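(* Let $A$ and $A'$ be gauge equivalent finite-dimensional unimodular Hopf algebras over the field $\Bbbk$. Let $\Lambda$ be a nonzero left integral in $A$. For any polynomial $\psi(X_1,\dots,X_s)\in\Bbbk[X_1,\dots,X_s]$, if $\psi(P_{n_1}(\Lambda),\dots,P_{n_s}(\Lambda))=0$ for some $n_1,\dots,n_s\in\mathbb{Z}$, then there exists a nonzero left integral $\Lambda'$ in $A'$ such that $\psi(P'_{n_1}(\Lambda'),\dots,P'_{n_s}(\Lambda'))=0$.
   Context: $\Bbbk$ is an arbitrary field. Two finite-dimensional Hopf algebras $A,A'$ over $\Bbbk$ are gauge equivalent if their categories of finite-dimensional left modules are equivalent as ($\Bbbk$-linear) tensor categories. A left integral $\Lambda\in A$ satisfies $a\Lambda=\varepsilon(a)\Lambda$ for all $a\in A$; $A$ is unimodular if its left integrals are also right integrals, i.e. $\Lambda a=\varepsilon(a)\Lambda$. For a Hopf algebra $A$ with comultiplication $\Delta(a)=a_{(1)}\otimes a_{(2)}$, counit $\varepsilon$ and antipode $S$, the $n$-th Sweedler power map $P_n:A\to A$ is $P_n(a)=a_{(1)}\cdots a_{(n)}$ for $n\ge1$, $P_0(a)=\varepsilon(a)1$, and $P_n(a)=S(a_{(-n)}\cdots a_{(1)})$ for $n\le-1$ (the factors being the $|n|$ tensor legs of the iterated comultiplication of $a$, multiplied in decreasing order of index). $P_n$ and $P'_n$ are the $n$-th Sweedler power maps of $A$ and $A'$. (For unimodular $A$ the elements $P_n(\Lambda)$ are central, so polynomial evaluation is unambiguous.) *)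

theory Defs
  imports
    "HOL-Library.Poly_Mapping"
    "Jordan_Normal_Form.Matrix"
begin

section \<open>Tensor powers of a vector space\<close>

text \<open>
  An element of a tensor power of a vector space \<open>A\<close> is written as a formal sum of pure tensors:
  the inner lists are the pure tensors \<open>x\<^sub>1 \<otimes> \<dots> \<otimes> x\<^sub>n\<close>, the outer list is the sum.
  Two such sums denote the same tensor iff they agree in the quotient of the free vector space on
  the lists over \<open>A\<close> by the subspace that expresses linearity in each leg.
\<close>

definition multilinear_relations ::
    "('k::field \<Rightarrow> 'a::ab_group_add \<Rightarrow> 'a) \<Rightarrow> ('a list \<Rightarrow>\<^sub>0 'k) set" where
  "multilinear_relations scale =
     {Poly_Mapping.single (us @ [x + y] @ vs) 1
        - Poly_Mapping.single (us @ [x] @ vs) 1 - Poly_Mapping.single (us @ [y] @ vs) 1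
      | us x y vs. True} \<union>
     {Poly_Mapping.single (us @ [scale c x] @ vs) 1 - Poly_Mapping.single (us @ [x] @ vs) c
      | us c x vs. True}"

definition formal_sum :: "'a list list \<Rightarrow> ('a list \<Rightarrow>\<^sub>0 'k::field)" where
  "formal_sum t = sum_list (map (\<lambda>xs. Poly_Mapping.single xs 1) t)"

definition tensor_eq ::
    "('k::field \<Rightarrow> 'a::ab_group_add \<Rightarrow> 'a) \<Rightarrow> 'a list list \<Rightarrow> 'a list list \<Rightarrow> bool" where
  "tensor_eq scale s t \<longleftrightarrow>
     formal_sum s - formal_sum t
       \<in> Modules.module.span (\<lambda>c p. Poly_Mapping.map ((*) c) p) (multilinear_relations scale)"


section \<open>Hopf algebras\<close>

text \<open>
  The underlying ring of a Hopf algebra is its type.  The comultiplication is given in Sweedler form: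
  \<open>comult H x\<close> lists the pairs \<open>(x\<^sub>1, x\<^sub>2)\<close> of some expression of the tensor \<open>\<Delta>(x)\<close> as a sum
  of pure tensors.  The expression chosen is immaterial: the axioms below only speak about the
  tensor it denotes, and everything computed from it is multilinear in the legs.
\<close>

record ('k, 'a) hopf =
  scale :: "'k \<Rightarrow> 'a \<Rightarrow> 'a"
  comult :: "'a \<Rightarrow> ('a \<times> 'a) list"
  counit :: "'a \<Rightarrow> 'k"
  antipode :: "'a \<Rightarrow> 'a"

abbreviation legs :: "('a \<times> 'a) list \<Rightarrow> 'a list list" where
  "legs t \<equiv> [[x, y]. (x, y) \<leftarrow> t]"

locale hopf_algebra =
  fixes H :: "('k::field, 'a::ring_1) hopf"
  assumes vector_space: "vector_space (scale H)"
    and scale_mult_left: "scale H c x * y = scale H c (x * y)"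
    and scale_mult_right: "x * scale H c y = scale H c (x * y)"
    and comult_add: "tensor_eq (scale H) (legs (comult H (x + y))) (legs (comult H x @ comult H y))"
    and comult_scale: "tensor_eq (scale H) (legs (comult H (scale H c x)))
          [[scale H c x1, x2]. (x1, x2) \<leftarrow> comult H x]"
    and comult_mult: "tensor_eq (scale H) (legs (comult H (x * y)))
          [[x1 * y1, x2 * y2]. (x1, x2) \<leftarrow> comult H x, (y1, y2) \<leftarrow> comult H y]"
    and comult_one: "tensor_eq (scale H) (legs (comult H 1)) [[1, 1]]"
    and coassoc: "tensor_eq (scale H)
          [[x11, x12, x2]. (x1, x2) \<leftarrow> comult H x, (x11, x12) \<leftarrow> comult H x1]
          [[x1, x21, x22]. (x1, x2) \<leftarrow> comult H x, (x21, x22) \<leftarrow> comult H x2]"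
    and counit_linear: "Vector_Spaces.linear (scale H) (*) (counit H)"
    and counit_mult: "counit H (x * y) = counit H x * counit H y"
    and counit_one: "counit H 1 = 1"
    and counit_left: "(\<Sum>(x1, x2) \<leftarrow> comult H x. scale H (counit H x1) x2) = x"
    and counit_right: "(\<Sum>(x1, x2) \<leftarrow> comult H x. scale H (counit H x2) x1) = x"
    and antipode_linear: "Vector_Spaces.linear (scale H) (scale H) (antipode H)"
    and antipode_left: "(\<Sum>(x1, x2) \<leftarrow> comult H x. antipode H x1 * x2) = scale H (counit H x) 1"
    and antipode_right: "(\<Sum>(x1, x2) \<leftarrow> comult H x. x1 * antipode H x2) = scale H (counit H x) 1"

locale fin_dim_hopf_algebra = hopf_algebra +
  assumes finite_dimensional: "\<exists>B. finite B \<and> Modules.module.span (scale H) B = UNIV"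

definition left_integral :: "('k::field, 'a::ring_1) hopf \<Rightarrow> 'a \<Rightarrow> bool" where
  "left_integral H \<Lambda> \<longleftrightarrow> (\<forall>a. a * \<Lambda> = scale H (counit H a) \<Lambda>)"

definition right_integral :: "('k::field, 'a::ring_1) hopf \<Rightarrow> 'a \<Rightarrow> bool" where
  "right_integral H \<Lambda> \<longleftrightarrow> (\<forall>a. \<Lambda> * a = scale H (counit H a) \<Lambda>)"

definition unimodular :: "('k::field, 'a::ring_1) hopf \<Rightarrow> bool" where
  "unimodular H \<longleftrightarrow> (\<forall>\<Lambda>. left_integral H \<Lambda> \<longrightarrow> right_integral H \<Lambda>)"

text \<open>\<open>iter_comult H m x\<close> has \<open>m + 1\<close> legs.\<close>

primrec iter_comult :: "('k, 'a) hopf \<Rightarrow> nat \<Rightarrow> 'a \<Rightarrow> 'a list list" where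
  "iter_comult H 0 x = [[x]]"
| "iter_comult H (Suc m) x = [x1 # xs. (x1, x2) \<leftarrow> comult H x, xs \<leftarrow> iter_comult H m x2]"

definition sweedler_power :: "('k::field, 'a::ring_1) hopf \<Rightarrow> int \<Rightarrow> 'a \<Rightarrow> 'a" where
  "sweedler_power H n x =
     (if n = 0 then scale H (counit H x) 1
      else if n > 0 then (\<Sum>xs \<leftarrow> iter_comult H (nat n - 1) x. prod_list xs)
      else antipode H (\<Sum>xs \<leftarrow> iter_comult H (nat (- n) - 1) x. prod_list (rev xs)))"


section \<open>The tensor category of finite-dimensional left modules\<close>

text \<open>
  A finite-dimensional left module is given in coordinates: its underlying space is \<open>k\<^sup>n\<close>
  (\<open>n = 0\<close> included) and the action is a representation by \<open>n \<times> n\<close> matrices.  With the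
  lexicographically ordered basis of \<open>k\<^sup>m \<otimes> k\<^sup>n = k\<^sup>m\<^sup>n\<close>, the tensor product of linear maps is the
  Kronecker product.  In these coordinates the associativity and unit constraints are identity
  matrices, i.e. the tensor category is strict (see \<open>tensor_rep_assoc\<close>, \<open>tensor_rep_unit_left\<close>
  and \<open>tensor_rep_unit_right\<close> below).
\<close>

type_synonym ('k, 'a) rep = "nat \<times> ('a \<Rightarrow> 'k mat)"

definition lmod :: "('k::field, 'a::ring_1) hopf \<Rightarrow> ('k, 'a) rep set" where
  "lmod H = {(n, \<rho>).
     (\<forall>x. \<rho> x \<in> carrier_mat n n) \<and>
     (\<forall>x y. \<rho> (x + y) = \<rho> x + \<rho> y) \<and>
     (\<forall>c x. \<rho> (scale H c x) = c \<cdot>\<^sub>m \<rho> x) \<and>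
     (\<forall>x y. \<rho> (x * y) = \<rho> x * \<rho> y) \<and>
     \<rho> 1 = 1\<^sub>m n}"

definition lmod_hom :: "('k::field, 'a) rep \<Rightarrow> ('k, 'a) rep \<Rightarrow> 'k mat set" where
  "lmod_hom V W = {T \<in> carrier_mat (fst W) (fst V). \<forall>x. T * snd V x = snd W x * T}"

definition lmod_iso :: "('k::field, 'a) rep \<Rightarrow> ('k, 'a) rep \<Rightarrow> 'k mat set" where
  "lmod_iso V W = {T \<in> lmod_hom V W. \<exists>T' \<in> lmod_hom W V. T' * T = 1\<^sub>m (fst V) \<and> T * T' = 1\<^sub>m (fst W)}"

definition kronecker :: "'k::semiring_0 mat \<Rightarrow> 'k mat \<Rightarrow> 'k mat" (infixr \<open>\<otimes>\<^sub>K\<close> 75) where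
  "S \<otimes>\<^sub>K T = mat (dim_row S * dim_row T) (dim_col S * dim_col T)
     (\<lambda>(i, j). S $$ (i div dim_row T, j div dim_col T) * T $$ (i mod dim_row T, j mod dim_col T))"

text \<open>The action of \<open>x\<close> on \<open>V \<otimes> W\<close> is that of \<open>\<Delta>(x)\<close>.\<close>

definition tensor_rep ::
    "('k::field, 'a) hopf \<Rightarrow> ('k, 'a) rep \<Rightarrow> ('k, 'a) rep \<Rightarrow> ('k, 'a) rep" where
  "tensor_rep H V W =
     (fst V * fst W,
      \<lambda>x. foldr (\<lambda>(x1, x2) T. snd V x1 \<otimes>\<^sub>K snd W x2 + T) (comult H x)
            (0\<^sub>m (fst V * fst W) (fst V * fst W)))"

definition unit_rep :: "('k::field, 'a) hopf \<Rightarrow> ('k, 'a) rep" where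
  "unit_rep H = (1, \<lambda>x. counit H x \<cdot>\<^sub>m 1\<^sub>m 1)"


subsection \<open>Strictness\<close>

lemma lookup_map_mult: "Poly_Mapping.lookup (Poly_Mapping.map ((*) c) p) k = c * Poly_Mapping.lookup p k"
  for c :: "'k::field"
  by (simp add: Poly_Mapping.map.rep_eq when_def)

lemma module_scale_poly_mapping:
  "Modules.module (\<lambda>(c::'k::field) (p::'a \<Rightarrow>\<^sub>0 'k). Poly_Mapping.map ((*) c) p)"
  by unfold_locales
     (auto intro!: poly_mapping_eqI simp: lookup_map_mult lookup_add algebra_simps)

lemma sum_list_eq_if_tensor_eq:
  fixes f :: "'a::ab_group_add list \<Rightarrow> 'k::field"
  assumes eq: "tensor_eq sc s t"
    and add: "\<And>us x y vs. f (us @ [x + y] @ vs) = f (us @ [x] @ vs) + f (us @ [y] @ vs)"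
    and sc: "\<And>us c x vs. f (us @ [sc c x] @ vs) = c * f (us @ [x] @ vs)"
  shows "sum_list (map f s) = sum_list (map f t)"
proof -
  define L where "L p = (\<Sum>k \<in> Poly_Mapping.keys p. Poly_Mapping.lookup p k * f k)" for p :: "'a list \<Rightarrow>\<^sub>0 'k"
  have L_eq: "L p = (\<Sum>k \<in> K. Poly_Mapping.lookup p k * f k)" if "finite K" "Poly_Mapping.keys p \<subseteq> K" for p K
    unfolding L_def using that by (intro sum.mono_neutral_left) (auto simp: in_keys_iff)
  have L_add: "L (p + q) = L p + L q" for p q
    using L_eq[of "Poly_Mapping.keys p \<union> Poly_Mapping.keys q" "p + q"] L_eq[of "Poly_Mapping.keys p \<union> Poly_Mapping.keys q" p]
      L_eq[of "Poly_Mapping.keys p \<union> Poly_Mapping.keys q" q] Poly_Mapping.keys_add[of p q]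
    by (simp add: lookup_add sum.distrib distrib_right)
  have L_minus: "L (p - q) = L p - L q" for p q
    using L_add[of "p - q" q] by simp
  have L_scale: "L (Poly_Mapping.map ((*) c) p) = c * L p" for c p
  proof -
    have "Poly_Mapping.keys (Poly_Mapping.map ((*) c) p) \<subseteq> Poly_Mapping.keys p"
      by (auto simp: in_keys_iff lookup_map_mult)
    then show ?thesis
      using L_eq[of "Poly_Mapping.keys p" "Poly_Mapping.map ((*) c) p"]
      by (simp add: L_def lookup_map_mult sum_distrib_left mult.assoc)
  qed
  have L_single: "L (Poly_Mapping.single k c) = c * f k" for k c
    by (cases "c = 0") (auto simp: L_def)
  have L_formal: "L (formal_sum u) = sum_list (map f u)" for u
    by (induction u) (auto simp: formal_sum_def L_add L_single, simp add: L_def)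
  have "L p = 0" if "p \<in> Modules.module.span (\<lambda>c p. Poly_Mapping.map ((*) c) p) (multilinear_relations sc)" for p
    using that
  proof (induction rule: Modules.module.span_induct_alt[OF module_scale_poly_mapping, consumes 1, case_names base step])
    case base
    show ?case by (simp add: L_def)
  next
    case (step c p q)
    have "L p = 0"
      using step(1) add sc
      by (auto simp: multilinear_relations_def L_minus L_single simp del: append_Cons append_Nil)
    then show ?case using step by (simp add: L_add L_scale)
  qed
  then have "L (formal_sum s - formal_sum t) = 0"
    using eq by (simp add: tensor_eq_def)
  then show ?thesis by (simp add: L_minus L_formal)
qed

lemma kronecker_carrier [simp]:
  "S \<in> carrier_mat m n \<Longrightarrow> T \<in> carrier_mat p q \<Longrightarrow> S \<otimes>\<^sub>K T \<in> carrier_mat (m * p) (n * q)"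
  by (auto simp: kronecker_def)

lemma less_mult_div_mod: "i < a * b \<Longrightarrow> i div b < a \<and> i mod b < b" for i :: nat
proof -
  assume i: "i < a * b"
  then have "0 < b" by (cases b) simp_all
  then show ?thesis using less_mult_imp_div_less[OF i] mod_less_divisor by blast
qed

lemma div_mod_nested:
  fixes i v w :: nat
  shows "i div (v * w) = i div w div v"
    and "i mod (v * w) div w = i div w mod v"
    and "i mod (v * w) mod w = i mod w"
proof -
  show "i div (v * w) = i div w div v"
    unfolding mult.commute[of v] by (rule div_mult2_eq)
  show "i mod (v * w) mod w = i mod w"
    by (rule mod_mod_cancel) (rule dvd_triv_right)
  show "i mod (v * w) div w = i div w mod v"
    unfolding mult.commute[of v] mod_mult2_eq by (cases "w = 0") simp_all
qed

lemma kronecker_index: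
  "i < dim_row S * dim_row T \<Longrightarrow> j < dim_col S * dim_col T \<Longrightarrow> (S \<otimes>\<^sub>K T) $$ (i, j) =
    S $$ (i div dim_row T, j div dim_col T) * T $$ (i mod dim_row T, j mod dim_col T)"
  and kronecker_dim [simp]: "dim_row (S \<otimes>\<^sub>K T) = dim_row S * dim_row T"
    "dim_col (S \<otimes>\<^sub>K T) = dim_col S * dim_col T"
  by (simp_all add: kronecker_def)

lemma kronecker_assoc: "(R \<otimes>\<^sub>K S) \<otimes>\<^sub>K T = R \<otimes>\<^sub>K (S \<otimes>\<^sub>K T)" for R S T :: "'k::semiring_0 mat"
proof (rule eq_matI)
  fix i j
  assume "i < dim_row (R \<otimes>\<^sub>K (S \<otimes>\<^sub>K T))" "j < dim_col (R \<otimes>\<^sub>K (S \<otimes>\<^sub>K T))"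
  then have ij: "i < dim_row R * (dim_row S * dim_row T)" "j < dim_col R * (dim_col S * dim_col T)"
    by simp_all
  then have ij': "i < dim_row R * dim_row S * dim_row T" "j < dim_col R * dim_col S * dim_col T"
    by (simp_all only: mult.assoc)
  note b = less_mult_div_mod[OF ij'(1)] less_mult_div_mod[OF ij'(2)]
    less_mult_div_mod[OF ij(1)] less_mult_div_mod[OF ij(2)]
  show "((R \<otimes>\<^sub>K S) \<otimes>\<^sub>K T) $$ (i, j) = (R \<otimes>\<^sub>K (S \<otimes>\<^sub>K T)) $$ (i, j)"
    unfolding kronecker_index[of i "R \<otimes>\<^sub>K S" T j, unfolded kronecker_dim, OF ij']
      kronecker_index[of i R "S \<otimes>\<^sub>K T" j, unfolded kronecker_dim, OF ij]
      kronecker_index[OF conjunct1[OF b(1)] conjunct1[OF b(2)]]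
      kronecker_index[OF conjunct2[OF b(3)] conjunct2[OF b(4)]]
      div_mod_nested mult.assoc ..
qed (simp_all add: mult.assoc)

lemma lmod_carrier: "V \<in> lmod H \<Longrightarrow> snd V x \<in> carrier_mat (fst V) (fst V)"
  unfolding lmod_def by (cases V) (simp only: mem_Collect_eq prod.case fst_conv snd_conv)

lemma index_tensor_rep:
  assumes V: "\<And>x. snd V x \<in> carrier_mat (fst V) (fst V)"
    and W: "\<And>x. snd W x \<in> carrier_mat (fst W) (fst W)"
  shows "snd (tensor_rep H V W) x \<in> carrier_mat (fst V * fst W) (fst V * fst W)" (is ?A)
    and "i < fst V * fst W \<Longrightarrow> j < fst V * fst W \<Longrightarrow> snd (tensor_rep H V W) x $$ (i, j) =
          (\<Sum>(x1, x2) \<leftarrow> comult H x. snd V x1 $$ (i div fst W, j div fst W) * snd W x2 $$ (i mod fst W, j mod fst W))"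
proof -
  let ?f = "\<lambda>t. foldr (\<lambda>(x1, x2) T. snd V x1 \<otimes>\<^sub>K snd W x2 + T) t (0\<^sub>m (fst V * fst W) (fst V * fst W))"
  have dims: "dim_row (snd V x) = fst V" "dim_col (snd V x) = fst V"
     "dim_row (snd W x) = fst W" "dim_col (snd W x) = fst W" for x
    by (rule carrier_matD[OF V] carrier_matD[OF W])+
  have c: "?f t \<in> carrier_mat (fst V * fst W) (fst V * fst W)" for t
  proof (induction t)
    case (Cons p t)
    obtain x1 x2 where p: "p = (x1, x2)" by (cases p)
    show ?case
      unfolding p using add_carrier_mat[OF Cons] by simp
  qed simp
  show ?A unfolding tensor_rep_def snd_conv by (rule c)
  have e: "?f t $$ (i, j) = (\<Sum>(x1, x2) \<leftarrow> t. snd V x1 $$ (i div fst W, j div fst W) * snd W x2 $$ (i mod fst W, j mod fst W))"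
    if "i < fst V * fst W" "j < fst V * fst W" for t i j
    using that
  proof (induction t)
    case (Cons p t)
    obtain x1 x2 where p: "p = (x1, x2)" by (cases p)
    have d: "dim_row (?f t) = fst V * fst W" "dim_col (?f t) = fst V * fst W"
      using c[of t] by (simp_all only: carrier_mat_def mem_Collect_eq)
    have "?f (p # t) $$ (i, j) = (snd V x1 \<otimes>\<^sub>K snd W x2) $$ (i, j) + ?f t $$ (i, j)"
      unfolding p using Cons.prems d by simp
    also have "(snd V x1 \<otimes>\<^sub>K snd W x2) $$ (i, j)
        = snd V x1 $$ (i div fst W, j div fst W) * snd W x2 $$ (i mod fst W, j mod fst W)"
      using kronecker_index[of i "snd V x1" "snd W x2" j] Cons.prems by (simp only: dims)
    finally show ?case using Cons by (simp only: p) simp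
  qed simp
  show "i < fst V * fst W \<Longrightarrow> j < fst V * fst W \<Longrightarrow> snd (tensor_rep H V W) x $$ (i, j) =
          (\<Sum>(x1, x2) \<leftarrow> comult H x. snd V x1 $$ (i div fst W, j div fst W) * snd W x2 $$ (i mod fst W, j mod fst W))"
    unfolding tensor_rep_def snd_conv by (rule e)
qed

lemma legs3_multilinear:
  fixes f :: "'a::ab_group_add \<Rightarrow> 'a \<Rightarrow> 'a \<Rightarrow> 'k::field"
  assumes eq: "tensor_eq sc [[x, y, z]. (x, y, z) \<leftarrow> s] [[x, y, z]. (x, y, z) \<leftarrow> t]"
    and "\<And>x x' y z. f (x + x') y z = f x y z + f x' y z" "\<And>c x y z. f (sc c x) y z = c * f x y z"
    and "\<And>x y y' z. f x (y + y') z = f x y z + f x y' z" "\<And>c x y z. f x (sc c y) z = c * f x y z"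
    and "\<And>x y z z'. f x y (z + z') = f x y z + f x y z'" "\<And>c x y z. f x y (sc c z) = c * f x y z"
  shows "(\<Sum>(x, y, z) \<leftarrow> s. f x y z) = (\<Sum>(x, y, z) \<leftarrow> t. f x y z)"
proof -
  define g where "g xs = (if length xs = 3 then f (xs ! 0) (xs ! 1) (xs ! 2) else 0)" for xs
  have us: "us = [] \<or> (\<exists>a. us = [a]) \<or> (\<exists>a b. us = [a, b]) \<or> length us \<ge> 3" for us :: "'a list"
  proof (cases us)
    case (Cons a vs)
    then show ?thesis by (cases vs; cases "tl vs") auto
  qed simp
  have "sum_list (map g [[x, y, z]. (x, y, z) \<leftarrow> s]) = sum_list (map g [[x, y, z]. (x, y, z) \<leftarrow> t])"
  proof (rule sum_list_eq_if_tensor_eq[OF eq])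
    show "g (us @ [x + y] @ vs) = g (us @ [x] @ vs) + g (us @ [y] @ vs)" for us x y vs
      using us[of us] by (elim disjE exE) (simp_all add: g_def assms(2,4,6))
    show "g (us @ [sc c x] @ vs) = c * g (us @ [x] @ vs)" for us c x vs
      using us[of us] by (elim disjE exE) (simp_all add: g_def assms(3,5,7))
  qed
  moreover have "sum_list (map g [[x, y, z]. (x, y, z) \<leftarrow> u]) = (\<Sum>(x, y, z) \<leftarrow> u. f x y z)" for u
    by (induction u) (auto simp: g_def)
  ultimately show ?thesis by (simp only:)
qed

lemma lmod_entries:
  assumes "V \<in> lmod H" "i < fst V" "j < fst V"
  shows "snd V (x + y) $$ (i, j) = snd V x $$ (i, j) + snd V y $$ (i, j)"
    and "snd V (scale H c x) $$ (i, j) = c * snd V x $$ (i, j)"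
proof -
  have c: "snd V x \<in> carrier_mat (fst V) (fst V)" for x
    using assms lmod_carrier by blast
  have "snd V (x + y) = snd V x + snd V y" "snd V (scale H c x) = c \<cdot>\<^sub>m snd V x"
    using assms unfolding lmod_def by (cases V; simp only: mem_Collect_eq prod.case snd_conv)+
  then show "snd V (x + y) $$ (i, j) = snd V x $$ (i, j) + snd V y $$ (i, j)"
    "snd V (scale H c x) $$ (i, j) = c * snd V x $$ (i, j)"
    using c[of x] c[of y] assms(2,3) by auto
qed

lemma sum_list_concat_pairs:
  "(\<Sum>p \<leftarrow> concat (map h t). g p) = (\<Sum>q \<leftarrow> t. \<Sum>p \<leftarrow> h q. g p)"
  by (induction t) auto

lemma tensor_rep_assoc:
  assumes H: "hopf_algebra H" and lmod: "U \<in> lmod H" "V \<in> lmod H" "W \<in> lmod H"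
  shows "tensor_rep H (tensor_rep H U V) W = tensor_rep H U (tensor_rep H V W)"
proof -
  define u v w where "u = fst U" and "v = fst V" and "w = fst W"
  note c = lmod_carrier[OF lmod(1)] lmod_carrier[OF lmod(2)] lmod_carrier[OF lmod(3)]
  have fst_UV: "fst (tensor_rep H U V) = u * v" and fst_VW: "fst (tensor_rep H V W) = v * w"
    by (simp_all add: tensor_rep_def u_def v_def w_def)
  have cUV: "snd (tensor_rep H U V) x \<in> carrier_mat (fst (tensor_rep H U V)) (fst (tensor_rep H U V))"
    and cVW: "snd (tensor_rep H V W) x \<in> carrier_mat (fst (tensor_rep H V W)) (fst (tensor_rep H V W))" for x
    unfolding fst_UV fst_VW u_def v_def w_def using c by (auto intro!: index_tensor_rep(1))
  have "snd (tensor_rep H (tensor_rep H U V) W) x = snd (tensor_rep H U (tensor_rep H V W)) x" (is "?L = ?R") for x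
  proof (rule eq_matI)
    have L: "?L \<in> carrier_mat (u * v * w) (u * v * w)"
      using index_tensor_rep(1)[OF cUV c(3)] by (simp add: fst_UV w_def)
    have R: "?R \<in> carrier_mat (u * v * w) (u * v * w)"
      using index_tensor_rep(1)[OF c(1) cVW] by (simp add: fst_VW u_def mult.assoc)
    from L R show "dim_row ?L = dim_row ?R" "dim_col ?L = dim_col ?R" by auto
    fix i j assume "i < dim_row ?R" "j < dim_col ?R"
    with R have ij: "i < u * v * w" "j < u * v * w" by auto
    then have ij': "i < u * (v * w)" "j < u * (v * w)" by (simp_all add: mult.assoc)
    note b = less_mult_div_mod[OF ij(1)] less_mult_div_mod[OF ij(2)]
    note b' = less_mult_div_mod[OF conjunct1[OF b(1)]] less_mult_div_mod[OF conjunct1[OF b(2)]]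
    note b'' = less_mult_div_mod[OF ij'(1)] less_mult_div_mod[OF ij'(2)]
    define f where "f x y z = snd U x $$ (i div w div v, j div w div v) *
      snd V y $$ (i div w mod v, j div w mod v) * snd W z $$ (i mod w, j mod w)" for x y z
    have "?L $$ (i, j) = (\<Sum>(x1, x2) \<leftarrow> comult H x. \<Sum>(x11, x12) \<leftarrow> comult H x1. f x11 x12 x2)"
      using index_tensor_rep(2)[OF cUV c(3)] index_tensor_rep(2)[OF c(1,2)] ij b
      by (simp add: fst_UV flip: u_def v_def w_def)
         (simp add: f_def split_def sum_list_mult_const)
    also have "\<dots> = (\<Sum>(x, y, z) \<leftarrow> [(x11, x12, x2). (x1, x2) \<leftarrow> comult H x, (x11, x12) \<leftarrow> comult H x1]. f x y z)"
      by (simp add: sum_list_concat_pairs split_def comp_def)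
    also have "\<dots> = (\<Sum>(x, y, z) \<leftarrow> [(x1, x21, x22). (x1, x2) \<leftarrow> comult H x, (x21, x22) \<leftarrow> comult H x2]. f x y z)"
    proof (rule legs3_multilinear)
      show "tensor_eq (scale H)
         [[x, y, z]. (x, y, z) \<leftarrow> [(x11, x12, x2). (x1, x2) \<leftarrow> comult H x, (x11, x12) \<leftarrow> comult H x1]]
         [[x, y, z]. (x, y, z) \<leftarrow> [(x1, x21, x22). (x1, x2) \<leftarrow> comult H x, (x21, x22) \<leftarrow> comult H x2]]"
        using hopf_algebra.coassoc[OF H, of x] by (simp add: map_concat comp_def split_def)
    qed (use b b' in \<open>simp_all add: f_def u_def v_def w_def lmod_entries[OF lmod(1)]
          lmod_entries[OF lmod(2)] lmod_entries[OF lmod(3)] algebra_simps\<close>)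
    also have "\<dots> = (\<Sum>(x1, x2) \<leftarrow> comult H x. \<Sum>(x21, x22) \<leftarrow> comult H x2. f x1 x21 x22)"
      by (simp add: sum_list_concat_pairs split_def comp_def)
    also have "\<dots> = ?R $$ (i, j)"
      using index_tensor_rep(2)[OF c(1) cVW] index_tensor_rep(2)[OF c(2,3)] ij' b''
      by (simp add: fst_VW div_mod_nested flip: u_def v_def w_def)
         (simp add: f_def split_def mult.assoc sum_list_const_mult)
    finally show "?L $$ (i, j) = ?R $$ (i, j)" .
  qed
  moreover have "fst (tensor_rep H (tensor_rep H U V) W) = fst (tensor_rep H U (tensor_rep H V W))"
    by (simp add: tensor_rep_def mult.assoc)
  ultimately show ?thesis
    by (auto intro!: prod_eqI)
qed

lemma lmod_sum_list:
  assumes H: "hopf_algebra H" and V: "V \<in> lmod H" and ij: "i < fst V" "j < fst V"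
  shows "snd V (sum_list xs) $$ (i, j) = (\<Sum>x \<leftarrow> xs. snd V x $$ (i, j))"
proof (induction xs)
  case Nil
  have "snd V 0 $$ (i, j) + 0 = snd V 0 $$ (i, j) + snd V 0 $$ (i, j)"
    using lmod_entries(1)[OF V ij, of 0 0] by (simp only: add_0_right)
  then show ?case by (simp only: add_left_cancel) simp
qed (simp add: lmod_entries(1)[OF V ij])

lemma tensor_rep_unit_left:
  assumes H: "hopf_algebra H" and V: "V \<in> lmod H"
  shows "tensor_rep H (unit_rep H) V = V"
proof -
  have c: "snd (unit_rep H) x \<in> carrier_mat (fst (unit_rep H)) (fst (unit_rep H))" for x
    by (simp add: unit_rep_def)
  have "snd (tensor_rep H (unit_rep H) V) x = snd V x" for x
  proof (rule eq_matI)
    fix i j assume "i < dim_row (snd V x)" "j < dim_col (snd V x)"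
    then have ij: "i < fst V" "j < fst V" using lmod_carrier[OF V, of x] by auto
    then have "snd (tensor_rep H (unit_rep H) V) x $$ (i, j) =
        (\<Sum>(x1, x2) \<leftarrow> comult H x. snd V (scale H (counit H x1) x2) $$ (i, j))"
      using index_tensor_rep(2)[OF c lmod_carrier[OF V], of i j H x]
      by (simp add: unit_rep_def lmod_entries(2)[OF V ij])
    also have "\<dots> = snd V (\<Sum>(x1, x2) \<leftarrow> comult H x. scale H (counit H x1) x2) $$ (i, j)"
      by (simp add: lmod_sum_list[OF H V ij] comp_def split_def)
    finally show "snd (tensor_rep H (unit_rep H) V) x $$ (i, j) = snd V x $$ (i, j)"
      by (simp add: hopf_algebra.counit_left[OF H])
  qed (use index_tensor_rep(1)[OF c lmod_carrier[OF V], of H x] lmod_carrier[OF V, of x] in \<open>auto simp: unit_rep_def\<close>)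
  then show ?thesis
    by (intro prod_eqI ext) (simp_all add: tensor_rep_def unit_rep_def)
qed

lemma tensor_rep_unit_right:
  assumes H: "hopf_algebra H" and V: "V \<in> lmod H"
  shows "tensor_rep H V (unit_rep H) = V"
proof -
  have c: "snd (unit_rep H) x \<in> carrier_mat (fst (unit_rep H)) (fst (unit_rep H))" for x
    by (simp add: unit_rep_def)
  have "snd (tensor_rep H V (unit_rep H)) x = snd V x" for x
  proof (rule eq_matI)
    fix i j assume "i < dim_row (snd V x)" "j < dim_col (snd V x)"
    then have ij: "i < fst V" "j < fst V" using lmod_carrier[OF V, of x] by auto
    then have "snd (tensor_rep H V (unit_rep H)) x $$ (i, j) =
        (\<Sum>(x1, x2) \<leftarrow> comult H x. snd V (scale H (counit H x2) x1) $$ (i, j))"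
      using index_tensor_rep(2)[OF lmod_carrier[OF V] c, of i j H x]
      by (simp add: unit_rep_def lmod_entries(2)[OF V ij] mult.commute)
    also have "\<dots> = snd V (\<Sum>(x1, x2) \<leftarrow> comult H x. scale H (counit H x2) x1) $$ (i, j)"
      by (simp add: lmod_sum_list[OF H V ij] comp_def split_def)
    finally show "snd (tensor_rep H V (unit_rep H)) x $$ (i, j) = snd V x $$ (i, j)"
      by (simp add: hopf_algebra.counit_right[OF H])
  qed (use index_tensor_rep(1)[OF lmod_carrier[OF V] c, of H x] lmod_carrier[OF V, of x] in \<open>auto simp: unit_rep_def\<close>)
  then show ?thesis
    by (intro prod_eqI ext) (simp_all add: tensor_rep_def unit_rep_def)
qed


section \<open>Gauge equivalence\<close>

record ('k, 'a, 'b) rep_functor =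
  on_ob :: "('k, 'a) rep \<Rightarrow> ('k, 'b) rep"
  on_hom :: "('k, 'a) rep \<Rightarrow> ('k, 'a) rep \<Rightarrow> 'k mat \<Rightarrow> 'k mat"

definition id_functor :: "('k, 'a, 'a) rep_functor" where
  "id_functor = \<lparr>on_ob = (\<lambda>V. V), on_hom = (\<lambda>V W T. T)\<rparr>"

definition comp_functor ::
    "('k, 'b, 'c) rep_functor \<Rightarrow> ('k, 'a, 'b) rep_functor \<Rightarrow> ('k, 'a, 'c) rep_functor" where
  "comp_functor G F = \<lparr>on_ob = (\<lambda>V. on_ob G (on_ob F V)),
     on_hom = (\<lambda>V W T. on_hom G (on_ob F V) (on_ob F W) (on_hom F V W T))\<rparr>"

locale linear_functor =
  fixes H :: "('k::field, 'a::ring_1) hopf" and H' :: "('k, 'b::ring_1) hopf"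
    and F :: "('k, 'a, 'b) rep_functor"
  assumes ob: "V \<in> lmod H \<Longrightarrow> on_ob F V \<in> lmod H'"
    and hom: "\<lbrakk>V \<in> lmod H; W \<in> lmod H; T \<in> lmod_hom V W\<rbrakk>
          \<Longrightarrow> on_hom F V W T \<in> lmod_hom (on_ob F V) (on_ob F W)"
    and id: "V \<in> lmod H \<Longrightarrow> on_hom F V V (1\<^sub>m (fst V)) = 1\<^sub>m (fst (on_ob F V))"
    and comp: "\<lbrakk>U \<in> lmod H; V \<in> lmod H; W \<in> lmod H; S \<in> lmod_hom U V; T \<in> lmod_hom V W\<rbrakk>
          \<Longrightarrow> on_hom F U W (T * S) = on_hom F V W T * on_hom F U V S"
    and add: "\<lbrakk>V \<in> lmod H; W \<in> lmod H; S \<in> lmod_hom V W; T \<in> lmod_hom V W\<rbrakk>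
          \<Longrightarrow> on_hom F V W (S + T) = on_hom F V W S + on_hom F V W T"
    and scale: "\<lbrakk>V \<in> lmod H; W \<in> lmod H; T \<in> lmod_hom V W\<rbrakk>
          \<Longrightarrow> on_hom F V W (c \<cdot>\<^sub>m T) = c \<cdot>\<^sub>m on_hom F V W T"

definition natural_iso ::
    "('k::field, 'a::ring_1) hopf \<Rightarrow> ('k, 'a, 'b) rep_functor \<Rightarrow> ('k, 'a, 'b) rep_functor
      \<Rightarrow> (('k, 'a) rep \<Rightarrow> 'k mat) \<Rightarrow> bool" where
  "natural_iso H F G \<eta> \<longleftrightarrow>
     (\<forall>V \<in> lmod H. \<eta> V \<in> lmod_iso (on_ob F V) (on_ob G V)) \<and>
     (\<forall>V \<in> lmod H. \<forall>W \<in> lmod H. \<forall>T \<in> lmod_hom V W.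
        \<eta> W * on_hom F V W T = on_hom G V W T * \<eta> V)"

locale linear_equivalence = linear_functor +
  assumes quasi_inverse: "\<exists>G \<eta> \<theta>. linear_functor H' H G \<and>
      natural_iso H id_functor (comp_functor G F) \<eta> \<and>
      natural_iso H' (comp_functor F G) id_functor \<theta>"

text \<open>
  \<open>J V W : F(V) \<otimes> F(W) \<rightarrow> F(V \<otimes> W)\<close> and \<open>\<phi> : 1 \<rightarrow> F(1)\<close> are the structure isomorphisms of a
  (strong) tensor functor; the constraints of the two module categories are omitted from the
  coherence axioms since they are identities.
\<close>

locale tensor_functor = linear_functor +
  fixes J :: "('k::field, 'a::ring_1) rep \<Rightarrow> ('k, 'a) rep \<Rightarrow> 'k mat" and \<phi> :: "'k mat"
  assumes J_iso: "\<lbrakk>V \<in> lmod H; W \<in> lmod H\<rbrakk>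
        \<Longrightarrow> J V W \<in> lmod_iso (tensor_rep H' (on_ob F V) (on_ob F W)) (on_ob F (tensor_rep H V W))"
    and J_natural:
      "\<lbrakk>V \<in> lmod H; W \<in> lmod H; V' \<in> lmod H; W' \<in> lmod H; S \<in> lmod_hom V V'; T \<in> lmod_hom W W'\<rbrakk>
        \<Longrightarrow> J V' W' * (on_hom F V V' S \<otimes>\<^sub>K on_hom F W W' T)
          = on_hom F (tensor_rep H V W) (tensor_rep H V' W') (S \<otimes>\<^sub>K T) * J V W"
    and \<phi>_iso: "\<phi> \<in> lmod_iso (unit_rep H') (on_ob F (unit_rep H))"
    and J_assoc: "\<lbrakk>U \<in> lmod H; V \<in> lmod H; W \<in> lmod H\<rbrakk>
        \<Longrightarrow> J (tensor_rep H U V) W * (J U V \<otimes>\<^sub>K 1\<^sub>m (fst (on_ob F W)))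
          = J U (tensor_rep H V W) * (1\<^sub>m (fst (on_ob F U)) \<otimes>\<^sub>K J V W)"
    and J_unit_left: "V \<in> lmod H
        \<Longrightarrow> J (unit_rep H) V * (\<phi> \<otimes>\<^sub>K 1\<^sub>m (fst (on_ob F V))) = 1\<^sub>m (fst (on_ob F V))"
    and J_unit_right: "V \<in> lmod H
        \<Longrightarrow> J V (unit_rep H) * (1\<^sub>m (fst (on_ob F V)) \<otimes>\<^sub>K \<phi>) = 1\<^sub>m (fst (on_ob F V))"

definition gauge_equivalent ::
    "('k::field, 'a::ring_1) hopf \<Rightarrow> ('k, 'b::ring_1) hopf \<Rightarrow> bool" where
  "gauge_equivalent H H' \<longleftrightarrow>
     (\<exists>F J \<phi>. linear_equivalence H H' F \<and> tensor_functor H H' F J \<phi>)"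


section \<open>Evaluation of polynomials\<close>

text \<open>
  A polynomial in the variables \<open>X\<^sub>0, X\<^sub>1, \<dots>\<close> is a finitely supported function on exponent
  vectors.  The factors of a monomial are multiplied in the order of the variables; this is the
  usual evaluation whenever the elements substituted for the variables commute.
\<close>

type_synonym 'k polynomial = "(nat \<Rightarrow>\<^sub>0 nat) \<Rightarrow>\<^sub>0 'k"

definition in_variables :: "nat \<Rightarrow> 'k::zero polynomial \<Rightarrow> bool" where
  "in_variables s \<psi> \<longleftrightarrow> (\<forall>e \<in> Poly_Mapping.keys \<psi>. Poly_Mapping.keys e \<subseteq> {..<s})"

definition eval_poly ::
    "('k::field, 'a::ring_1) hopf \<Rightarrow> nat \<Rightarrow> 'k polynomial \<Rightarrow> (nat \<Rightarrow> 'a) \<Rightarrow> 'a" where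
  "eval_poly H s \<psi> x =
     (\<Sum>e \<in> Poly_Mapping.keys \<psi>. scale H (Poly_Mapping.lookup \<psi> e)
        (prod_list (map (\<lambda>i. x i ^ Poly_Mapping.lookup e i) [0..<s])))"

end

theory Submission
  imports Defs
begin

text \<open>
  On every module \<open>V\<close> a two-sided integral \<open>\<Lambda>\<close> acts as a sum \<open>\<Sum>\<^sub>k p\<^sub>k q\<^sub>k\<close> of \<open>H\<close>-linear maps
  \<open>q\<^sub>k : V \<rightarrow> 1\<close>, \<open>p\<^sub>k : 1 \<rightarrow> V\<close>.  Decompose in this way its action on \<open>V\<^sup>\<otimes>\<^sup>n = V \<otimes> W = W \<otimes> V\<close>, where
  \<open>W\<close> is the tensor power with one factor less.  Multiplying the legs of \<open>\<Delta>(\<Lambda>)\<close> means feeding the output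
  of each leg into the next one, and since \<open>p\<^sub>k q\<^sub>k\<close> is disconnected, this is a planar diagram: the \<open>n\<close>-th
  Sweedler power of \<open>\<Lambda>\<close> acts on \<open>V\<close> as \<open>\<Sum>\<^sub>k (V \<otimes> q\<^sub>k) (p\<^sub>k \<otimes> V)\<close>, and the product of the legs in reversed
  order acts as \<open>\<Sum>\<^sub>k (q\<^sub>k \<otimes> V) (V \<otimes> p\<^sub>k)\<close>.  Such diagrams are preserved by tensor functors.  The antipode of
  an element acting by \<open>H\<close>-linear maps is preserved as well, since it is the transpose of the action on the dual module.  Hence
  the element \<open>\<Lambda>'\<close> that acts on each \<open>F(V)\<close> as \<open>F(\<Lambda>)\<close> is an integral whose Sweedler powers
  correspond to those of \<open>\<Lambda>\<close>, and \<open>F\<close> carries one polynomial identity to the other.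
\<close>

section \<open>Matrices\<close>

text \<open>Planarity matters because the flip of two modules is in general not linear over the Hopf
  algebra: a tensor functor sees no crossing of strands, and \<open>F\<close> is not assumed to
  commute with the underlying vector spaces. Invariance on both sides makes the splitting possible:
  the maps out of the trivial module come from the left integral property, the maps into it from the
  right one, and unimodularity of \<open>A\<close> supplies the second. For the antipode, the dual
  of \<open>F(V)\<close> is not identified with the image of the dual of \<open>V\<close>. Instead
  the antipode is recognised as the adjoint for any invariant pairing, in particular for the image
  of the evaluation. Finally, an element acting linearly on every module is a natural endomorphism
  of the identity functor. Fullness of \<open>F\<close> and a module whose image is isomorphic to
  the regular module turn it back into an element on the other side. This correspondence respects
  the algebra operations, and faithfulness of \<open>F\<close> keeps \<open>\<Lambda>'\<close>
  nonzero.\<close>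

lemma sum_lessThan_mult: "(\<Sum>t<m * p. g t) = (\<Sum>i<m. \<Sum>k<p. g (i * p + k))" for m p :: nat
proof (induction m)
  case (Suc m)
  have split: "(\<Sum>t<a + p. g t) = (\<Sum>t<a. g t) + (\<Sum>k<p. g (a + k))" for a
    by (induction p) (auto simp: add.assoc)
  show ?case using split[of "m * p"] Suc by (simp add: add.commute)
qed simp

lemma index_pair_less: "i < m \<Longrightarrow> k < p \<Longrightarrow> i * p + k < m * p" for i :: nat
proof -
  assume "i < m" "k < p"
  then have "i * p + k < Suc i * p" "Suc i * p \<le> m * p"
    by (simp, intro mult_le_mono1) simp
  then show ?thesis by (rule less_le_trans)
qed

lemma index_mult_mat_sum:
  "A \<in> carrier_mat m n \<Longrightarrow> B \<in> carrier_mat n p \<Longrightarrow> i < m \<Longrightarrow> j < p \<Longrightarrow>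
    (A * B) $$ (i, j) = (\<Sum>k<n. A $$ (i, k) * B $$ (k, j))"
  by (auto simp: scalar_prod_def lessThan_atLeast0 intro!: sum.cong)

text \<open>Quotient and remainder identify the indices below \<open>m * p\<close> with the pairs
  \<open>i * p + k\<close>, which is the basis order of \<open>\<otimes>\<^sub>K\<close>. Matrices
  on tensor products are compared on such pairs.\<close>

lemma eq_mat_pairI:
  assumes "A \<in> carrier_mat (m * p) (n * q)" "B \<in> carrier_mat (m * p) (n * q)"
    and eq: "\<And>i k j l. i < m \<Longrightarrow> k < p \<Longrightarrow> j < n \<Longrightarrow> l < q \<Longrightarrow>
      A $$ (i * p + k, j * q + l) = B $$ (i * p + k, j * q + l)"
  shows "A = B"
proof (rule eq_matI)
  fix r c assume "r < dim_row B" "c < dim_col B"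
  then have rc: "r < m * p" "c < n * q" using assms by auto
  show "A $$ (r, c) = B $$ (r, c)"
    using eq[of "r div p" "r mod p" "c div q" "c mod q"] less_mult_div_mod[OF rc(1)] less_mult_div_mod[OF rc(2)]
    by simp
qed (use assms in auto)

lemma kronecker_entry:
  assumes "S \<in> carrier_mat m n" "T \<in> carrier_mat p q" "i < m" "k < p" "j < n" "l < q"
  shows "(S \<otimes>\<^sub>K T) $$ (i * p + k, j * q + l) = S $$ (i, j) * T $$ (k, l)"
  using assms kronecker_index[of "i * p + k" S T "j * q + l"]
    index_pair_less[OF assms(3,4)] index_pair_less[OF assms(5,6)] by simp

text \<open>The sum over the middle pairs factorises into two sums, which is where commutativity of
  the entries enters. Categorically this is functoriality of the tensor product.\<close>

lemma kronecker_mult: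
  fixes A B C D :: "'k::comm_semiring_1 mat"
  assumes A: "A \<in> carrier_mat m n" and C: "C \<in> carrier_mat n o'"
    and B: "B \<in> carrier_mat p q" and D: "D \<in> carrier_mat q r"
  shows "(A \<otimes>\<^sub>K B) * (C \<otimes>\<^sub>K D) = (A * C) \<otimes>\<^sub>K (B * D)"
proof (rule eq_mat_pairI)
  note AB = kronecker_carrier[OF A B] and CD = kronecker_carrier[OF C D]
  show "(A \<otimes>\<^sub>K B) * (C \<otimes>\<^sub>K D) \<in> carrier_mat (m * p) (o' * r)"
    using AB CD by (rule mult_carrier_mat)
  show "(A * C) \<otimes>\<^sub>K (B * D) \<in> carrier_mat (m * p) (o' * r)"
    using assms by (intro kronecker_carrier mult_carrier_mat)
  fix i k j l assume b: "i < m" "k < p" "j < o'" "l < r"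
  have "((A \<otimes>\<^sub>K B) * (C \<otimes>\<^sub>K D)) $$ (i * p + k, j * r + l)
      = (\<Sum>s<n. \<Sum>t<q. (A $$ (i, s) * B $$ (k, t)) * (C $$ (s, j) * D $$ (t, l)))"
    using b by (simp add: index_mult_mat_sum[OF AB CD] index_pair_less sum_lessThan_mult
        kronecker_entry[OF A B] kronecker_entry[OF C D])
  also have "\<dots> = (\<Sum>s<n. A $$ (i, s) * C $$ (s, j)) * (\<Sum>t<q. B $$ (k, t) * D $$ (t, l))"
    by (simp add: sum_product ac_simps)
  also have "\<dots> = ((A * C) \<otimes>\<^sub>K (B * D)) $$ (i * p + k, j * r + l)"
    using b kronecker_entry[OF mult_carrier_mat[OF A C] mult_carrier_mat[OF B D] b]
    by (simp add: index_mult_mat_sum[OF A C] index_mult_mat_sum[OF B D])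
  finally show "((A \<otimes>\<^sub>K B) * (C \<otimes>\<^sub>K D)) $$ (i * p + k, j * r + l) = \<dots>" .
qed

lemma kronecker_one: "1\<^sub>m a \<otimes>\<^sub>K 1\<^sub>m b = (1\<^sub>m (a * b) :: 'k::comm_semiring_1 mat)"
proof (rule eq_mat_pairI)
  fix i k j l assume b: "i < a" "k < b" "j < a" "l < b"
  have "i = j \<and> k = l" if "i * b + k = j * b + l"
    using arg_cong[OF that, of "\<lambda>t. t div b"] arg_cong[OF that, of "\<lambda>t. t mod b"] b by simp
  then show "(1\<^sub>m a \<otimes>\<^sub>K 1\<^sub>m b :: 'k mat) $$ (i * b + k, j * b + l) = 1\<^sub>m (a * b) $$ (i * b + k, j * b + l)"
    using b by (auto simp: kronecker_entry[OF one_carrier_mat one_carrier_mat] index_pair_less)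
qed auto

lemma kronecker_one_left: "1\<^sub>m 1 \<otimes>\<^sub>K T = (T :: 'k::comm_semiring_1 mat)"
  by (rule eq_matI) (auto simp: kronecker_def)

text \<open>
  \<open>slide d N X\<close> closes the legs of \<open>X : k\<^sup>N \<otimes> k\<^sup>d \<rightarrow> k\<^sup>d \<otimes> k\<^sup>N\<close> that belong to \<open>k\<^sup>N\<close>;
  \<open>slide' d N X\<close> does so for \<open>X : k\<^sup>d \<otimes> k\<^sup>N \<rightarrow> k\<^sup>N \<otimes> k\<^sup>d\<close>.
\<close>

definition slide :: "nat \<Rightarrow> nat \<Rightarrow> 'k::comm_semiring_1 mat \<Rightarrow> 'k mat" where
  "slide d N X = mat d d (\<lambda>(i, j). \<Sum>w<N. X $$ (i * N + w, w * d + j))"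

definition slide' :: "nat \<Rightarrow> nat \<Rightarrow> 'k::comm_semiring_1 mat \<Rightarrow> 'k mat" where
  "slide' d N X = mat d d (\<lambda>(i, j). \<Sum>w<N. X $$ (w * d + i, j * N + w))"

lemma slide_carrier [simp]: "slide d N X \<in> carrier_mat d d" "slide' d N X \<in> carrier_mat d d"
  by (simp_all add: slide_def slide'_def)

lemma slide_zero:
  "slide d N (0\<^sub>m (d * N) (d * N)) = 0\<^sub>m d d" "slide' d N (0\<^sub>m (d * N) (d * N)) = 0\<^sub>m d d"
  by (auto intro!: eq_matI sum.neutral simp: slide_def slide'_def index_pair_less
      index_pair_less[of _ N _ d, unfolded mult.commute[of N d]])

lemma slide_add:
  assumes "X \<in> carrier_mat (d * N) (d * N)" "Y \<in> carrier_mat (d * N) (d * N)"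
  shows "slide d N (X + Y) = slide d N X + slide d N Y" "slide' d N (X + Y) = slide' d N X + slide' d N Y"
  using assms
  by (auto intro!: eq_matI simp: slide_def slide'_def index_pair_less
      index_pair_less[of _ N _ d, unfolded mult.commute[of N d]] simp flip: sum.distrib)

section \<open>Planar diagrams in coordinates\<close>

lemma index_one_kronecker_row:
  fixes q :: "'k::comm_semiring_1 mat"
  assumes "q \<in> carrier_mat 1 m" "i < d" "a < d" "B < m"
  shows "(1\<^sub>m d \<otimes>\<^sub>K q) $$ (i, a * m + B) = (if i = a then q $$ (0, B) else 0)"
  using kronecker_entry[of "1\<^sub>m d" d d q 1 m i 0 a B] assms by simp

lemma index_one_kronecker_column:
  fixes p :: "'k::comm_semiring_1 mat"
  assumes "p \<in> carrier_mat m 1" "j < d" "a < d" "B < m"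
  shows "(1\<^sub>m d \<otimes>\<^sub>K p) $$ (a * m + B, j) = (if a = j then p $$ (B, 0) else 0)"
  using kronecker_entry[of "1\<^sub>m d" d d p m 1 a B j 0] assms by simp

lemma index_row_kronecker_one:
  fixes q :: "'k::comm_semiring_1 mat"
  assumes "q \<in> carrier_mat 1 m" "i < d" "a < d" "B < m"
  shows "(q \<otimes>\<^sub>K 1\<^sub>m d) $$ (i, B * d + a) = (if i = a then q $$ (0, B) else 0)"
  using kronecker_entry[of q 1 m "1\<^sub>m d" d d 0 i B a] assms by simp

lemma index_column_kronecker_one:
  fixes p :: "'k::comm_semiring_1 mat"
  assumes "p \<in> carrier_mat m 1" "j < d" "a < d" "B < m"
  shows "(p \<otimes>\<^sub>K 1\<^sub>m d) $$ (B * d + a, j) = (if a = j then p $$ (B, 0) else 0)"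
  using kronecker_entry[of p m 1 "1\<^sub>m d" d d B a 0 j] assms by simp

text \<open>Of the three legs between the two factors,
  \<open>1\<^sub>m d \<otimes>\<^sub>K q\<close> forces the first to be \<open>i\<close> and
  \<open>p \<otimes>\<^sub>K 1\<^sub>m d\<close> forces the last to be \<open>j\<close>. Only the
  middle leg \<open>w\<close>, shared by \<open>p\<close> and \<open>q\<close>, is summed.\<close>

lemma index_planar:
  fixes p q :: "'k::comm_semiring_1 mat"
  assumes p: "p \<in> carrier_mat (d * N) 1" and q: "q \<in> carrier_mat 1 (N * d)" and b: "i < d" "j < d"
  shows "((1\<^sub>m d \<otimes>\<^sub>K q) * (p \<otimes>\<^sub>K 1\<^sub>m d)) $$ (i, j) = (\<Sum>w<N. p $$ (i * N + w, 0) * q $$ (0, w * d + j))"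
proof -
  have P: "p \<otimes>\<^sub>K 1\<^sub>m d \<in> carrier_mat (d * (N * d)) d"
    using kronecker_carrier[OF p one_carrier_mat, of d] by (simp add: mult.assoc)
  have Q: "1\<^sub>m d \<otimes>\<^sub>K q \<in> carrier_mat d (d * (N * d))"
    using kronecker_carrier[OF one_carrier_mat q, of d] by simp
  have col: "(p \<otimes>\<^sub>K 1\<^sub>m d) $$ (a * (N * d) + (w * d + c), j) = (if c = j then p $$ (a * N + w, 0) else 0)"
    if "a < d" "w < N" "c < d" for a w c
    using index_column_kronecker_one[OF p b(2) that(3) index_pair_less[OF that(1,2)]]
    by (simp add: algebra_simps)
  have row: "(1\<^sub>m d \<otimes>\<^sub>K q) $$ (i, a * (N * d) + (w * d + c)) = (if i = a then q $$ (0, w * d + c) else 0)"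
    if "a < d" "w < N" "c < d" for a w c
    using index_one_kronecker_row[OF q b(1) that(1) index_pair_less[OF that(2,3)]] .
  have "((1\<^sub>m d \<otimes>\<^sub>K q) * (p \<otimes>\<^sub>K 1\<^sub>m d)) $$ (i, j)
    = (\<Sum>a<d. \<Sum>w<N. \<Sum>c<d. (if i = a then q $$ (0, w * d + c) else 0) * (if c = j then p $$ (a * N + w, 0) else 0))"
    unfolding index_mult_mat_sum[OF Q P b] sum_lessThan_mult by (simp add: row col)
  also have "\<dots> = (\<Sum>a<d. if i = a then (\<Sum>w<N. p $$ (a * N + w, 0) * q $$ (0, w * d + j)) else 0)"
    using b by (intro sum.cong refl) (auto simp: if_distrib[of "\<lambda>x. _ * x"] sum.delta mult.commute cong: if_cong)
  finally show ?thesis using b by simp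
qed

text \<open>Mirror image of \<open>index_planar\<close>: \<open>q\<close> now holds the first two
  legs and \<open>p\<close> the last two, so the first leg is forced to be \<open>j\<close> and the
  last to be \<open>i\<close>.\<close>

lemma index_planar':
  fixes p q :: "'k::comm_semiring_1 mat"
  assumes p: "p \<in> carrier_mat (N * d) 1" and q: "q \<in> carrier_mat 1 (d * N)" and b: "i < d" "j < d"
  shows "((q \<otimes>\<^sub>K 1\<^sub>m d) * (1\<^sub>m d \<otimes>\<^sub>K p)) $$ (i, j) = (\<Sum>w<N. p $$ (w * d + i, 0) * q $$ (0, j * N + w))"
proof -
  have P: "1\<^sub>m d \<otimes>\<^sub>K p \<in> carrier_mat (d * (N * d)) d"
    using kronecker_carrier[OF one_carrier_mat p, of d] by simp
  have Q: "q \<otimes>\<^sub>K 1\<^sub>m d \<in> carrier_mat d (d * (N * d))"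
    using kronecker_carrier[OF q one_carrier_mat, of d] by (simp add: mult.assoc)
  have row: "(q \<otimes>\<^sub>K 1\<^sub>m d) $$ (i, a * (N * d) + (w * d + c)) = (if i = c then q $$ (0, a * N + w) else 0)"
    if "a < d" "w < N" "c < d" for a w c
    using index_row_kronecker_one[OF q b(1) that(3) index_pair_less[OF that(1,2)]]
    by (simp add: algebra_simps)
  have col: "(1\<^sub>m d \<otimes>\<^sub>K p) $$ (a * (N * d) + (w * d + c), j) = (if a = j then p $$ (w * d + c, 0) else 0)"
    if "a < d" "w < N" "c < d" for a w c
    using index_one_kronecker_column[OF p b(2) that(1) index_pair_less[OF that(2,3)]] .
  have "((q \<otimes>\<^sub>K 1\<^sub>m d) * (1\<^sub>m d \<otimes>\<^sub>K p)) $$ (i, j)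
    = (\<Sum>a<d. \<Sum>w<N. \<Sum>c<d. (if i = c then q $$ (0, a * N + w) else 0) * (if a = j then p $$ (w * d + c, 0) else 0))"
    unfolding index_mult_mat_sum[OF Q P b] sum_lessThan_mult by (simp add: row col)
  also have "\<dots> = (\<Sum>a<d. if a = j then (\<Sum>w<N. p $$ (w * d + i, 0) * q $$ (0, a * N + w)) else 0)"
    using b by (intro sum.cong refl)
      (auto simp: if_distrib[of "\<lambda>x. x * _"] if_distrib[of "\<lambda>x. _ * x"] sum.delta' mult.commute cong: if_cong)
  finally show ?thesis using b by simp
qed

text \<open>Each entry of \<open>p * q\<close> is an entry of the column \<open>p\<close> times an
  entry of the row \<open>q\<close>. Closing strands therefore contracts a leg of \<open>p\<close>
  with a leg of \<open>q\<close> and needs no flip; the sums are those of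
  \<open>index_planar\<close> and \<open>index_planar'\<close>.\<close>

lemma slide_mult:
  fixes p q :: "'k::comm_semiring_1 mat"
  assumes p: "p \<in> carrier_mat (d * N) 1" and q: "q \<in> carrier_mat 1 (d * N)"
  shows "slide d N (p * q) = (1\<^sub>m d \<otimes>\<^sub>K q) * (p \<otimes>\<^sub>K 1\<^sub>m d)"
    and "slide' d N (p * q) = (q \<otimes>\<^sub>K 1\<^sub>m d) * (1\<^sub>m d \<otimes>\<^sub>K p)"
proof -
  \<comment> \<open>The same coordinate space is read as a tensor product with its factors in either
    order.\<close>
  have p': "p \<in> carrier_mat (N * d) 1" and q': "q \<in> carrier_mat 1 (N * d)"
    using p q by (simp_all add: mult.commute)
  have b: "i * N + w < d * N" "w * d + i < d * N" if "i < d" "w < N" for i w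
    using index_pair_less[OF that] index_pair_less[OF that(2,1)] by (simp_all add: mult.commute)
  have P: "(1\<^sub>m d \<otimes>\<^sub>K q) * (p \<otimes>\<^sub>K 1\<^sub>m d) \<in> carrier_mat d d"
    "(q \<otimes>\<^sub>K 1\<^sub>m d) * (1\<^sub>m d \<otimes>\<^sub>K p) \<in> carrier_mat d d"
    using kronecker_carrier[OF p one_carrier_mat, of d] kronecker_carrier[OF one_carrier_mat q', of d]
      kronecker_carrier[OF one_carrier_mat p', of d] kronecker_carrier[OF q one_carrier_mat, of d]
    by (simp_all only: mult.assoc mult_1 mult_1_right mult_carrier_mat)
  show "slide d N (p * q) = (1\<^sub>m d \<otimes>\<^sub>K q) * (p \<otimes>\<^sub>K 1\<^sub>m d)"
  proof (rule eq_matI)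
    fix i j assume "i < dim_row ((1\<^sub>m d \<otimes>\<^sub>K q) * (p \<otimes>\<^sub>K 1\<^sub>m d))" "j < dim_col ((1\<^sub>m d \<otimes>\<^sub>K q) * (p \<otimes>\<^sub>K 1\<^sub>m d))"
    with P(1) have "i < d" "j < d" by (simp_all only: carrier_matD)
    then show "slide d N (p * q) $$ (i, j) = ((1\<^sub>m d \<otimes>\<^sub>K q) * (p \<otimes>\<^sub>K 1\<^sub>m d)) $$ (i, j)"
      using b by (simp only: index_planar[OF p q']) (simp add: slide_def index_mult_mat_sum[OF p q] del: index_mult_mat)
  qed (use P(1) in \<open>simp_all only: carrier_matD slide_carrier[THEN carrier_matD(1)] slide_carrier[THEN carrier_matD(2)]\<close>)
  show "slide' d N (p * q) = (q \<otimes>\<^sub>K 1\<^sub>m d) * (1\<^sub>m d \<otimes>\<^sub>K p)"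
  proof (rule eq_matI)
    fix i j assume "i < dim_row ((q \<otimes>\<^sub>K 1\<^sub>m d) * (1\<^sub>m d \<otimes>\<^sub>K p))" "j < dim_col ((q \<otimes>\<^sub>K 1\<^sub>m d) * (1\<^sub>m d \<otimes>\<^sub>K p))"
    with P(2) have "i < d" "j < d" by (simp_all only: carrier_matD)
    then show "slide' d N (p * q) $$ (i, j) = ((q \<otimes>\<^sub>K 1\<^sub>m d) * (1\<^sub>m d \<otimes>\<^sub>K p)) $$ (i, j)"
      using b by (simp only: index_planar'[OF p' q]) (simp add: slide'_def index_mult_mat_sum[OF p q] del: index_mult_mat)
  qed (use P(2) in \<open>simp_all only: carrier_matD slide_carrier[THEN carrier_matD(1)] slide_carrier[THEN carrier_matD(2)]\<close>)
qed

text \<open>A linear map has a linear section on its range. The purpose is the factorisation of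
  \<open>M\<close> as \<open>M * X\<close> times \<open>M\<close>: the columns of
  \<open>M * X\<close> lie in the column space of \<open>M\<close>, so no basis of the image has to
  be chosen.\<close>

lemma generalized_inverse_mat:
  fixes M :: "'k::field mat"
  assumes M: "M \<in> carrier_mat n n"
  obtains X where "X \<in> carrier_mat n n" "M * X * M = M"
proof -
  let ?sc = "\<lambda>c p. Poly_Mapping.map ((*) c) p :: nat \<Rightarrow>\<^sub>0 'k"
  interpret vs: vector_space ?sc
    using module_scale_poly_mapping[where 'k = 'k and 'a = nat] unfolding vector_space_def Modules.module_def by blast
  interpret vector_space_pair ?sc ?sc ..
  let ?l = "Poly_Mapping.lookup :: (nat \<Rightarrow>\<^sub>0 'k) \<Rightarrow> nat \<Rightarrow> 'k"
  \<comment> \<open>\<open>f\<close> applies \<open>M\<close> to the first \<open>n\<close>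
    coordinates of a finitely supported sequence and ignores the others.\<close>
  define f where "f v = (\<Sum>i<n. Poly_Mapping.single i (\<Sum>j<n. M $$ (i, j) * ?l v j))" for v
  have lookup_sum: "?l (\<Sum>i\<in>I. h i) k = (\<Sum>i\<in>I. ?l (h i) k)" for I :: "nat set" and h k
    by (induction I rule: infinite_finite_induct) (auto simp: lookup_add)
  have f: "?l (f v) i = (if i < n then \<Sum>j<n. M $$ (i, j) * ?l v j else 0)" for v i
    by (auto simp: f_def lookup_sum lookup_single when_def sum.delta)
  have "Vector_Spaces.linear ?sc ?sc f"
    unfolding linear_iff_module_hom
    by unfold_locales
      (auto intro!: poly_mapping_eqI simp: f lookup_add lookup_map_mult algebra_simps sum.distrib sum_distrib_left)
  from linear_exists_right_inverse_on[OF this vs.subspace_UNIV]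
  obtain g where g: "Vector_Spaces.linear ?sc ?sc g" "\<And>v. f (g (f v)) = f v" by auto
  define e where "e j = (Poly_Mapping.single j 1 :: nat \<Rightarrow>\<^sub>0 'k)" for j
  \<comment> \<open>The columns are the values of the section \<open>g\<close> on unit vectors, cut
    to \<open>n\<close> coordinates; the cut is harmless because \<open>f\<close> ignores the
    rest.\<close>
  define X where "X = mat n n (\<lambda>(i, j). ?l (g (e j)) i)"
  have X: "X \<in> carrier_mat n n" by (simp add: X_def)
  have fe: "f (e j) = (\<Sum>i<n. ?sc (M $$ (i, j)) (e i))" if "j < n" for j
    using that by (auto intro!: poly_mapping_eqI
        simp: f lookup_sum lookup_map_mult e_def lookup_single when_def sum.delta
          if_distrib[of "\<lambda>x. _ * x"] cong: if_cong)
  have gfe: "?l (g (f (e j))) k = (\<Sum>i<n. M $$ (i, j) * ?l (g (e i)) k)" if "j < n" for j k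
  proof -
    have "g (f (e j)) = (\<Sum>i<n. ?sc (M $$ (i, j)) (g (e i)))"
      unfolding fe[OF that]
      by (simp add: module_hom.sum[OF g(1)[unfolded linear_iff_module_hom]] module_hom.scale[OF g(1)[unfolded linear_iff_module_hom]])
    then show ?thesis by (simp add: lookup_sum lookup_map_mult)
  qed
  have "M * X * M = M"
  proof (rule eq_matI)
    fix i j assume "i < dim_row M" "j < dim_col M"
    then have b: "i < n" "j < n" using M by auto
    have "(M * X * M) $$ (i, j) = (\<Sum>k<n. (\<Sum>l<n. M $$ (i, l) * X $$ (l, k)) * M $$ (k, j))"
      using b by (simp add: index_mult_mat_sum[OF mult_carrier_mat[OF M X] M] index_mult_mat_sum[OF M X])
    also have "\<dots> = (\<Sum>k<n. \<Sum>l<n. M $$ (i, l) * (M $$ (k, j) * ?l (g (e k)) l))"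
      by (simp add: X_def sum_distrib_left sum_distrib_right ac_simps)
    also have "\<dots> = (\<Sum>l<n. \<Sum>k<n. M $$ (i, l) * (M $$ (k, j) * ?l (g (e k)) l))"
      by (rule sum.swap)
    also have "\<dots> = ?l (f (g (f (e j)))) i"
      using b by (simp add: f[of "g _"] gfe sum_distrib_left)
    also have "\<dots> = M $$ (i, j)"
      using b by (simp add: g(2)) (simp add: f e_def lookup_single when_def if_distrib[of "\<lambda>x. _ * x"] cong: if_cong)
    finally show "(M * X * M) $$ (i, j) = M $$ (i, j)" .
  qed (use M X in auto)
  with X show thesis by (rule that)
qed

section \<open>Hopf algebras\<close>

lemma sum_list_sum_swap: "(\<Sum>i\<in>I. \<Sum>x\<leftarrow>xs. f i x) = (\<Sum>x\<leftarrow>xs. \<Sum>i\<in>I. f i x)"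
  for f :: "'i \<Rightarrow> 'x \<Rightarrow> 'r::comm_monoid_add"
  by (induction xs) (simp_all add: sum.distrib)

lemma sum_list_swap: "(\<Sum>x\<leftarrow>xs. \<Sum>y\<leftarrow>ys. f x y) = (\<Sum>y\<leftarrow>ys. \<Sum>x\<leftarrow>xs. f x y)"
  for f :: "'x \<Rightarrow> 'y \<Rightarrow> 'r::comm_monoid_add"
  by (induction xs) (simp_all add: sum_list_addf)

section \<open>Hopf algebra axioms tested on linear forms\<close>

lemma legs2_multilinear:
  fixes f :: "'a::ab_group_add \<Rightarrow> 'a \<Rightarrow> 'k::field"
  assumes eq: "tensor_eq sc (legs s) (legs t)"
    and "\<And>x x' y. f (x + x') y = f x y + f x' y" "\<And>c x y. f (sc c x) y = c * f x y"
    and "\<And>x y y'. f x (y + y') = f x y + f x y'" "\<And>c x y. f x (sc c y) = c * f x y"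
  shows "(\<Sum>(x, y) \<leftarrow> s. f x y) = (\<Sum>(x, y) \<leftarrow> t. f x y)"
proof -
  \<comment> \<open>The multilinear relations preserve the length of a list, so the extension by
    zero to other lengths is still multilinear.\<close>
  define g where "g xs = (if length xs = 2 then f (xs ! 0) (xs ! 1) else 0)" for xs
  have us: "us = [] \<or> (\<exists>a. us = [a]) \<or> length us \<ge> 2" for us :: "'a list"
    by (cases us; cases "tl us") auto
  have "sum_list (map g (legs s)) = sum_list (map g (legs t))"
  proof (rule sum_list_eq_if_tensor_eq[OF eq])
    show "g (us @ [x + y] @ vs) = g (us @ [x] @ vs) + g (us @ [y] @ vs)" for us x y vs
      using us[of us] by (elim disjE exE) (simp_all add: g_def assms(2,4))
    show "g (us @ [sc c x] @ vs) = c * g (us @ [x] @ vs)" for us c x vs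
      using us[of us] by (elim disjE exE) (simp_all add: g_def assms(3,5))
  qed
  moreover have "sum_list (map g (legs u)) = (\<Sum>(x, y) \<leftarrow> u. f x y)" for u
    by (induction u) (auto simp: g_def)
  ultimately show ?thesis by (simp only:)
qed

definition linear_form :: "('k::field, 'a::ring_1) hopf \<Rightarrow> ('a \<Rightarrow> 'k) \<Rightarrow> bool" where
  "linear_form H f \<longleftrightarrow> (\<forall>x y. f (x + y) = f x + f y) \<and> (\<forall>c x. f (scale H c x) = c * f x)"

lemma linear_form_add: "linear_form H f \<Longrightarrow> f (x + y) = f x + f y"
  and linear_form_scale: "linear_form H f \<Longrightarrow> f (scale H c x) = c * f x"
  by (simp_all add: linear_form_def)

lemma linear_form_zero: "linear_form H f \<Longrightarrow> f 0 = 0"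
  using linear_form_add[of H f 0 0] by (simp only: add_0_left add_cancel_right_right)

lemma linear_form_sum_list: "linear_form H f \<Longrightarrow> f (sum_list xs) = (\<Sum>x\<leftarrow>xs. f x)"
  by (induction xs) (simp_all add: linear_form_zero linear_form_add)

lemma linear_form_sum: "linear_form H f \<Longrightarrow> f (\<Sum>i\<in>I. g i) = (\<Sum>i\<in>I. f (g i))"
  by (induction I rule: infinite_finite_induct) (simp_all add: linear_form_zero linear_form_add)

context hopf_algebra
begin

sublocale vs: vector_space "Defs.scale H"
  by (rule vector_space)

lemma antipode_add: "antipode H (x + y) = antipode H x + antipode H y"
  and antipode_scale: "antipode H (Defs.scale H c x) = Defs.scale H c (antipode H x)"
  using antipode_linear by (simp_all add: linear_iff_module_hom module_hom.add module_hom.scale)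

lemma counit_linear_form: "linear_form H (counit H)"
  using counit_linear by (simp add: linear_form_def linear_iff_module_hom module_hom.add module_hom.scale)

text \<open>Equality of tensors is exploited through scalar-valued multilinear functions. Identities
  between elements, such as those for the antipode, are therefore tested on all linear
  forms.\<close>

lemma linear_forms_separate:
  assumes "\<And>f. linear_form H f \<Longrightarrow> f x = f y"
  shows "x = y"
proof (rule ccontr)
  assume "x \<noteq> y"
  then have "vs.independent {x - y}" by (simp add: vs.independent_insert)
  interpret field: vector_space "(*) :: 'k \<Rightarrow> 'k \<Rightarrow> 'k"
    by unfold_locales (simp_all add: algebra_simps)
  interpret vector_space_pair "Defs.scale H" "(*) :: 'k \<Rightarrow> 'k \<Rightarrow> 'k" ..
  from linear_independent_extend[OF \<open>vs.independent {x - y}\<close>, of "\<lambda>_. 1"]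
  obtain f where f: "Vector_Spaces.linear (Defs.scale H) (*) f" "f (x - y) = 1" by auto
  then have "linear_form H f"
    by (simp add: linear_form_def linear_iff_module_hom module_hom.add module_hom.scale)
  then have "f x = f y" by (rule assms)
  with f show False by (simp add: linear_iff_module_hom module_hom.diff)
qed

text \<open>Here and in the next four lemmas an axiom on tensors becomes an identity of scalars: a
  function linear in each leg is evaluated on both expressions.\<close>

lemma comult_sum_add:
  assumes "\<And>y. linear_form H (\<lambda>x. f x y)" "\<And>x. linear_form H (f x)"
  shows "(\<Sum>(a, b)\<leftarrow>comult H (x + y). f a b) = (\<Sum>(a, b)\<leftarrow>comult H x. f a b) + (\<Sum>(a, b)\<leftarrow>comult H y. f a b)"
  using legs2_multilinear[OF comult_add[of x y], of f] assms by (simp add: linear_form_def)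

lemma comult_sum_scale:
  assumes "\<And>y. linear_form H (\<lambda>x. f x y)" "\<And>x. linear_form H (f x)"
  shows "(\<Sum>(a, b)\<leftarrow>comult H (Defs.scale H c x). f a b) = c * (\<Sum>(a, b)\<leftarrow>comult H x. f a b)"
proof -
  have "tensor_eq (Defs.scale H) (legs (comult H (Defs.scale H c x)))
      (legs [(Defs.scale H c x1, x2). (x1, x2) \<leftarrow> comult H x])"
    using comult_scale[of c x] by (simp add: comp_def split_def)
  from legs2_multilinear[OF this, of f] show ?thesis
    using assms by (simp add: linear_form_def comp_def split_def sum_list_const_mult)
qed

lemma comult_sum_one:
  assumes "\<And>y. linear_form H (\<lambda>x. f x y)" "\<And>x. linear_form H (f x)"
  shows "(\<Sum>(a, b)\<leftarrow>comult H 1. f a b) = f 1 1"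
  using legs2_multilinear[of "Defs.scale H" "comult H 1" "[(1, 1)]" f] comult_one assms by (simp add: linear_form_def)

lemma comult_sum_mult:
  assumes "\<And>y. linear_form H (\<lambda>x. f x y)" "\<And>x. linear_form H (f x)"
  shows "(\<Sum>(a, b)\<leftarrow>comult H (x * y). f a b) =
    (\<Sum>(x1, x2)\<leftarrow>comult H x. \<Sum>(y1, y2)\<leftarrow>comult H y. f (x1 * y1) (x2 * y2))"
proof -
  have "tensor_eq (Defs.scale H) (legs (comult H (x * y)))
      (legs [(x1 * y1, x2 * y2). (x1, x2) \<leftarrow> comult H x, (y1, y2) \<leftarrow> comult H y])"
    using comult_mult[of x y] by (simp add: comp_def split_def map_concat)
  from legs2_multilinear[OF this, of f] show ?thesis
    using assms by (simp add: linear_form_def sum_list_concat_pairs comp_def split_def)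
qed

lemma comult_sum_coassoc:
  assumes "\<And>y z. linear_form H (\<lambda>x. f x y z)" "\<And>x z. linear_form H (\<lambda>y. f x y z)" "\<And>x y. linear_form H (f x y)"
  shows "(\<Sum>(x1, x2)\<leftarrow>comult H x. \<Sum>(x11, x12)\<leftarrow>comult H x1. f x11 x12 x2) =
    (\<Sum>(x1, x2)\<leftarrow>comult H x. \<Sum>(x21, x22)\<leftarrow>comult H x2. f x1 x21 x22)"
proof -
  have "tensor_eq (Defs.scale H)
     [[x, y, z]. (x, y, z) \<leftarrow> [(x11, x12, x2). (x1, x2) \<leftarrow> comult H x, (x11, x12) \<leftarrow> comult H x1]]
     [[x, y, z]. (x, y, z) \<leftarrow> [(x1, x21, x22). (x1, x2) \<leftarrow> comult H x, (x21, x22) \<leftarrow> comult H x2]]"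
    using coassoc[of x] by (simp add: map_concat comp_def split_def)
  from legs3_multilinear[OF this, of f] show ?thesis
    using assms by (simp add: linear_form_def sum_list_concat_pairs split_def comp_def)
qed

lemma counit_sum_left: "linear_form H f \<Longrightarrow> (\<Sum>(a, b)\<leftarrow>comult H x. counit H a * f b) = f x"
  using linear_form_sum_list[of H f "map (\<lambda>(a, b). Defs.scale H (counit H a) b) (comult H x)"] counit_left[of x]
  by (simp add: comp_def split_def linear_form_scale)

lemma counit_sum_right: "linear_form H f \<Longrightarrow> (\<Sum>(a, b)\<leftarrow>comult H x. counit H b * f a) = f x"
  using linear_form_sum_list[of H f "map (\<lambda>(a, b). Defs.scale H (counit H b) a) (comult H x)"] counit_right[of x]
  by (simp add: comp_def split_def linear_form_scale)

lemma antipode_sum_left: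
  assumes "linear_form H f"
  shows "(\<Sum>(a, b)\<leftarrow>comult H x. f (antipode H a * b)) = counit H x * f 1"
  using linear_form_sum_list[OF assms, of "map (\<lambda>(a, b). antipode H a * b) (comult H x)"] antipode_left[of x]
  by (simp add: comp_def split_def linear_form_scale[OF assms])

lemma antipode_sum_right:
  assumes "linear_form H f"
  shows "(\<Sum>(a, b)\<leftarrow>comult H x. f (a * antipode H b)) = counit H x * f 1"
  using linear_form_sum_list[OF assms, of "map (\<lambda>(a, b). a * antipode H b) (comult H x)"] antipode_right[of x]
  by (simp add: comp_def split_def linear_form_scale[OF assms])

lemmas linear_simps = linear_form_def distrib_left distrib_right antipode_add antipode_scale
  scale_mult_left scale_mult_right sum_list_addf sum_list_const_mult

lemma antipode_one: "antipode H 1 = 1"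
proof (rule linear_forms_separate)
  fix f assume f: "linear_form H f"
  have "(\<Sum>(a, b)\<leftarrow>comult H 1. f (antipode H a * b)) = f (antipode H 1 * 1)"
    by (rule comult_sum_one) (use f in \<open>simp_all add: linear_simps\<close>)
  then show "f (antipode H 1) = f 1"
    using antipode_sum_left[OF f, of 1] by (simp add: counit_one)
qed

text \<open>Both sides are convolution inverses of the multiplication map. Concretely, one six-leg
  expression is collapsed in two ways: from the right it gives the antipode of \<open>x * y\<close>,
  from the left the product of antipodes.\<close>

lemma antipode_mult: "antipode H (x * y) = antipode H y * antipode H x"
proof (rule linear_forms_separate)
  fix f assume f: "linear_form H f"
  note l = f[unfolded linear_form_def]
  let ?S = "antipode H" and ?D = "comult H"
  define g where "g x1 x2 x3 y1 y2 y3 = f (?S (x1 * y1) * x2 * y2 * ?S y3 * ?S x3)" for x1 x2 x3 y1 y2 y3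
  have g_lin: "linear_form H (\<lambda>x. g x x2 x3 y1 y2 y3)" "linear_form H (\<lambda>x. g x1 x x3 y1 y2 y3)"
    "linear_form H (\<lambda>x. g x1 x2 x y1 y2 y3)" "linear_form H (\<lambda>x. g x1 x2 x3 x y2 y3)"
    "linear_form H (\<lambda>x. g x1 x2 x3 y1 x y3)" "linear_form H (\<lambda>x. g x1 x2 x3 y1 y2 x)"
    for x1 x2 x3 y1 y2 y3
    using l by (simp_all add: g_def linear_simps)
  note g_simps = g_lin[unfolded linear_form_def]
  have fL: "linear_form H (\<lambda>u. f (a * u * b))" for a b
    using l by (simp add: linear_simps)
  \<comment> \<open>Collapse from the right: the last two legs of \<open>y\<close> cancel inside the
    product; in \<open>R\<close> those of \<open>x\<close> follow.\<close>
  have R1: "(\<Sum>(y1, y2)\<leftarrow>?D y. \<Sum>(y21, y22)\<leftarrow>?D y2. g x1 x2 x3 y1 y21 y22) = f (?S (x1 * y) * (x2 * ?S x3))"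
    for x1 x2 x3
  proof -
    have "(\<Sum>(y21, y22)\<leftarrow>?D y2. g x1 x2 x3 y1 y21 y22) = counit H y2 * f (?S (x1 * y1) * (x2 * ?S x3))" for y1 y2
      using antipode_sum_right[OF fL[of "?S (x1 * y1) * x2" "?S x3"], of y2] by (simp add: g_def mult.assoc)
    moreover have "linear_form H (\<lambda>y. f (?S (x1 * y) * (x2 * ?S x3)))"
      using l by (simp add: linear_simps)
    ultimately show ?thesis using counit_sum_right by simp
  qed
  have R: "(\<Sum>(x1, x2)\<leftarrow>?D x. \<Sum>(x21, x22)\<leftarrow>?D x2. f (?S (x1 * y) * (x21 * ?S x22))) = f (?S (x * y))"
  proof -
    have "(\<Sum>(x21, x22)\<leftarrow>?D x2. f (?S (x1 * y) * (x21 * ?S x22))) = counit H x2 * f (?S (x1 * y))" for x1 x2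
      using antipode_sum_right[OF fL[of "?S (x1 * y)" 1], of x2] by simp
    moreover have "linear_form H (\<lambda>x. f (?S (x * y)))"
      using l by (simp add: linear_simps)
    ultimately show ?thesis using counit_sum_right by simp
  qed
  \<comment> \<open>Collapse from the left: by multiplicativity of the comultiplication,
    \<open>x11 * y11\<close> and \<open>x12 * y12\<close> are the legs of \<open>x1 * y1\<close>, so
    the left antipode axiom applies to that product.\<close>
  have L1: "(\<Sum>(x11, x12)\<leftarrow>?D x1. \<Sum>(y11, y12)\<leftarrow>?D y1. g x11 x12 x2 y11 y12 y2) =
      counit H x1 * (counit H y1 * f (?S y2 * ?S x2))" for x1 y1 x2 y2
  proof -
    have "(\<Sum>(u, v)\<leftarrow>?D (x1 * y1). f (1 * (?S u * v) * (?S y2 * ?S x2))) =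
       (\<Sum>(x11, x12)\<leftarrow>?D x1. \<Sum>(y11, y12)\<leftarrow>?D y1. f (1 * (?S (x11 * y11) * (x12 * y12)) * (?S y2 * ?S x2)))"
      by (rule comult_sum_mult) (use l in \<open>simp_all add: linear_simps\<close>)
    then show ?thesis
      using antipode_sum_left[OF fL[of 1 "?S y2 * ?S x2"], of "x1 * y1"] by (simp add: g_def counit_mult mult.assoc)
  qed
  have L2: "(\<Sum>(x1, x2)\<leftarrow>?D x. \<Sum>(y1, y2)\<leftarrow>?D y. counit H x1 * (counit H y1 * f (?S y2 * ?S x2))) = f (?S y * ?S x)"
  proof -
    have "linear_form H (\<lambda>y. f (?S y * ?S x2))" "linear_form H (\<lambda>x. f (?S y * ?S x))" for x2
      using l by (simp_all add: linear_simps)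
    from counit_sum_left[OF this(1)] counit_sum_left[OF this(2)]
    show ?thesis by (simp add: sum_list_const_mult split_def)
  qed
  have "f (?S (x * y)) = (\<Sum>(x1, x2)\<leftarrow>?D x. \<Sum>(x21, x22)\<leftarrow>?D x2.
      \<Sum>(y1, y2)\<leftarrow>?D y. \<Sum>(y21, y22)\<leftarrow>?D y2. g x1 x21 x22 y1 y21 y22)"
    by (simp only: R1 R)
  also have "\<dots> = (\<Sum>(x1, x2)\<leftarrow>?D x. \<Sum>(x11, x12)\<leftarrow>?D x1.
      \<Sum>(y1, y2)\<leftarrow>?D y. \<Sum>(y21, y22)\<leftarrow>?D y2. g x11 x12 x2 y1 y21 y22)"
    by (rule comult_sum_coassoc[symmetric])
       (unfold linear_form_def split_def, simp_all add: g_simps sum_list_addf sum_list_const_mult)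
  also have "\<dots> = (\<Sum>(x1, x2)\<leftarrow>?D x. \<Sum>(x11, x12)\<leftarrow>?D x1.
      \<Sum>(y1, y2)\<leftarrow>?D y. \<Sum>(y11, y12)\<leftarrow>?D y1. g x11 x12 x2 y11 y12 y2)"
    by (subst comult_sum_coassoc) (simp_all add: g_lin)
  also have "\<dots> = (\<Sum>(x1, x2)\<leftarrow>?D x. \<Sum>(y1, y2)\<leftarrow>?D y.
      \<Sum>(x11, x12)\<leftarrow>?D x1. \<Sum>(y11, y12)\<leftarrow>?D y1. g x11 x12 x2 y11 y12 y2)"
    unfolding split_def by (subst sum_list_swap) (rule refl)
  also have "\<dots> = f (?S y * ?S x)"
    by (simp only: L1 L2)
  finally show "f (?S (x * y)) = f (?S y * ?S x)" .
qed

end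

section \<open>Modules\<close>

lemma lmodI:
  assumes "\<And>x. snd V x \<in> carrier_mat (fst V) (fst V)"
    and "\<And>x y. snd V (x + y) = snd V x + snd V y" "\<And>c x. snd V (scale H c x) = c \<cdot>\<^sub>m snd V x"
    and "\<And>x y. snd V (x * y) = snd V x * snd V y" "snd V 1 = 1\<^sub>m (fst V)"
  shows "V \<in> lmod H"
  using assms by (cases V) (simp add: lmod_def)

lemma lmodD:
  assumes "V \<in> lmod H"
  shows "snd V (x + y) = snd V x + snd V y" "snd V (scale H c x) = c \<cdot>\<^sub>m snd V x"
    "snd V (x * y) = snd V x * snd V y" "snd V 1 = 1\<^sub>m (fst V)"
  using assms by (auto simp: lmod_def)

lemma lmod_dim [simp]:
  assumes "V \<in> lmod H"
  shows "dim_row (snd V x) = fst V" "dim_col (snd V x) = fst V"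
  using lmod_carrier[OF assms, of x] by auto

lemma lmod_entry_linear:
  "V \<in> lmod H \<Longrightarrow> i < fst V \<Longrightarrow> j < fst V \<Longrightarrow> linear_form H (\<lambda>x. snd V x $$ (i, j))"
  by (simp add: linear_form_def lmod_entries)

lemma lmod_mult_entry:
  "V \<in> lmod H \<Longrightarrow> i < fst V \<Longrightarrow> j < fst V \<Longrightarrow>
    snd V (x * y) $$ (i, j) = (\<Sum>a<fst V. snd V x $$ (i, a) * snd V y $$ (a, j))"
  by (simp only: lmodD(3) index_mult_mat_sum[OF lmod_carrier lmod_carrier])

lemma lmod_homI: "T \<in> carrier_mat (fst W) (fst V) \<Longrightarrow> (\<And>x. T * snd V x = snd W x * T) \<Longrightarrow> T \<in> lmod_hom V W"
  by (simp add: lmod_hom_def)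

lemma lmod_hom_carrier: "T \<in> lmod_hom V W \<Longrightarrow> T \<in> carrier_mat (fst W) (fst V)"
  and lmod_hom_commute: "T \<in> lmod_hom V W \<Longrightarrow> T * snd V x = snd W x * T"
  by (simp_all add: lmod_hom_def)

lemma lmod_hom_one: "V \<in> lmod H \<Longrightarrow> 1\<^sub>m (fst V) \<in> lmod_hom V V"
  using lmod_carrier[of V H] by (intro lmod_homI) auto

lemma lmod_hom_mult:
  assumes lmod: "U \<in> lmod H" "V \<in> lmod H" "W \<in> lmod H" and S: "S \<in> lmod_hom U V" and T: "T \<in> lmod_hom V W"
  shows "T * S \<in> lmod_hom U W"
proof (rule lmod_homI)
  note c = lmod_hom_carrier[OF S] lmod_hom_carrier[OF T] lmod[THEN lmod_carrier]
  show "T * S \<in> carrier_mat (fst W) (fst U)" using c by simp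
  fix x
  have "T * S * snd U x = T * (snd V x * S)"
    using c assoc_mult_mat[OF c(2,1,3)] lmod_hom_commute[OF S] by simp
  also have "\<dots> = snd W x * T * S"
    using assoc_mult_mat[OF c(2,4,1)] lmod_hom_commute[OF T] by simp
  also have "\<dots> = snd W x * (T * S)" using assoc_mult_mat[OF c(5,2,1)] by simp
  finally show "T * S * snd U x = snd W x * (T * S)" .
qed

lemma lmod_hom_add:
  assumes lmod: "V \<in> lmod H" "W \<in> lmod H" and S: "S \<in> lmod_hom V W" and T: "T \<in> lmod_hom V W"
  shows "S + T \<in> lmod_hom V W"
proof (rule lmod_homI)
  note c = lmod_hom_carrier[OF S] lmod_hom_carrier[OF T] lmod[THEN lmod_carrier]
  show "S + T \<in> carrier_mat (fst W) (fst V)" using c by simp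
  show "(S + T) * snd V x = snd W x * (S + T)" for x
    using add_mult_distrib_mat[OF c(1,2,3)] mult_add_distrib_mat[OF c(4,1,2)]
      lmod_hom_commute[OF S] lmod_hom_commute[OF T] by simp
qed

lemma lmod_hom_zero: "V \<in> lmod H \<Longrightarrow> W \<in> lmod H \<Longrightarrow> 0\<^sub>m (fst W) (fst V) \<in> lmod_hom V W"
  using left_mult_zero_mat[OF lmod_carrier[of V H]] right_mult_zero_mat[OF lmod_carrier[of W H]]
  by (intro lmod_homI) auto

lemma lmod_isoE:
  assumes "T \<in> lmod_iso V W"
  obtains T' where "T \<in> lmod_hom V W" "T' \<in> lmod_hom W V" "T' * T = 1\<^sub>m (fst V)" "T * T' = 1\<^sub>m (fst W)"
  using assms by (auto simp: lmod_iso_def)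

lemma fst_tensor_rep [simp]: "fst (tensor_rep H V W) = fst V * fst W"
  by (simp add: tensor_rep_def)

lemma fst_unit_rep [simp]: "fst (unit_rep H) = 1"
  by (simp add: unit_rep_def)

lemma unit_rep_entry [simp]: "snd (unit_rep H) x $$ (0, 0) = counit H x"
  by (simp add: unit_rep_def)

lemma tensor_rep_carrier:
  "V \<in> lmod H \<Longrightarrow> W \<in> lmod H \<Longrightarrow> snd (tensor_rep H V W) x \<in> carrier_mat (fst V * fst W) (fst V * fst W)"
  by (intro index_tensor_rep(1) lmod_carrier)

lemma tensor_rep_entry:
  assumes "V \<in> lmod H" "W \<in> lmod H" and b: "i < fst V" "k < fst W" "j < fst V" "l < fst W"
  shows "snd (tensor_rep H V W) x $$ (i * fst W + k, j * fst W + l) =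
    (\<Sum>(x1, x2)\<leftarrow>comult H x. snd V x1 $$ (i, j) * snd W x2 $$ (k, l))"
  using index_tensor_rep(2)[where V = V and W = W and H = H, OF lmod_carrier[OF assms(1)] lmod_carrier[OF assms(2)]
      index_pair_less[OF b(1,2)] index_pair_less[OF b(3,4)]] b by simp

text \<open>Each pure tensor of the comultiplication of \<open>x\<close> acts by a Kronecker
  product, and \<open>S\<close> and \<open>T\<close> commute with it leg by leg.\<close>

lemma lmod_hom_kronecker:
  assumes lmod: "V \<in> lmod H" "W \<in> lmod H" "V' \<in> lmod H" "W' \<in> lmod H"
    and S: "S \<in> lmod_hom V V'" and T: "T \<in> lmod_hom W W'"
  shows "S \<otimes>\<^sub>K T \<in> lmod_hom (tensor_rep H V W) (tensor_rep H V' W')"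
proof (rule lmod_homI)
  note cS = lmod_hom_carrier[OF S] and cT = lmod_hom_carrier[OF T]
  note c = lmod[THEN lmod_carrier]
  have ST: "S \<otimes>\<^sub>K T \<in> carrier_mat (fst V' * fst W') (fst V * fst W)" using cS cT by simp
  then show "S \<otimes>\<^sub>K T \<in> carrier_mat (fst (tensor_rep H V' W')) (fst (tensor_rep H V W))" by simp
  fix x
  note sums = index_mult_mat_sum[OF ST tensor_rep_carrier[OF lmod(1,2)]]
    index_mult_mat_sum[OF tensor_rep_carrier[OF lmod(3,4)] ST]
  show "(S \<otimes>\<^sub>K T) * snd (tensor_rep H V W) x = snd (tensor_rep H V' W') x * (S \<otimes>\<^sub>K T)"
  proof (rule eq_mat_pairI)
    show "(S \<otimes>\<^sub>K T) * snd (tensor_rep H V W) x \<in> carrier_mat (fst V' * fst W') (fst V * fst W)"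
      "snd (tensor_rep H V' W') x * (S \<otimes>\<^sub>K T) \<in> carrier_mat (fst V' * fst W') (fst V * fst W)"
      using mult_carrier_mat[OF ST tensor_rep_carrier[OF lmod(1,2)]]
        mult_carrier_mat[OF tensor_rep_carrier[OF lmod(3,4)] ST] .
    fix i k j l assume b: "i < fst V'" "k < fst W'" "j < fst V" "l < fst W"
    have "((S \<otimes>\<^sub>K T) * snd (tensor_rep H V W) x) $$ (i * fst W' + k, j * fst W + l)
      = (\<Sum>a<fst V. \<Sum>b<fst W. S $$ (i, a) * T $$ (k, b) *
          (\<Sum>(x1, x2)\<leftarrow>comult H x. snd V x1 $$ (a, j) * snd W x2 $$ (b, l)))"
      using b by (simp add: sums index_pair_less sum_lessThan_mult kronecker_entry[OF cS cT] tensor_rep_entry lmod)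
    also have "\<dots> = (\<Sum>(x1, x2)\<leftarrow>comult H x. (S * snd V x1) $$ (i, j) * (T * snd W x2) $$ (k, l))"
      using b by (simp add: index_mult_mat_sum[OF cS c(1)] index_mult_mat_sum[OF cT c(2)] sum_product
          sum_list_sum_swap sum_list_const_mult[symmetric] split_def ac_simps del: index_mult_mat)
    also have "\<dots> = (\<Sum>(x1, x2)\<leftarrow>comult H x. (snd V' x1 * S) $$ (i, j) * (snd W' x2 * T) $$ (k, l))"
      by (simp only: lmod_hom_commute[OF S] lmod_hom_commute[OF T])
    also have "\<dots> = (\<Sum>a<fst V'. \<Sum>b<fst W'.
          (\<Sum>(x1, x2)\<leftarrow>comult H x. snd V' x1 $$ (i, a) * snd W' x2 $$ (k, b)) * (S $$ (a, j) * T $$ (b, l)))"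
      using b by (simp add: index_mult_mat_sum[OF c(3) cS] index_mult_mat_sum[OF c(4) cT] sum_product
          sum_list_sum_swap sum_list_const_mult[symmetric] split_def ac_simps del: index_mult_mat)
    also have "\<dots> = (snd (tensor_rep H V' W') x * (S \<otimes>\<^sub>K T)) $$ (i * fst W' + k, j * fst W + l)"
      using b by (simp add: sums index_pair_less sum_lessThan_mult kronecker_entry[OF cS cT] tensor_rep_entry lmod)
    finally show "((S \<otimes>\<^sub>K T) * snd (tensor_rep H V W) x) $$ (i * fst W' + k, j * fst W + l) = \<dots>" .
  qed
qed

section \<open>Tensor powers, duals and maps through the trivial module\<close>

primrec tensor_power :: "('k::field, 'a) hopf \<Rightarrow> ('k, 'a) rep \<Rightarrow> nat \<Rightarrow> ('k, 'a) rep" where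
  "tensor_power H V 0 = unit_rep H"
| "tensor_power H V (Suc n) = tensor_rep H V (tensor_power H V n)"

lemma fst_tensor_power [simp]: "fst (tensor_power H V n) = fst V ^ n"
  by (induction n) simp_all

text \<open>The left dual: using the antipode itself, rather than its inverse, makes evaluation
  linear with the dual on the left and coevaluation linear with the dual on the right.\<close>

definition dual_rep :: "('k::field, 'a) hopf \<Rightarrow> ('k, 'a) rep \<Rightarrow> ('k, 'a) rep" where
  "dual_rep H V = (fst V, \<lambda>x. transpose_mat (snd V (antipode H x)))"

lemma fst_dual_rep [simp]: "fst (dual_rep H V) = fst V"
  by (simp add: dual_rep_def)

text \<open>The vector of all \<open>e_i\<close> tensor \<open>e_i\<close>; \<open>i div d\<close>
  and \<open>i mod d\<close> are the two legs of the index \<open>i\<close>.\<close>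

definition coev_mat :: "nat \<Rightarrow> 'k::semiring_1 mat" where
  "coev_mat d = mat (d * d) 1 (\<lambda>(i, _). if i div d = i mod d then 1 else 0)"

definition ev_mat :: "nat \<Rightarrow> 'k::semiring_1 mat" where
  "ev_mat d = mat 1 (d * d) (\<lambda>(_, j). if j div d = j mod d then 1 else 0)"

lemma coev_mat_carrier [simp]: "coev_mat d \<in> carrier_mat (d * d) 1"
  and ev_mat_carrier [simp]: "ev_mat d \<in> carrier_mat 1 (d * d)"
  by (simp_all add: coev_mat_def ev_mat_def)

lemma coev_mat_entry: "i < d \<Longrightarrow> k < d \<Longrightarrow> coev_mat d $$ (i * d + k, 0) = (if i = k then 1 else 0)"
  and ev_mat_entry: "i < d \<Longrightarrow> k < d \<Longrightarrow> ev_mat d $$ (0, i * d + k) = (if i = k then 1 else 0)"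
  by (simp_all add: coev_mat_def ev_mat_def index_pair_less)

text \<open>Finite sums of endomorphisms factoring through the unit object. The inductive form lets
  an additive functor be followed one summand at a time.\<close>

inductive factors_trivially :: "('k::field, 'a::ring_1) hopf \<Rightarrow> ('k, 'a) rep \<Rightarrow> 'k mat \<Rightarrow> bool" for H V where
  zero: "factors_trivially H V (0\<^sub>m (fst V) (fst V))"
| add: "p \<in> lmod_hom (unit_rep H) V \<Longrightarrow> q \<in> lmod_hom V (unit_rep H) \<Longrightarrow> factors_trivially H V X \<Longrightarrow>
    factors_trivially H V (p * q + X)"

context hopf_algebra
begin

lemma unit_rep_lmod: "unit_rep H \<in> lmod H"
  using counit_linear_form
  by (intro lmodI) (auto intro!: eq_matI simp: unit_rep_def linear_form_def counit_mult counit_one scalar_prod_def)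

text \<open>The comultiplication is a linear algebra homomorphism. In pair coordinates every entry
  is a bilinear form in its legs, to which the \<open>comult_sum\<close> rules apply.\<close>

lemma tensor_rep_lmod:
  assumes V: "V \<in> lmod H" and W: "W \<in> lmod H"
  shows "tensor_rep H V W \<in> lmod H"
proof (rule lmodI, unfold fst_tensor_rep)
  note c = tensor_rep_carrier[OF V W]
  show "snd (tensor_rep H V W) x \<in> carrier_mat (fst V * fst W) (fst V * fst W)" for x
    by (rule c)
  note e = tensor_rep_entry[OF V W]
  have lin: "linear_form H (\<lambda>x. snd V x $$ (i, j) * snd W y $$ (k, l))"
    "linear_form H (\<lambda>y. snd V x $$ (i, j) * snd W y $$ (k, l))"
    if "i < fst V" "k < fst W" "j < fst V" "l < fst W" for i j k l x y
    using that by (simp_all add: linear_form_def lmod_entries[OF V] lmod_entries[OF W] algebra_simps)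
  show "snd (tensor_rep H V W) (x + y) = snd (tensor_rep H V W) x + snd (tensor_rep H V W) y" for x y
    by (rule eq_mat_pairI[OF c add_carrier_mat[OF c]])
      (simp add: e comult_sum_add[OF lin] index_pair_less carrier_matD[OF c])
  show "snd (tensor_rep H V W) (Defs.scale H a x) = a \<cdot>\<^sub>m snd (tensor_rep H V W) x" for a x
    by (rule eq_mat_pairI[OF c smult_carrier_mat[OF c]])
      (simp add: e comult_sum_scale[OF lin] index_pair_less carrier_matD[OF c])
  show "snd (tensor_rep H V W) 1 = 1\<^sub>m (fst V * fst W)"
    by (rule eq_mat_pairI[OF c one_carrier_mat])
      (simp add: e comult_sum_one[OF lin] lmodD[OF V] lmodD[OF W]
        kronecker_entry[OF one_carrier_mat one_carrier_mat] flip: kronecker_one)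
  fix x y
  show "snd (tensor_rep H V W) (x * y) = snd (tensor_rep H V W) x * snd (tensor_rep H V W) y"
  proof (rule eq_mat_pairI[OF c mult_carrier_mat[OF c c]])
    fix i k j l assume b: "i < fst V" "k < fst W" "j < fst V" "l < fst W"
    have "(snd (tensor_rep H V W) x * snd (tensor_rep H V W) y) $$ (i * fst W + k, j * fst W + l) =
      (\<Sum>a<fst V. \<Sum>b<fst W. \<Sum>(y1, y2)\<leftarrow>comult H y. \<Sum>(x1, x2)\<leftarrow>comult H x.
        snd V x1 $$ (i, a) * snd W x2 $$ (k, b) * (snd V y1 $$ (a, j) * snd W y2 $$ (b, l)))"
      using b by (simp add: index_mult_mat_sum[OF c c] index_pair_less sum_lessThan_mult e split_def
          sum_list_mult_const[symmetric] sum_list_const_mult[symmetric])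
    also have "\<dots> = (\<Sum>(y1, y2)\<leftarrow>comult H y. \<Sum>(x1, x2)\<leftarrow>comult H x.
        snd V (x1 * y1) $$ (i, j) * snd W (x2 * y2) $$ (k, l))"
      using b by (simp add: lmod_mult_entry[OF V] lmod_mult_entry[OF W] sum_product sum_list_sum_swap split_def ac_simps)
    also have "\<dots> = (\<Sum>(x1, x2)\<leftarrow>comult H x. \<Sum>(y1, y2)\<leftarrow>comult H y.
        snd V (x1 * y1) $$ (i, j) * snd W (x2 * y2) $$ (k, l))"
      unfolding split_def by (rule sum_list_swap)
    also have "\<dots> = snd (tensor_rep H V W) (x * y) $$ (i * fst W + k, j * fst W + l)"
      using b by (simp add: e comult_sum_mult[OF lin])
    finally show "snd (tensor_rep H V W) (x * y) $$ (i * fst W + k, j * fst W + l) =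
      (snd (tensor_rep H V W) x * snd (tensor_rep H V W) y) $$ (i * fst W + k, j * fst W + l)" by (rule sym)
  qed
qed

lemma tensor_power_lmod: "V \<in> lmod H \<Longrightarrow> tensor_power H V n \<in> lmod H"
  by (induction n) (simp_all add: unit_rep_lmod tensor_rep_lmod)

text \<open>By strictness this is a literal equality. It lets one matrix on a tensor power be read
  with \<open>V\<close> split off on either side, as \<open>slide\<close> requires.\<close>

lemma tensor_power_Suc_right:
  assumes "V \<in> lmod H"
  shows "tensor_rep H (tensor_power H V n) V = tensor_power H V (Suc n)"
proof (induction n)
  case 0
  show ?case
    using assms by (simp add: tensor_rep_unit_left[OF hopf_algebra_axioms] tensor_rep_unit_right[OF hopf_algebra_axioms])
next
  case (Suc n)
  then show ?case
    using assms by (simp add: tensor_rep_assoc[OF hopf_algebra_axioms] tensor_power_lmod)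
qed

text \<open>At row \<open>(i, w_1, ..., w_n)\<close> and column \<open>(w_1, ..., w_n, j)\<close>
  the legs contribute their entries \<open>(i, w_1)\<close>, \<open>(w_1, w_2)\<close>, up to
  \<open>(w_n, j)\<close>. Summing over all \<open>w\<close> multiplies the matrices of the
  \<open>n + 1\<close> legs in order.\<close>

lemma slide_tensor_power:
  assumes V: "V \<in> lmod H"
  shows "slide (fst V) (fst V ^ n) (snd (tensor_power H V (Suc n)) x) =
    snd V (\<Sum>xs\<leftarrow>iter_comult H n x. prod_list xs)" (is "?L n x = snd V (?P n x)")
proof (rule eq_matI)
  let ?d = "fst V"
  fix i j assume "i < dim_row (snd V (?P n x))" "j < dim_col (snd V (?P n x))"
  then have "i < ?d" "j < ?d" using V by auto
  then show "?L n x $$ (i, j) = snd V (?P n x) $$ (i, j)"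
  proof (induction n arbitrary: x i j)
    case 0
    then show ?case by (simp add: slide_def tensor_rep_unit_right[OF hopf_algebra_axioms V])
  next
    case (Suc n)
    let ?N = "?d ^ n" and ?T = "\<lambda>x. snd (tensor_power H V (Suc n)) x"
    note T = tensor_power_lmod[OF V, of "Suc n"]
    have entry: "snd (tensor_power H V (Suc (Suc n))) x $$ (i * (?d * ?N) + (a * ?N + w), (a * ?N + w) * ?d + j) =
      (\<Sum>(x1, x2)\<leftarrow>comult H x. snd V x1 $$ (i, a) * ?T x2 $$ (a * ?N + w, w * ?d + j))"
      if "a < ?d" "w < ?N" for a w
    proof -
      \<comment> \<open>The column is regrouped: its leading leg is \<open>a\<close>, and
        \<open>w * ?d + j\<close> indexes the remaining \<open>n + 1\<close> legs.\<close>
      have "(a * ?N + w) * ?d + j = a * (?d * ?N) + (w * ?d + j)" by (simp add: algebra_simps)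
      then show ?thesis
        using tensor_rep_entry[OF V T Suc.prems(1) _ that(1), of "a * ?N + w" "w * ?d + j" x]
          index_pair_less[OF that] index_pair_less[OF that(2) Suc.prems(2)]
        by (simp add: mult.commute add.assoc)
    qed
    have "?L (Suc n) x $$ (i, j) = (\<Sum>a<?d. \<Sum>w<?N. \<Sum>(x1, x2)\<leftarrow>comult H x.
        snd V x1 $$ (i, a) * ?T x2 $$ (a * ?N + w, w * ?d + j))"
      using Suc.prems by (simp add: slide_def sum_lessThan_mult entry del: tensor_power.simps)
    also have "\<dots> = (\<Sum>(x1, x2)\<leftarrow>comult H x. \<Sum>a<?d. snd V x1 $$ (i, a) * (?L n x2 $$ (a, j)))"
      using Suc.prems
      by (simp add: sum_list_sum_swap split_def slide_def sum_distrib_left del: tensor_power.simps)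
    also have "\<dots> = (\<Sum>(x1, x2)\<leftarrow>comult H x. snd V (x1 * ?P n x2) $$ (i, j))"
      using Suc by (simp add: lmod_mult_entry[OF V])
    also have "\<dots> = snd V (\<Sum>(x1, x2)\<leftarrow>comult H x. x1 * ?P n x2) $$ (i, j)"
      using Suc.prems by (simp add: lmod_sum_list[OF hopf_algebra_axioms V] split_def comp_def)
    also have "(\<Sum>(x1, x2)\<leftarrow>comult H x. x1 * ?P n x2) = ?P (Suc n) x"
      by (simp add: sum_list_concat_pairs split_def comp_def sum_list_const_mult)
    finally show ?case .
  qed
qed (use V in \<open>auto simp: slide_def\<close>)

text \<open>With row \<open>(w_1, ..., w_n, i)\<close> and column \<open>(j, w_1, ..., w_n)\<close>
  the entries are \<open>(w_1, j)\<close>, \<open>(w_2, w_1)\<close>, up to \<open>(i, w_n)\<close>,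
  so the chain runs backwards through the legs.\<close>

lemma slide'_tensor_power:
  assumes V: "V \<in> lmod H"
  shows "slide' (fst V) (fst V ^ n) (snd (tensor_power H V (Suc n)) x) =
    snd V (\<Sum>xs\<leftarrow>iter_comult H n x. prod_list (rev xs))" (is "?L n x = snd V (?P n x)")
proof (rule eq_matI)
  let ?d = "fst V"
  fix i j assume "i < dim_row (snd V (?P n x))" "j < dim_col (snd V (?P n x))"
  then have "i < ?d" "j < ?d" using V by auto
  then show "?L n x $$ (i, j) = snd V (?P n x) $$ (i, j)"
  proof (induction n arbitrary: x i j)
    case 0
    then show ?case by (simp add: slide'_def tensor_rep_unit_right[OF hopf_algebra_axioms V])
  next
    case (Suc n)
    let ?N = "?d ^ n" and ?T = "\<lambda>x. snd (tensor_power H V (Suc n)) x"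
    note T = tensor_power_lmod[OF V, of "Suc n"]
    have entry: "snd (tensor_power H V (Suc (Suc n))) x $$ ((a * ?N + w) * ?d + i, j * (?d * ?N) + (a * ?N + w)) =
      (\<Sum>(x1, x2)\<leftarrow>comult H x. snd V x1 $$ (a, j) * ?T x2 $$ (w * ?d + i, a * ?N + w))"
      if "a < ?d" "w < ?N" for a w
    proof -
      have "(a * ?N + w) * ?d + i = a * (?d * ?N) + (w * ?d + i)" by (simp add: algebra_simps)
      then show ?thesis
        using tensor_rep_entry[OF V T that(1) _ Suc.prems(2), of "w * ?d + i" "a * ?N + w" x]
          index_pair_less[OF that] index_pair_less[OF that(2) Suc.prems(1)]
        by (simp add: mult.commute add.assoc)
    qed
    have "?L (Suc n) x $$ (i, j) = (\<Sum>a<?d. \<Sum>w<?N. \<Sum>(x1, x2)\<leftarrow>comult H x.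
        snd V x1 $$ (a, j) * ?T x2 $$ (w * ?d + i, a * ?N + w))"
      using Suc.prems by (simp add: slide'_def sum_lessThan_mult entry del: tensor_power.simps)
    also have "\<dots> = (\<Sum>(x1, x2)\<leftarrow>comult H x. \<Sum>a<?d. ?L n x2 $$ (i, a) * snd V x1 $$ (a, j))"
      using Suc.prems
      by (simp add: sum_list_sum_swap split_def slide'_def sum_distrib_left mult.commute del: tensor_power.simps)
    also have "\<dots> = (\<Sum>(x1, x2)\<leftarrow>comult H x. snd V (?P n x2 * x1) $$ (i, j))"
      using Suc by (simp add: lmod_mult_entry[OF V])
    also have "\<dots> = snd V (\<Sum>(x1, x2)\<leftarrow>comult H x. ?P n x2 * x1) $$ (i, j)"
      using Suc.prems by (simp add: lmod_sum_list[OF hopf_algebra_axioms V] split_def comp_def)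
    also have "(\<Sum>(x1, x2)\<leftarrow>comult H x. ?P n x2 * x1) = ?P (Suc n) x"
      by (simp add: sum_list_concat_pairs split_def comp_def sum_list_mult_const)
    finally show ?case .
  qed
qed (use V in \<open>auto simp: slide'_def\<close>)

lemma dual_rep_entry:
  "V \<in> lmod H \<Longrightarrow> i < fst V \<Longrightarrow> j < fst V \<Longrightarrow> snd (dual_rep H V) x $$ (i, j) = snd V (antipode H x) $$ (j, i)"
  by (simp add: dual_rep_def)

text \<open>Antipode and transposition both reverse products, so their composite preserves
  them.\<close>

lemma dual_rep_lmod:
  assumes "V \<in> lmod H"
  shows "dual_rep H V \<in> lmod H"
proof (rule lmodI)
  note c = lmod_carrier[OF assms]
  show "snd (dual_rep H V) (x * y) = snd (dual_rep H V) x * snd (dual_rep H V) y" for x y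
    using transpose_mult[OF c c] by (simp add: dual_rep_def antipode_mult lmodD[OF assms])
qed (use assms in \<open>auto simp: dual_rep_def antipode_add antipode_scale antipode_one lmodD[OF assms]\<close>)

text \<open>The axiom \<open>antipode_right\<close> in matrix entries: contracting the inner indices
  multiplies \<open>x1\<close> by the antipode of \<open>x2\<close>.\<close>

lemma coev_mat_hom:
  assumes V: "V \<in> lmod H"
  shows "coev_mat (fst V) \<in> lmod_hom (unit_rep H) (tensor_rep H V (dual_rep H V))"
proof (rule lmod_homI)
  let ?d = "fst V" and ?T = "tensor_rep H V (dual_rep H V)"
  note V' = dual_rep_lmod[OF V]
  have cT: "snd ?T x \<in> carrier_mat (?d * ?d) (?d * ?d)" for x
    using tensor_rep_carrier[OF V V'] by simp
  show "coev_mat ?d \<in> carrier_mat (fst ?T) (fst (unit_rep H))" by (simp del: One_nat_def)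
  fix x
  show "coev_mat ?d * snd (unit_rep H) x = snd ?T x * coev_mat ?d"
  proof (rule eq_mat_pairI[of _ ?d ?d 1 1])
    show "coev_mat ?d * snd (unit_rep H) x \<in> carrier_mat (?d * ?d) (1 * 1)"
      using lmod_carrier[OF unit_rep_lmod, of x] by (auto intro!: mult_carrier_mat simp del: One_nat_def)
    show "snd ?T x * coev_mat ?d \<in> carrier_mat (?d * ?d) (1 * 1)"
      using mult_carrier_mat[OF cT coev_mat_carrier] by simp
    fix i k j l :: nat assume b: "i < ?d" "k < ?d" "j < 1" "l < 1"
    have "(snd ?T x * coev_mat ?d) $$ (i * ?d + k, 0) = (\<Sum>a<?d. \<Sum>b<?d.
        (\<Sum>(x1, x2)\<leftarrow>comult H x. snd V x1 $$ (i, a) * snd V (antipode H x2) $$ (b, k)) * (if a = b then 1 else 0))"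
      using b tensor_rep_entry[OF V V'] by (simp add: index_mult_mat_sum[OF cT coev_mat_carrier] index_pair_less
          sum_lessThan_mult coev_mat_entry dual_rep_entry[OF V] del: index_mult_mat)
    also have "\<dots> = (\<Sum>(x1, x2)\<leftarrow>comult H x. snd V (x1 * antipode H x2) $$ (i, k))"
      using b by (simp add: if_distrib[of "\<lambda>x. _ * x"] lmod_mult_entry[OF V] sum_list_sum_swap split_def cong: if_cong)
    also have "\<dots> = counit H x * snd V 1 $$ (i, k)"
      using antipode_sum_right[OF lmod_entry_linear[OF V]] b by simp
    also have "\<dots> = (coev_mat ?d * snd (unit_rep H) x) $$ (i * ?d + k, 0)"
      using b lmod_carrier[OF unit_rep_lmod, of x] coev_mat_entry[OF b(1,2), where 'a = 'k]
      by (subst index_mult_mat_sum[OF coev_mat_carrier]) (auto simp: lmodD[OF V] index_pair_less)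
    finally show "(coev_mat ?d * snd (unit_rep H) x) $$ (i * ?d + k, j * 1 + l) = (snd ?T x * coev_mat ?d) $$ (i * ?d + k, j * 1 + l)"
      using b by simp
  qed
qed

text \<open>The axiom \<open>antipode_left\<close> in matrix entries.\<close>

lemma ev_mat_hom:
  assumes V: "V \<in> lmod H"
  shows "ev_mat (fst V) \<in> lmod_hom (tensor_rep H (dual_rep H V) V) (unit_rep H)"
proof (rule lmod_homI)
  let ?d = "fst V" and ?T = "tensor_rep H (dual_rep H V) V"
  note V' = dual_rep_lmod[OF V]
  have cT: "snd ?T x \<in> carrier_mat (?d * ?d) (?d * ?d)" for x
    using tensor_rep_carrier[OF V' V] by simp
  show "ev_mat ?d \<in> carrier_mat (fst (unit_rep H)) (fst ?T)" by (simp del: One_nat_def)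
  fix x
  show "ev_mat ?d * snd ?T x = snd (unit_rep H) x * ev_mat ?d"
  proof (rule eq_mat_pairI[of _ 1 1 ?d ?d])
    show "snd (unit_rep H) x * ev_mat ?d \<in> carrier_mat (1 * 1) (?d * ?d)"
      using lmod_carrier[OF unit_rep_lmod, of x] by (auto intro!: mult_carrier_mat simp del: One_nat_def)
    show "ev_mat ?d * snd ?T x \<in> carrier_mat (1 * 1) (?d * ?d)"
      using mult_carrier_mat[OF ev_mat_carrier cT] by simp
    fix i k j l :: nat assume b: "i < 1" "k < 1" "j < ?d" "l < ?d"
    have "(ev_mat ?d * snd ?T x) $$ (0, j * ?d + l) = (\<Sum>a<?d. \<Sum>b<?d. (if a = b then 1 else 0) *
        (\<Sum>(x1, x2)\<leftarrow>comult H x. snd V (antipode H x1) $$ (j, a) * snd V x2 $$ (b, l)))"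
      using b tensor_rep_entry[OF V' V] by (simp add: index_mult_mat_sum[OF ev_mat_carrier cT] index_pair_less
          sum_lessThan_mult ev_mat_entry dual_rep_entry[OF V] del: index_mult_mat)
    also have "\<dots> = (\<Sum>(x1, x2)\<leftarrow>comult H x. snd V (antipode H x1 * x2) $$ (j, l))"
      using b by (simp add: if_distrib[of "\<lambda>x. x * _"] lmod_mult_entry[OF V] sum_list_sum_swap split_def cong: if_cong)
    also have "\<dots> = counit H x * snd V 1 $$ (j, l)"
      using antipode_sum_left[OF lmod_entry_linear[OF V]] b by simp
    also have "\<dots> = (snd (unit_rep H) x * ev_mat ?d) $$ (0, j * ?d + l)"
      using b lmod_carrier[OF unit_rep_lmod, of x] ev_mat_entry[OF b(3,4), where 'b = 'k]
      by (subst index_mult_mat_sum[OF _ ev_mat_carrier]) (auto simp: lmodD[OF V] index_pair_less)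
    finally show "(ev_mat ?d * snd ?T x) $$ (i * 1 + k, j * ?d + l) = (snd (unit_rep H) x * ev_mat ?d) $$ (i * 1 + k, j * ?d + l)"
      using b by simp
  qed
qed

text \<open>A snake with the action of \<open>z\<close> inserted on the dual strand: straightening
  it transposes that action back. The case \<open>z = 1\<close> is the zigzag identity.\<close>

lemma antipode_planar:
  assumes V: "V \<in> lmod H"
  shows "(1\<^sub>m (fst V) \<otimes>\<^sub>K (ev_mat (fst V) * (snd (dual_rep H V) z \<otimes>\<^sub>K 1\<^sub>m (fst V)))) * (coev_mat (fst V) \<otimes>\<^sub>K 1\<^sub>m (fst V))
    = snd V (antipode H z)"
proof -
  let ?d = "fst V"
  have c: "snd (dual_rep H V) z \<in> carrier_mat ?d ?d" using lmod_carrier[OF dual_rep_lmod[OF V]] by simp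
  note c1 = kronecker_carrier[OF c one_carrier_mat[of ?d]]
  define q where "q = ev_mat ?d * (snd (dual_rep H V) z \<otimes>\<^sub>K 1\<^sub>m ?d)"
  have q: "q \<in> carrier_mat 1 (?d * ?d)" unfolding q_def by (rule mult_carrier_mat[OF ev_mat_carrier c1])
  have q_entry: "q $$ (0, i * ?d + j) = snd V (antipode H z) $$ (i, j)" if "i < ?d" "j < ?d" for i j
    using that unfolding q_def
    by (simp add: index_mult_mat_sum[OF ev_mat_carrier c1] index_pair_less sum_lessThan_mult ev_mat_entry
        kronecker_entry[OF c one_carrier_mat] dual_rep_entry[OF V] if_distrib[of "\<lambda>x. x * _"]
        if_distrib[of "\<lambda>x. _ * x"] del: index_mult_mat cong: if_cong)
  have "1\<^sub>m ?d \<otimes>\<^sub>K q \<in> carrier_mat ?d (?d * ?d * ?d)" "coev_mat ?d \<otimes>\<^sub>K 1\<^sub>m ?d \<in> carrier_mat (?d * ?d * ?d) ?d"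
    using kronecker_carrier[OF one_carrier_mat q, of ?d] kronecker_carrier[OF coev_mat_carrier one_carrier_mat, of ?d ?d]
    by (simp_all add: mult.assoc)
  note cL = mult_carrier_mat[OF this]
  show ?thesis unfolding q_def[symmetric]
  proof (rule eq_matI)
    fix i j assume "i < dim_row (snd V (antipode H z))" "j < dim_col (snd V (antipode H z))"
    then have b: "i < ?d" "j < ?d" using V by auto
    show "((1\<^sub>m ?d \<otimes>\<^sub>K q) * (coev_mat ?d \<otimes>\<^sub>K 1\<^sub>m ?d)) $$ (i, j) = snd V (antipode H z) $$ (i, j)"
      unfolding index_planar[OF coev_mat_carrier q b] using b
      by (simp add: coev_mat_entry q_entry if_distrib[of "\<lambda>x. x * _"] cong: if_cong)
  qed (use cL V in \<open>simp_all only: carrier_matD lmod_dim\<close>)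
qed

text \<open>Insert \<open>x2\<close> times the antipode of \<open>x3\<close>, which is a counit, in
  front of the second argument; then invariance of \<open>e\<close> removes the legs
  \<open>x1\<close> and \<open>x2\<close>. It replaces an identification of the dual of
  \<open>F(V)\<close> with the image of the dual of \<open>V\<close>.\<close>

lemma pairing_antipode:
  assumes lmod: "U \<in> lmod H" "W \<in> lmod H" and e: "e \<in> lmod_hom (tensor_rep H U W) (unit_rep H)"
  shows "e * (snd U x \<otimes>\<^sub>K 1\<^sub>m (fst W)) = e * (1\<^sub>m (fst U) \<otimes>\<^sub>K snd W (antipode H x))"
proof -
  let ?u = "fst U" and ?w = "fst W" and ?S = "antipode H"
  have ec: "e \<in> carrier_mat 1 (?u * ?w)" using lmod_hom_carrier[OF e] by simp
  note c = lmod[THEN lmod_carrier]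
  note c1 = kronecker_carrier[OF c(1) one_carrier_mat[of ?w]] kronecker_carrier[OF one_carrier_mat[of ?u] c(2)]
  have sum_if: "(\<Sum>t\<in>T. if P then h t else 0) = (if P then \<Sum>t\<in>T. h t else 0)" for P T and h :: "nat \<Rightarrow> 'k"
    by simp
  have L: "(e * (snd U x \<otimes>\<^sub>K 1\<^sub>m ?w)) $$ (0, i * ?w + k) = (\<Sum>s<?u. e $$ (0, s * ?w + k) * snd U x $$ (s, i))"
    and R: "(e * (1\<^sub>m ?u \<otimes>\<^sub>K snd W x)) $$ (0, i * ?w + k) = (\<Sum>t<?w. e $$ (0, i * ?w + t) * snd W x $$ (t, k))"
    if "i < ?u" "k < ?w" for i k x
    using that
    by (simp_all add: index_mult_mat_sum[OF ec c1(1)] index_mult_mat_sum[OF ec c1(2)] index_pair_less sum_lessThan_mult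
        kronecker_entry[OF c(1) one_carrier_mat] kronecker_entry[OF one_carrier_mat c(2)]
        if_distrib[of "\<lambda>x. x * _"] if_distrib[of "\<lambda>x. _ * x"] sum_if del: index_mult_mat cong: if_cong)
  have inv: "(\<Sum>(a, b)\<leftarrow>comult H y. \<Sum>s<?u. \<Sum>t<?w. e $$ (0, s * ?w + t) * (snd U a $$ (s, i) * snd W b $$ (t, k)))
      = counit H y * e $$ (0, i * ?w + k)" if "i < ?u" "k < ?w" for i k y
  proof -
    have "(e * snd (tensor_rep H U W) y) $$ (0, i * ?w + k) = (snd (unit_rep H) y * e) $$ (0, i * ?w + k)"
      by (simp only: lmod_hom_commute[OF e])
    moreover have "(snd (unit_rep H) y * e) $$ (0, i * ?w + k) = counit H y * e $$ (0, i * ?w + k)"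
      using lmod_carrier[OF unit_rep_lmod, of y] index_pair_less[OF that]
      by (subst index_mult_mat_sum[OF _ ec]) auto
    ultimately show ?thesis
      using that by (simp add: index_mult_mat_sum[OF ec tensor_rep_carrier[OF lmod]] index_pair_less sum_lessThan_mult
        tensor_rep_entry[OF lmod] sum_list_sum_swap sum_list_const_mult[symmetric] split_def del: index_mult_mat)
  qed
  show ?thesis
  proof (rule eq_mat_pairI[of _ 1 1 ?u ?w])
    show "e * (snd U x \<otimes>\<^sub>K 1\<^sub>m ?w) \<in> carrier_mat (1 * 1) (?u * ?w)"
      "e * (1\<^sub>m ?u \<otimes>\<^sub>K snd W (?S x)) \<in> carrier_mat (1 * 1) (?u * ?w)"
      using mult_carrier_mat[OF ec c1(1)] mult_carrier_mat[OF ec c1(2)] by simp_all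
    fix i' k' i k :: nat assume b: "i' < 1" "k' < 1" "i < ?u" "k < ?w"
    \<comment> \<open>The pairing of \<open>a\<close> applied to the \<open>i\<close>-th basis
      vector with \<open>b\<close> times the antipode of \<open>c\<close> applied to the
      \<open>k\<close>-th one; it is evaluated on three legs of \<open>x\<close>.\<close>
    define g where "g a b c = (\<Sum>s<?u. \<Sum>t<?w. e $$ (0, s * ?w + t) * (snd U a $$ (s, i) * snd W (b * ?S c) $$ (t, k)))" for a b c
    have g: "linear_form H (\<lambda>x. g x y z)" "linear_form H (\<lambda>y. g x y z)" "linear_form H (g x y)" for x y z
      using b by (simp_all add: g_def linear_simps lmod_entries[OF lmod(1)] lmod_entries[OF lmod(2)]
          sum.distrib sum_distrib_left ac_simps)
    have g': "g a b c = (\<Sum>r<?w. (\<Sum>s<?u. \<Sum>t<?w. e $$ (0, s * ?w + t) * (snd U a $$ (s, i) * snd W b $$ (t, r))) * snd W (?S c) $$ (r, k))"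
      for a b c
    proof -
      have "g a b c = (\<Sum>s<?u. \<Sum>t<?w. \<Sum>r<?w. e $$ (0, s * ?w + t) * (snd U a $$ (s, i) * snd W b $$ (t, r)) * snd W (?S c) $$ (r, k))"
        using b by (simp add: g_def lmod_mult_entry[OF lmod(2)] sum_distrib_left ac_simps)
      also have "\<dots> = (\<Sum>r<?w. \<Sum>s<?u. \<Sum>t<?w. e $$ (0, s * ?w + t) * (snd U a $$ (s, i) * snd W b $$ (t, r)) * snd W (?S c) $$ (r, k))"
        by (subst (2) sum.swap, subst sum.swap) (rule refl)
      finally show ?thesis by (simp add: sum_distrib_right)
    qed
    have "(\<Sum>(x11, x12)\<leftarrow>comult H x1. g x11 x12 x2) = (\<Sum>r<?w. counit H x1 * e $$ (0, i * ?w + r) * snd W (?S x2) $$ (r, k))" for x1 x2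
    proof -
      have "(\<Sum>(x11, x12)\<leftarrow>comult H x1. g x11 x12 x2) = (\<Sum>r<?w. (\<Sum>(x11, x12)\<leftarrow>comult H x1.
          \<Sum>s<?u. \<Sum>t<?w. e $$ (0, s * ?w + t) * (snd U x11 $$ (s, i) * snd W x12 $$ (t, r))) * snd W (?S x2) $$ (r, k))"
        by (simp only: g' split_def sum_list_sum_swap[symmetric] sum_list_mult_const)
      also have "\<dots> = (\<Sum>r<?w. counit H x1 * e $$ (0, i * ?w + r) * snd W (?S x2) $$ (r, k))"
        by (rule sum.cong) (simp_all only: inv[OF b(3)] lessThan_iff)
      finally show ?thesis .
    qed
    then have "(\<Sum>(x1, x2)\<leftarrow>comult H x. \<Sum>(x11, x12)\<leftarrow>comult H x1. g x11 x12 x2)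
      = (\<Sum>(x1, x2)\<leftarrow>comult H x. \<Sum>r<?w. counit H x1 * e $$ (0, i * ?w + r) * snd W (?S x2) $$ (r, k))"
      by (simp only:)
    also have "\<dots> = (\<Sum>(x1, x2)\<leftarrow>comult H x. counit H x1 * (\<Sum>r<?w. e $$ (0, i * ?w + r) * snd W (?S x2) $$ (r, k)))"
      by (simp add: sum_distrib_left mult.assoc)
    also have "\<dots> = (\<Sum>r<?w. e $$ (0, i * ?w + r) * snd W (?S x) $$ (r, k))"
      by (rule counit_sum_left) (use b in \<open>simp add: linear_simps lmod_entries[OF lmod(2)] sum.distrib sum_distrib_left ac_simps\<close>)
    finally have left: "(\<Sum>(x1, x2)\<leftarrow>comult H x. \<Sum>(x11, x12)\<leftarrow>comult H x1. g x11 x12 x2) = \<dots>" .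
    have "(\<Sum>(x21, x22)\<leftarrow>comult H x2. g x1 x21 x22) = counit H x2 * (\<Sum>s<?u. e $$ (0, s * ?w + k) * snd U x1 $$ (s, i))" for x1 x2
    proof -
      \<comment> \<open>Setting the last argument to \<open>1\<close>, whose antipode is
        \<open>1\<close>, leaves the middle slot free for the product that the antipode axiom
        collapses.\<close>
      have lin: "linear_form H (\<lambda>y. g x1 y 1)" by (rule g)
      have "(\<Sum>(x21, x22)\<leftarrow>comult H x2. g x1 (x21 * ?S x22) 1) = counit H x2 * g x1 1 1"
        by (rule antipode_sum_right[OF lin])
      then show ?thesis
        using b by (simp add: g_def antipode_one lmodD(4)[OF lmod(2)] if_distrib[of "\<lambda>x. _ * x"] cong: if_cong)
    qed
    then have "(\<Sum>(x1, x2)\<leftarrow>comult H x. \<Sum>(x21, x22)\<leftarrow>comult H x2. g x1 x21 x22) =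
        (\<Sum>(x1, x2)\<leftarrow>comult H x. counit H x2 * (\<Sum>s<?u. e $$ (0, s * ?w + k) * snd U x1 $$ (s, i)))"
      by (simp only:)
    also have "\<dots> = (\<Sum>s<?u. e $$ (0, s * ?w + k) * snd U x $$ (s, i))"
      by (rule counit_sum_right) (use b in \<open>simp add: linear_simps lmod_entries[OF lmod(1)] sum.distrib sum_distrib_left ac_simps\<close>)
    finally show "(e * (snd U x \<otimes>\<^sub>K 1\<^sub>m ?w)) $$ (i' * 1 + k', i * ?w + k) =
        (e * (1\<^sub>m ?u \<otimes>\<^sub>K snd W (?S x))) $$ (i' * 1 + k', i * ?w + k)"
      using comult_sum_coassoc[OF g, of x] left b by (simp add: L R del: index_mult_mat)
  qed
qed

lemma factors_trivially_hom:
  assumes V: "V \<in> lmod H" and "factors_trivially H V X"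
  shows "X \<in> lmod_hom V V"
  using assms(2)
  by induction (simp_all add: lmod_hom_zero[OF V V] lmod_hom_add[OF V V] lmod_hom_mult[OF V unit_rep_lmod V])

text \<open>Write the action \<open>M\<close> of the integral as \<open>M * X\<close> times
  \<open>M\<close> and expand into columns times rows. The columns of \<open>M * X\<close> are
  invariant vectors because the integral is left, and the rows of \<open>M\<close> are invariant
  forms because it is right.\<close>

lemma factors_trivially_integral:
  assumes V: "V \<in> lmod H" and left: "left_integral H \<Lambda>" and right: "right_integral H \<Lambda>"
  shows "factors_trivially H V (snd V \<Lambda>)"
proof -
  define d where "d = fst V"
  define M where "M = snd V \<Lambda>"
  have M: "M \<in> carrier_mat d d" using lmod_carrier[OF V] by (simp add: M_def d_def)
  obtain X where X: "X \<in> carrier_mat d d" and MXM: "M * X * M = M"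
    using generalized_inverse_mat[OF M] .
  have c: "snd V x \<in> carrier_mat d d" for x using lmod_carrier[OF V] by (simp add: d_def)
  have MX: "M * X \<in> carrier_mat d d" using M X by simp
  have left': "snd V x * (M * X) = counit H x \<cdot>\<^sub>m (M * X)" for x
    using left assoc_mult_mat[OF c M X] M X unfolding left_integral_def M_def lmodD[OF V, symmetric]
    by (metis M_def lmodD(2,3)[OF V] mult_smult_assoc_mat)
  have right': "M * snd V x = counit H x \<cdot>\<^sub>m M" for x
    using right unfolding right_integral_def M_def by (metis lmodD(2,3)[OF V])
  define p where "p k = mat d 1 (\<lambda>(i, _). (M * X) $$ (i, k))" for k
  define q where "q k = mat 1 d (\<lambda>(_, j). M $$ (k, j))" for k
  have pc: "p k \<in> carrier_mat d 1" and qc: "q k \<in> carrier_mat 1 d" for k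
    by (simp_all add: p_def q_def)
  have p_entry: "p k $$ (i, 0) = (M * X) $$ (i, k)" and q_entry: "q k $$ (0, i) = M $$ (k, i)" if "i < d" for i k
    using that by (simp_all add: p_def q_def)
  have unit_c: "snd (unit_rep H) x \<in> carrier_mat 1 1" for x
    using lmod_carrier[OF unit_rep_lmod] by simp
  have p: "p k \<in> lmod_hom (unit_rep H) V" if "k < d" for k
  proof (rule lmod_homI)
    show "p k * snd (unit_rep H) x = snd V x * p k" for x
    proof (rule eq_matI)
      fix i j assume "i < dim_row (snd V x * p k)" "j < dim_col (snd V x * p k)"
      then have b: "i < d" "j = 0" using c[of x] pc[of k] by auto
      have "(snd V x * p k) $$ (i, 0) = (snd V x * (M * X)) $$ (i, k)"
        using b that by (simp add: index_mult_mat_sum[OF c pc] index_mult_mat_sum[OF c MX] p_entry del: index_mult_mat)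
      then show "(p k * snd (unit_rep H) x) $$ (i, j) = (snd V x * p k) $$ (i, j)"
        using b that M X by (simp add: index_mult_mat_sum[OF pc unit_c] left' p_entry del: index_mult_mat(1))
    qed (use c[of x] pc[of k] unit_c[of x] in auto)
  qed (use pc in \<open>simp add: d_def\<close>)
  have q: "q k \<in> lmod_hom V (unit_rep H)" if "k < d" for k
  proof (rule lmod_homI)
    show "q k * snd V x = snd (unit_rep H) x * q k" for x
    proof (rule eq_matI)
      fix i j assume "i < dim_row (snd (unit_rep H) x * q k)" "j < dim_col (snd (unit_rep H) x * q k)"
      then have b: "i = 0" "j < d" using unit_c[of x] qc[of k] by auto
      have "(q k * snd V x) $$ (0, j) = (M * snd V x) $$ (k, j)"
        using b that by (simp add: index_mult_mat_sum[OF qc c] index_mult_mat_sum[OF M c] q_entry del: index_mult_mat)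
      then show "(q k * snd V x) $$ (i, j) = (snd (unit_rep H) x * q k) $$ (i, j)"
        using b that M by (simp add: index_mult_mat_sum[OF unit_c qc] right' q_entry del: index_mult_mat(1))
    qed (use c[of x] qc[of k] unit_c[of x] in auto)
  qed (use qc in \<open>simp add: d_def\<close>)
  \<comment> \<open>Induction over partial sums; the full sum \<open>r = d\<close> is
    \<open>M * X * M\<close>, which equals \<open>M\<close>.\<close>
  have "factors_trivially H V (mat d d (\<lambda>(i, j). \<Sum>k<r. (M * X) $$ (i, k) * M $$ (k, j)))" if "r \<le> d" for r
    using that
  proof (induction r)
    case 0
    have "mat d d (\<lambda>(i, j). \<Sum>k<0. (M * X) $$ (i, k) * M $$ (k, j)) = 0\<^sub>m (fst V) (fst V)"
      by (auto simp: d_def)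
    then show ?case by (simp only: factors_trivially.zero)
  next
    case (Suc r)
    have "mat d d (\<lambda>(i, j). \<Sum>k<Suc r. (M * X) $$ (i, k) * M $$ (k, j)) =
      p r * q r + mat d d (\<lambda>(i, j). \<Sum>k<r. (M * X) $$ (i, k) * M $$ (k, j))"
      using pc[of r] qc[of r] by (intro eq_matI) (simp_all add: index_mult_mat_sum[OF pc qc] p_entry q_entry del: index_mult_mat(1))
    then show ?case using Suc p[of r] q[of r] by (simp add: factors_trivially.add)
  qed
  from this[of d] have "factors_trivially H V (mat d d (\<lambda>(i, j). \<Sum>k<d. (M * X) $$ (i, k) * M $$ (k, j)))" by simp
  also have "mat d d (\<lambda>(i, j). \<Sum>k<d. (M * X) $$ (i, k) * M $$ (k, j)) = M"
    by (subst (3) MXM[symmetric], rule eq_matI)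
      (use M MX in \<open>simp_all add: index_mult_mat_sum[OF MX M] del: index_mult_mat(1)\<close>)
  finally show ?thesis unfolding M_def .
qed

end

section \<open>The regular module\<close>

lemma eq_mat_columnI:
  fixes M N :: "'k::semiring_1 mat"
  assumes M: "M \<in> carrier_mat n m" and N: "N \<in> carrier_mat n m"
    and eq: "\<And>w. w \<in> carrier_mat m 1 \<Longrightarrow> M * w = N * w"
  shows "M = N"
proof (rule eq_matI)
  fix i j assume "i < dim_row N" "j < dim_col N"
  then have b: "i < n" "j < m" using N by auto
  define w where "w = mat m 1 (\<lambda>(k, _). if k = j then 1 else 0 :: 'k)"
  have w: "w \<in> carrier_mat m 1" by (simp add: w_def)
  have entry: "(X * w) $$ (i, 0) = X $$ (i, j)" if "X \<in> carrier_mat n m" for X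
    using b by (simp add: index_mult_mat_sum[OF that w] del: index_mult_mat(1))
      (simp add: w_def if_distrib[of "\<lambda>x. _ * x"] cong: if_cong)
  from entry[OF M] entry[OF N] eq[OF w] show "M $$ (i, j) = N $$ (i, j)" by simp
qed (use M N in auto)

text \<open>\<open>R\<close> is the regular module and \<open>coord x\<close> the column of coordinates of \<open>x\<close>.\<close>

definition regular_coordinates :: "('k::field, 'a::ring_1) hopf \<Rightarrow> ('k, 'a) rep \<Rightarrow> ('a \<Rightarrow> 'k mat) \<Rightarrow> bool" where
  "regular_coordinates H R coord \<longleftrightarrow> R \<in> lmod H \<and> inj coord \<and> range coord = carrier_mat (fst R) 1 \<and>
    (\<forall>x y. snd R x * coord y = coord (x * y)) \<and>
    (\<forall>V\<in>lmod H. \<forall>w\<in>carrier_mat (fst V) 1. \<exists>T\<in>lmod_hom R V. \<forall>x. T * coord x = snd V x * w)"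

lemma regular_coordinatesD:
  assumes "regular_coordinates H R coord"
  shows "R \<in> lmod H" "coord x \<in> carrier_mat (fst R) 1" "inj coord"
    "v \<in> carrier_mat (fst R) 1 \<Longrightarrow> v \<in> range coord"
    "snd R x * coord y = coord (x * y)"
    "V \<in> lmod H \<Longrightarrow> w \<in> carrier_mat (fst V) 1 \<Longrightarrow> \<exists>T\<in>lmod_hom R V. \<forall>x. T * coord x = snd V x * w"
  using assms unfolding regular_coordinates_def by blast+

context fin_dim_hopf_algebra
begin

lemma coordinates:
  "\<exists>(d::nat) b c. (\<forall>i. linear_form H (c i)) \<and> (\<forall>x. (\<Sum>i<d. Defs.scale H (c i x) (b i)) = x) \<and>
    (\<forall>i<d. \<forall>j<d. c i (b j) = (if i = j then 1 else 0))"
proof -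
  obtain B0 where B0: "finite B0" "vs.span B0 = UNIV" using finite_dimensional by blast
  obtain B where B: "B \<subseteq> B0" "vs.independent B" "B0 \<subseteq> vs.span B"
    using vs.maximal_independent_subset[of B0] by blast
  have fin: "finite B" by (rule finite_subset[OF B(1) B0(1)])
  have span: "v \<in> vs.span B" for v
    using subsetD[OF vs.span_minimal[OF B(3) vs.subspace_span], of v] unfolding B0(2) by (simp only: UNIV_I)
  obtain b where b: "bij_betw b {0..<card B} B" using ex_bij_betw_nat_finite[OF fin] by blast
  define c where "c i x = vs.representation B x (b i)" for i x
  show ?thesis
  proof (intro exI[of _ "card B"] exI[of _ b] exI[of _ c] conjI allI impI)
    show "linear_form H (c i)" for i
      by (simp only: linear_form_def c_def vs.representation_add[OF B(2) span span]
          vs.representation_scale[OF B(2) span] simp_thms)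
    show "(\<Sum>i<card B. Defs.scale H (c i x) (b i)) = x" for x
    proof -
      have "(\<Sum>i<card B. Defs.scale H (c i x) (b i)) = (\<Sum>v\<in>B. Defs.scale H (vs.representation B x v) v)"
        using sum.reindex_bij_betw[OF b, of "\<lambda>v. Defs.scale H (vs.representation B x v) v"]
        by (simp only: c_def lessThan_atLeast0)
      also have "\<dots> = x" by (rule vs.sum_representation_eq[OF B(2) span fin subset_refl])
      finally show ?thesis .
    qed
    show "c i (b j) = (if i = j then 1 else 0)" if "i < card B" "j < card B" for i j
    proof -
      have "b j \<in> B" "b i = b j \<longleftrightarrow> i = j"
        using bij_betw_apply[OF b, of j] inj_on_eq_iff[OF bij_betw_imp_inj_on[OF b], of i j] that by simp_all
      then show ?thesis by (auto simp: c_def vs.representation_basis[OF B(2)])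
    qed
  qed
qed

text \<open>Left multiplication is written in a basis. The module is free on \<open>1\<close>, which
  supplies a homomorphism sending the coordinates of \<open>1\<close> to any prescribed
  vector.\<close>

lemma regular_module:
  obtains R coord where "regular_coordinates H R coord"
proof -
  from coordinates obtain d :: nat and b c where *: "(\<forall>i. linear_form H (c i)) \<and>
    (\<forall>x. (\<Sum>i<d. Defs.scale H (c i x) (b i)) = x) \<and> (\<forall>i<d. \<forall>j<d. c i (b j) = (if i = j then 1 else 0))"
    by (elim exE)
  have c: "linear_form H (c i)" for i
    using * by blast
  have cb: "(\<Sum>i<d. Defs.scale H (c i x) (b i)) = x" for x
    using * by blast
  have c_delta: "c i (b j) = (if i = j then 1 else 0)" if "i < d" "j < d" for i j
    using * that by blast
  \<comment> \<open>This turns each matrix product with a coordinate vector into one evaluation of a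
    linear form.\<close>
  have expand: "(\<Sum>j<d. f (b j) * c j y) = f y" if f: "linear_form H f" for f y
    using linear_form_sum[OF f, of "\<lambda>i. Defs.scale H (c i y) (b i)" "{..<d}"] cb[of y]
    by (simp add: linear_form_scale[OF f] mult.commute)
  have lin: "linear_form H (\<lambda>y. c i (x * y))" for i x
    using c[of i] by (simp add: linear_simps)
  define coord where "coord x = mat d 1 (\<lambda>(i, _). c i x)" for x
  define R where "R = (d, \<lambda>x. mat d d (\<lambda>(i, j). c i (x * b j)))"
  have fst_R: "fst R = d" by (simp add: R_def)
  have coord: "coord x \<in> carrier_mat d 1" for x by (simp add: coord_def)
  have Rc: "snd R x \<in> carrier_mat d d" for x by (simp add: R_def)
  have R_entry: "snd R x $$ (i, j) = c i (x * b j)" if "i < d" "j < d" for x i j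
    using that by (simp add: R_def)
  have coord_entry: "coord x $$ (i, 0) = c i x" if "i < d" for x i
    using that by (simp add: coord_def)
  have R: "R \<in> lmod H"
  proof (rule lmodI)
    show "snd R (x * y) = snd R x * snd R y" for x y
    proof (rule eq_matI)
      fix i j assume "i < dim_row (snd R x * snd R y)" "j < dim_col (snd R x * snd R y)"
      then have b: "i < d" "j < d" using Rc[of x] Rc[of y] by auto
      show "snd R (x * y) $$ (i, j) = (snd R x * snd R y) $$ (i, j)"
        unfolding index_mult_mat_sum[OF Rc Rc b] using b by (simp add: R_entry expand[OF lin] mult.assoc)
    qed (simp_all add: R_def)
    show "snd R 1 = 1\<^sub>m (fst R)"
      by (rule eq_matI) (simp_all add: R_def c_delta)
  qed (simp_all add: R_def distrib_right scale_mult_left linear_form_add[OF c] linear_form_scale[OF c] mat_eq_iff)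
  have act: "snd R x * coord y = coord (x * y)" for x y
  proof (rule eq_matI)
    fix i j assume "i < dim_row (coord (x * y))" "j < dim_col (coord (x * y))"
    then have b: "i < d" "j < 1" using coord[of "x * y"] by auto
    show "(snd R x * coord y) $$ (i, j) = coord (x * y) $$ (i, j)"
      unfolding index_mult_mat_sum[OF Rc coord b] using b by (simp add: R_entry coord_entry expand[OF lin])
  qed (simp_all add: R_def coord_def)
  have "inj coord"
  proof (rule injI)
    fix x y assume "coord x = coord y"
    then have "c i x = c i y" if "i < d" for i
      using that \<open>coord x = coord y\<close> by (metis coord_entry)
    then have "(\<Sum>i<d. Defs.scale H (c i x) (b i)) = (\<Sum>i<d. Defs.scale H (c i y) (b i))" by simp
    then show "x = y" unfolding cb .
  qed
  moreover have in_range: "v \<in> range coord" if v: "v \<in> carrier_mat d 1" for v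
  proof
    define x where "x = (\<Sum>j<d. Defs.scale H (v $$ (j, 0)) (b j))"
    have "c i x = v $$ (i, 0)" if "i < d" for i
      using that by (simp add: x_def linear_form_sum[OF c] linear_form_scale[OF c] c_delta if_distrib[of "\<lambda>x. _ * x"] cong: if_cong)
    then show "v = coord x" using v by (auto simp: coord_def intro!: eq_matI)
  qed simp
  moreover have "\<exists>T\<in>lmod_hom R V. \<forall>x. T * coord x = snd V x * w" if V: "V \<in> lmod H" and w: "w \<in> carrier_mat (fst V) 1" for V w
  proof -
    \<comment> \<open>The map \<open>x \<mapsto> x w\<close>, given by the images of the basis
      elements.\<close>
    define T where "T = mat (fst V) d (\<lambda>(i, j). (snd V (b j) * w) $$ (i, 0))"
    have T: "T \<in> carrier_mat (fst V) d" by (simp add: T_def)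
    note Vc = lmod_carrier[OF V]
    have zero_less: "0 < (1::nat)" by simp
    have lV: "linear_form H (\<lambda>x. (snd V x * w) $$ (i, 0))" if "i < fst V" for i
      unfolding index_mult_mat_sum[OF Vc w that zero_less] using that
      by (auto simp: linear_form_def lmod_entries[OF V] distrib_right sum.distrib sum_distrib_left mult.assoc)
    have T_entry: "T $$ (i, j) = (snd V (b j) * w) $$ (i, 0)" if "i < fst V" "j < d" for i j
      using that by (simp add: T_def del: index_mult_mat)
    have "T * coord x = snd V x * w" for x
    proof (rule eq_matI)
      fix i j assume "i < dim_row (snd V x * w)" "j < dim_col (snd V x * w)"
      then have b: "i < fst V" "j < 1" using Vc[of x] w by auto
      show "(T * coord x) $$ (i, j) = (snd V x * w) $$ (i, j)"
        unfolding index_mult_mat_sum[OF T coord b] using b by (simp add: T_entry coord_entry expand[OF lV] del: index_mult_mat)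
    qed (use T coord[of x] Vc[of x] w in auto)
    moreover have "T * snd R x = snd V x * T" for x
    proof (rule eq_matI)
      fix i j assume "i < dim_row (snd V x * T)" "j < dim_col (snd V x * T)"
      then have b: "i < fst V" "j < d" using T Vc[of x] by auto
      have "(T * snd R x) $$ (i, j) = (snd V (x * b j) * w) $$ (i, 0)"
        unfolding index_mult_mat_sum[OF T Rc b] using b by (simp add: T_entry R_entry expand[OF lV] del: index_mult_mat)
      also have "\<dots> = (snd V x * (snd V (b j) * w)) $$ (i, 0)"
        by (simp add: lmodD[OF V] assoc_mult_mat[OF Vc Vc w])
      also have "\<dots> = (snd V x * T) $$ (i, j)"
        using b by (simp add: index_mult_mat_sum[OF Vc T] index_mult_mat_sum[OF Vc mult_carrier_mat[OF Vc w]] T_entry del: index_mult_mat)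
      finally show "(T * snd R x) $$ (i, j) = (snd V x * T) $$ (i, j)" .
    qed (use T Rc[of x] Vc[of x] in auto)
    ultimately show ?thesis using T by (intro bexI[of _ T] allI lmod_homI) (simp_all only: fst_R)
  qed
  ultimately have "regular_coordinates H R coord"
    using R coord act in_range unfolding regular_coordinates_def fst_R by blast
  then show thesis by (rule that)
qed

end

lemma lmod_iso_cancel_left:
  assumes T: "T \<in> lmod_iso V W" and A: "A \<in> carrier_mat (fst V) n" and B: "B \<in> carrier_mat (fst V) n" and eq: "T * A = T * B"
  shows "A = B"
proof -
  obtain T' where T': "T \<in> lmod_hom V W" "T' \<in> lmod_hom W V" "T' * T = 1\<^sub>m (fst V)" using lmod_isoE[OF T] .
  note c = lmod_hom_carrier[OF T'(1)] lmod_hom_carrier[OF T'(2)]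
  have "T' * (T * X) = X" if "X \<in> carrier_mat (fst V) n" for X
    using that unfolding assoc_mult_mat[OF c(2,1) that, symmetric] T'(3) by (rule left_mult_one_mat)
  from this[OF A] this[OF B] eq show ?thesis by metis
qed

lemma lmod_iso_cancel_right:
  assumes T: "T \<in> lmod_iso V W" and A: "A \<in> carrier_mat n (fst W)" and B: "B \<in> carrier_mat n (fst W)" and eq: "A * T = B * T"
  shows "A = B"
proof -
  obtain T' where T': "T \<in> lmod_hom V W" "T' \<in> lmod_hom W V" "T' * T = 1\<^sub>m (fst V)" "T * T' = 1\<^sub>m (fst W)"
    using lmod_isoE[OF T] .
  note c = lmod_hom_carrier[OF T'(1)] lmod_hom_carrier[OF T'(2)]
  have "X * T * T' = X" if "X \<in> carrier_mat n (fst W)" for X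
    using that unfolding assoc_mult_mat[OF that c] T'(4) by (rule right_mult_one_mat)
  from this[OF A] this[OF B] eq show ?thesis by metis
qed

section \<open>Tensor functors\<close>

lemma one_kronecker_mult:
  fixes A B :: "'k::comm_semiring_1 mat"
  assumes "A \<in> carrier_mat m n" "B \<in> carrier_mat n p"
  shows "1\<^sub>m d \<otimes>\<^sub>K (A * B) = (1\<^sub>m d \<otimes>\<^sub>K A) * (1\<^sub>m d \<otimes>\<^sub>K B)"
  unfolding kronecker_mult[OF one_carrier_mat one_carrier_mat assms] right_mult_one_mat[OF one_carrier_mat] ..

lemma kronecker_one_mult:
  fixes A B :: "'k::comm_semiring_1 mat"
  assumes "A \<in> carrier_mat m n" "B \<in> carrier_mat n p"
  shows "(A * B) \<otimes>\<^sub>K 1\<^sub>m d = (A \<otimes>\<^sub>K 1\<^sub>m d) * (B \<otimes>\<^sub>K 1\<^sub>m d)"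
  unfolding kronecker_mult[OF assms one_carrier_mat one_carrier_mat] right_mult_one_mat[OF one_carrier_mat] ..

context linear_functor
begin

lemma hom_carrier:
  "V \<in> lmod H \<Longrightarrow> W \<in> lmod H \<Longrightarrow> T \<in> lmod_hom V W \<Longrightarrow>
    on_hom F V W T \<in> carrier_mat (fst (on_ob F W)) (fst (on_ob F V))"
  by (rule lmod_hom_carrier[OF hom])

text \<open>The zero map is zero times itself, so homogeneity of the functor suffices.\<close>

lemma hom_zero:
  assumes "V \<in> lmod H" "W \<in> lmod H"
  shows "on_hom F V W (0\<^sub>m (fst W) (fst V)) = 0\<^sub>m (fst (on_ob F W)) (fst (on_ob F V))"
proof -
  have zero: "0 \<cdot>\<^sub>m T = 0\<^sub>m m n" if "T \<in> carrier_mat m n" for m n and T :: "'k mat"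
    using that by (auto intro!: eq_matI)
  show ?thesis
    using scale[OF assms lmod_hom_zero[OF assms], of 0]
    unfolding zero[OF zero_carrier_mat] zero[OF hom_carrier[OF assms lmod_hom_zero[OF assms]]] .
qed

end

locale hopf_tensor_functor = tensor_functor H H' F J \<phi> + A: hopf_algebra H + A': hopf_algebra H'
  for H :: "('k::field, 'a::ring_1) hopf" and H' :: "('k, 'b::ring_1) hopf" and F J \<phi>
begin

abbreviation "Fdim V \<equiv> fst (on_ob F V)"

lemma J_carrier: "V \<in> lmod H \<Longrightarrow> W \<in> lmod H \<Longrightarrow> J V W \<in> carrier_mat (Fdim (tensor_rep H V W)) (Fdim V * Fdim W)"
  using J_iso[of V W] lmod_hom_carrier unfolding lmod_iso_def by fastforce

lemma \<phi>_carrier: "\<phi> \<in> carrier_mat (Fdim (unit_rep H)) 1"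
  using \<phi>_iso lmod_hom_carrier unfolding lmod_iso_def by fastforce

text \<open>The matrix \<open>K\<close> allows for a change of coordinates of \<open>F(W)\<close>.\<close>

lemma planar:
  assumes V: "V \<in> lmod H" and W: "W \<in> lmod H"
    and p: "p \<in> lmod_hom (unit_rep H) (tensor_rep H V W)" and q: "q \<in> lmod_hom (tensor_rep H W V) (unit_rep H)"
    and K: "K \<in> carrier_mat (Fdim W) N"
    and p': "p' \<in> carrier_mat (Fdim V * N) 1" and q': "q' \<in> carrier_mat 1 (N * Fdim V)"
    and Jp: "J V W * ((1\<^sub>m (Fdim V) \<otimes>\<^sub>K K) * p') = on_hom F (unit_rep H) (tensor_rep H V W) p * \<phi>"
    and Jq: "\<phi> * q' = on_hom F (tensor_rep H W V) (unit_rep H) q * (J W V * (K \<otimes>\<^sub>K 1\<^sub>m (Fdim V)))"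
  shows "(1\<^sub>m (fst V) \<otimes>\<^sub>K q) * (p \<otimes>\<^sub>K 1\<^sub>m (fst V)) \<in> lmod_hom V V"
    and "on_hom F V V ((1\<^sub>m (fst V) \<otimes>\<^sub>K q) * (p \<otimes>\<^sub>K 1\<^sub>m (fst V))) = (1\<^sub>m (Fdim V) \<otimes>\<^sub>K q') * (p' \<otimes>\<^sub>K 1\<^sub>m (Fdim V))"
proof -
  define v w x where "v = Fdim V" and "w = Fdim W" and "x = Fdim (tensor_rep H V (tensor_rep H W V))"
  note U = A.unit_rep_lmod
  note VW = A.tensor_rep_lmod[OF V W] and WV = A.tensor_rep_lmod[OF W V]
  note VWV = A.tensor_rep_lmod[OF V WV]
  have assoc: "tensor_rep H (tensor_rep H V W) V = tensor_rep H V (tensor_rep H W V)"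
    by (rule tensor_rep_assoc[OF A.hopf_algebra_axioms V W V])
  have UV: "tensor_rep H (unit_rep H) V = V" and VU: "tensor_rep H V (unit_rep H) = V"
    by (rule tensor_rep_unit_left[OF A.hopf_algebra_axioms V] tensor_rep_unit_right[OF A.hopf_algebra_axioms V])+
  note idV = lmod_hom_one[OF V]
  have p1: "p \<otimes>\<^sub>K 1\<^sub>m (fst V) \<in> lmod_hom V (tensor_rep H V (tensor_rep H W V))"
    using lmod_hom_kronecker[OF U V VW V p idV] unfolding UV assoc .
  have q1: "1\<^sub>m (fst V) \<otimes>\<^sub>K q \<in> lmod_hom (tensor_rep H V (tensor_rep H W V)) V"
    using lmod_hom_kronecker[OF V WV V U idV q] unfolding VU .
  show "(1\<^sub>m (fst V) \<otimes>\<^sub>K q) * (p \<otimes>\<^sub>K 1\<^sub>m (fst V)) \<in> lmod_hom V V"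
    by (rule lmod_hom_mult[OF V VWV V p1 q1])
  define P Q where "P = on_hom F V (tensor_rep H V (tensor_rep H W V)) (p \<otimes>\<^sub>K 1\<^sub>m (fst V))"
    and "Q = on_hom F (tensor_rep H V (tensor_rep H W V)) V (1\<^sub>m (fst V) \<otimes>\<^sub>K q)"
  define a b where "a = J (tensor_rep H V W) V" and "b = J V (tensor_rep H W V)"
  define Fp Fq where "Fp = on_hom F (unit_rep H) (tensor_rep H V W) p"
    and "Fq = on_hom F (tensor_rep H W V) (unit_rep H) q"
  define X where "X = J W V * (K \<otimes>\<^sub>K 1\<^sub>m v)"
  have P: "P \<in> carrier_mat x v" and Q: "Q \<in> carrier_mat v x"
    unfolding P_def Q_def v_def x_def by (rule hom_carrier[OF V VWV p1] hom_carrier[OF VWV V q1])+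
  have a: "a \<in> carrier_mat x (Fdim (tensor_rep H V W) * v)" and b: "b \<in> carrier_mat x (v * Fdim (tensor_rep H W V))"
    using J_carrier[OF VW V] J_carrier[OF V WV] unfolding a_def b_def v_def x_def assoc .
  have Fp: "Fp \<in> carrier_mat (Fdim (tensor_rep H V W)) (Fdim (unit_rep H))"
    and Fq: "Fq \<in> carrier_mat (Fdim (unit_rep H)) (Fdim (tensor_rep H W V))"
    unfolding Fp_def Fq_def by (rule hom_carrier[OF U VW p] hom_carrier[OF WV U q])+
  note JVW = J_carrier[OF V W, folded v_def w_def] and JWV = J_carrier[OF W V, folded v_def w_def]
  note JUV = J_carrier[OF U V, folded v_def, unfolded UV, folded v_def]
    and JVU = J_carrier[OF V U, folded v_def, unfolded VU, folded v_def]
  note K = K[folded w_def] and p' = p'[folded v_def] and q' = q'[folded v_def]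
  note K1 = kronecker_carrier[OF K one_carrier_mat[of v]] and K2 = kronecker_carrier[OF one_carrier_mat[of v] K]
  have X: "X \<in> carrier_mat (Fdim (tensor_rep H W V)) (N * v)"
    unfolding X_def by (rule mult_carrier_mat[OF JWV K1])
  have \<phi>1: "\<phi> \<otimes>\<^sub>K 1\<^sub>m v \<in> carrier_mat (Fdim (unit_rep H) * v) v" and \<phi>2: "1\<^sub>m v \<otimes>\<^sub>K \<phi> \<in> carrier_mat (v * Fdim (unit_rep H)) v"
    using kronecker_carrier[OF \<phi>_carrier one_carrier_mat[of v]] kronecker_carrier[OF one_carrier_mat[of v] \<phi>_carrier]
    by simp_all
  \<comment> \<open>Naturality moves \<open>F\<close> inside the tensor product, and the left unit
    axiom absorbs \<open>J\<close> on the unit object.\<close>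
  have P_eq: "P = a * ((J V W * ((1\<^sub>m v \<otimes>\<^sub>K K) * p')) \<otimes>\<^sub>K 1\<^sub>m v)"
  proof -
    have nat: "a * (Fp \<otimes>\<^sub>K 1\<^sub>m v) = P * J (unit_rep H) V"
      using J_natural[OF U V VW V p idV] unfolding id[OF V] UV assoc a_def Fp_def v_def P_def .
    have unit: "J (unit_rep H) V * (\<phi> \<otimes>\<^sub>K 1\<^sub>m v) = 1\<^sub>m v"
      using J_unit_left[OF V] unfolding v_def .
    have "P = P * (J (unit_rep H) V * (\<phi> \<otimes>\<^sub>K 1\<^sub>m v))"
      unfolding unit by (rule right_mult_one_mat[OF P, symmetric])
    also have "\<dots> = a * (Fp \<otimes>\<^sub>K 1\<^sub>m v) * (\<phi> \<otimes>\<^sub>K 1\<^sub>m v)"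
      unfolding nat by (rule assoc_mult_mat[OF P JUV \<phi>1, symmetric])
    also have "\<dots> = a * ((Fp * \<phi>) \<otimes>\<^sub>K 1\<^sub>m v)"
      unfolding kronecker_one_mult[OF Fp \<phi>_carrier]
      by (rule assoc_mult_mat[OF a kronecker_carrier[OF Fp one_carrier_mat] \<phi>1])
    also have "Fp * \<phi> = J V W * ((1\<^sub>m v \<otimes>\<^sub>K K) * p')"
      unfolding Fp_def v_def by (rule Jp[symmetric])
    finally show ?thesis .
  qed
  \<comment> \<open>The dual computation for \<open>q\<close>, with the right unit axiom. Here
    \<open>b\<close> belongs to the other bracketing of the three factors than \<open>a\<close> in
    \<open>P_eq\<close>.\<close>
  have Q_eq: "Q * b * (1\<^sub>m v \<otimes>\<^sub>K X) = 1\<^sub>m v \<otimes>\<^sub>K q'"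
  proof -
    have nat: "J V (unit_rep H) * (1\<^sub>m v \<otimes>\<^sub>K Fq) = Q * b"
      using J_natural[OF V WV V U idV q] unfolding id[OF V] VU b_def Fq_def v_def Q_def .
    have unit: "J V (unit_rep H) * (1\<^sub>m v \<otimes>\<^sub>K \<phi>) = 1\<^sub>m v"
      using J_unit_right[OF V] unfolding v_def .
    have q1': "1\<^sub>m v \<otimes>\<^sub>K q' \<in> carrier_mat v (v * (N * v))"
      using kronecker_carrier[OF one_carrier_mat[of v] q'] by simp
    have "Q * b * (1\<^sub>m v \<otimes>\<^sub>K X) = J V (unit_rep H) * (1\<^sub>m v \<otimes>\<^sub>K (Fq * X))"
      unfolding nat[symmetric] one_kronecker_mult[OF Fq X]
      by (rule assoc_mult_mat[OF JVU kronecker_carrier[OF one_carrier_mat Fq] kronecker_carrier[OF one_carrier_mat X]])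
    also have "Fq * X = \<phi> * q'"
      unfolding Fq_def X_def v_def by (rule Jq[symmetric])
    also have "J V (unit_rep H) * (1\<^sub>m v \<otimes>\<^sub>K (\<phi> * q')) = J V (unit_rep H) * (1\<^sub>m v \<otimes>\<^sub>K \<phi>) * (1\<^sub>m v \<otimes>\<^sub>K q')"
      unfolding one_kronecker_mult[OF \<phi>_carrier q'] by (rule assoc_mult_mat[OF JVU \<phi>2 q1', symmetric])
    also have "\<dots> = 1\<^sub>m v \<otimes>\<^sub>K q'" unfolding unit by (rule left_mult_one_mat[OF q1'])
    finally show ?thesis .
  qed
  have p1': "p' \<otimes>\<^sub>K 1\<^sub>m v \<in> carrier_mat (v * (N * v)) v"
    using kronecker_carrier[OF p' one_carrier_mat[of v]] by (simp add: mult.assoc)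
  have vX: "1\<^sub>m v \<otimes>\<^sub>K X \<in> carrier_mat (v * Fdim (tensor_rep H W V)) (v * (N * v))"
    by (rule kronecker_carrier[OF one_carrier_mat X])
  have vJ: "1\<^sub>m v \<otimes>\<^sub>K J W V \<in> carrier_mat (v * Fdim (tensor_rep H W V)) (v * (w * v))"
    by (rule kronecker_carrier[OF one_carrier_mat JWV])
  have Jv: "J V W \<otimes>\<^sub>K 1\<^sub>m v \<in> carrier_mat (Fdim (tensor_rep H V W) * v) (v * (w * v))"
    using kronecker_carrier[OF JVW one_carrier_mat[of v]] by (simp add: mult.assoc)
  have vK: "1\<^sub>m v \<otimes>\<^sub>K (K \<otimes>\<^sub>K 1\<^sub>m v) \<in> carrier_mat (v * (w * v)) (v * (N * v))"
    by (rule kronecker_carrier[OF one_carrier_mat K1])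
  \<comment> \<open>The associativity axiom of \<open>J\<close> passes from the bracketing suited to
    \<open>p\<close> to the one suited to \<open>q\<close>, so that \<open>Q\<close> and
    \<open>P\<close> can be composed through \<open>b\<close>.\<close>
  have P_eq': "P = b * ((1\<^sub>m v \<otimes>\<^sub>K X) * (p' \<otimes>\<^sub>K 1\<^sub>m v))"
  proof -
    have coh: "a * (J V W \<otimes>\<^sub>K 1\<^sub>m v) = b * (1\<^sub>m v \<otimes>\<^sub>K J W V)"
      using J_assoc[OF V W V] unfolding a_def b_def v_def .
    have "P = a * ((J V W \<otimes>\<^sub>K 1\<^sub>m v) * ((1\<^sub>m v \<otimes>\<^sub>K (K \<otimes>\<^sub>K 1\<^sub>m v)) * (p' \<otimes>\<^sub>K 1\<^sub>m v)))"
      unfolding P_eq kronecker_one_mult[OF JVW mult_carrier_mat[OF K2 p']] kronecker_one_mult[OF K2 p'] kronecker_assoc ..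
    also have "\<dots> = a * (J V W \<otimes>\<^sub>K 1\<^sub>m v) * ((1\<^sub>m v \<otimes>\<^sub>K (K \<otimes>\<^sub>K 1\<^sub>m v)) * (p' \<otimes>\<^sub>K 1\<^sub>m v))"
      by (rule assoc_mult_mat[OF a Jv mult_carrier_mat[OF vK p1'], symmetric])
    also have "\<dots> = b * ((1\<^sub>m v \<otimes>\<^sub>K J W V) * ((1\<^sub>m v \<otimes>\<^sub>K (K \<otimes>\<^sub>K 1\<^sub>m v)) * (p' \<otimes>\<^sub>K 1\<^sub>m v)))"
      unfolding coh by (rule assoc_mult_mat[OF b vJ mult_carrier_mat[OF vK p1']])
    also have "(1\<^sub>m v \<otimes>\<^sub>K J W V) * ((1\<^sub>m v \<otimes>\<^sub>K (K \<otimes>\<^sub>K 1\<^sub>m v)) * (p' \<otimes>\<^sub>K 1\<^sub>m v)) = (1\<^sub>m v \<otimes>\<^sub>K X) * (p' \<otimes>\<^sub>K 1\<^sub>m v)"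
      unfolding X_def one_kronecker_mult[OF JWV K1] by (rule assoc_mult_mat[OF vJ vK p1', symmetric])
    finally show ?thesis .
  qed
  have "on_hom F V V ((1\<^sub>m (fst V) \<otimes>\<^sub>K q) * (p \<otimes>\<^sub>K 1\<^sub>m (fst V))) = Q * P"
    unfolding P_def Q_def by (rule comp[OF V VWV V p1 q1])
  also have "\<dots> = Q * b * ((1\<^sub>m v \<otimes>\<^sub>K X) * (p' \<otimes>\<^sub>K 1\<^sub>m v))"
    unfolding P_eq' by (rule assoc_mult_mat[OF Q b mult_carrier_mat[OF vX p1'], symmetric])
  also have "\<dots> = Q * b * (1\<^sub>m v \<otimes>\<^sub>K X) * (p' \<otimes>\<^sub>K 1\<^sub>m v)"
    by (rule assoc_mult_mat[OF mult_carrier_mat[OF Q b] vX p1', symmetric])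
  also have "\<dots> = (1\<^sub>m v \<otimes>\<^sub>K q') * (p' \<otimes>\<^sub>K 1\<^sub>m v)"
    by (simp only: Q_eq)
  finally show "on_hom F V V ((1\<^sub>m (fst V) \<otimes>\<^sub>K q) * (p \<otimes>\<^sub>K 1\<^sub>m (fst V))) = (1\<^sub>m (Fdim V) \<otimes>\<^sub>K q') * (p' \<otimes>\<^sub>K 1\<^sub>m (Fdim V))"
    unfolding v_def .
qed

text \<open>Mirror image of \<open>planar\<close>: the two unit axioms exchange roles and the
  associativity axiom is used in the opposite direction.\<close>

lemma planar':
  assumes V: "V \<in> lmod H" and W: "W \<in> lmod H"
    and p: "p \<in> lmod_hom (unit_rep H) (tensor_rep H W V)" and q: "q \<in> lmod_hom (tensor_rep H V W) (unit_rep H)"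
    and K: "K \<in> carrier_mat (Fdim W) N"
    and p': "p' \<in> carrier_mat (N * Fdim V) 1" and q': "q' \<in> carrier_mat 1 (Fdim V * N)"
    and Jp: "J W V * ((K \<otimes>\<^sub>K 1\<^sub>m (Fdim V)) * p') = on_hom F (unit_rep H) (tensor_rep H W V) p * \<phi>"
    and Jq: "\<phi> * q' = on_hom F (tensor_rep H V W) (unit_rep H) q * (J V W * (1\<^sub>m (Fdim V) \<otimes>\<^sub>K K))"
  shows "(q \<otimes>\<^sub>K 1\<^sub>m (fst V)) * (1\<^sub>m (fst V) \<otimes>\<^sub>K p) \<in> lmod_hom V V"
    and "on_hom F V V ((q \<otimes>\<^sub>K 1\<^sub>m (fst V)) * (1\<^sub>m (fst V) \<otimes>\<^sub>K p)) = (q' \<otimes>\<^sub>K 1\<^sub>m (Fdim V)) * (1\<^sub>m (Fdim V) \<otimes>\<^sub>K p')"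
proof -
  define v w x where "v = Fdim V" and "w = Fdim W" and "x = Fdim (tensor_rep H V (tensor_rep H W V))"
  note U = A.unit_rep_lmod
  note VW = A.tensor_rep_lmod[OF V W] and WV = A.tensor_rep_lmod[OF W V]
  note VWV = A.tensor_rep_lmod[OF V WV]
  have assoc: "tensor_rep H (tensor_rep H V W) V = tensor_rep H V (tensor_rep H W V)"
    by (rule tensor_rep_assoc[OF A.hopf_algebra_axioms V W V])
  have UV: "tensor_rep H (unit_rep H) V = V" and VU: "tensor_rep H V (unit_rep H) = V"
    by (rule tensor_rep_unit_left[OF A.hopf_algebra_axioms V] tensor_rep_unit_right[OF A.hopf_algebra_axioms V])+
  note idV = lmod_hom_one[OF V]
  have p1: "1\<^sub>m (fst V) \<otimes>\<^sub>K p \<in> lmod_hom V (tensor_rep H V (tensor_rep H W V))"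
    using lmod_hom_kronecker[OF V U V WV idV p] unfolding VU .
  have q1: "q \<otimes>\<^sub>K 1\<^sub>m (fst V) \<in> lmod_hom (tensor_rep H V (tensor_rep H W V)) V"
    using lmod_hom_kronecker[OF VW V U V q idV] unfolding UV assoc .
  show "(q \<otimes>\<^sub>K 1\<^sub>m (fst V)) * (1\<^sub>m (fst V) \<otimes>\<^sub>K p) \<in> lmod_hom V V"
    by (rule lmod_hom_mult[OF V VWV V p1 q1])
  define P Q where "P = on_hom F V (tensor_rep H V (tensor_rep H W V)) (1\<^sub>m (fst V) \<otimes>\<^sub>K p)"
    and "Q = on_hom F (tensor_rep H V (tensor_rep H W V)) V (q \<otimes>\<^sub>K 1\<^sub>m (fst V))"
  define a b where "a = J (tensor_rep H V W) V" and "b = J V (tensor_rep H W V)"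
  define Fp Fq where "Fp = on_hom F (unit_rep H) (tensor_rep H W V) p"
    and "Fq = on_hom F (tensor_rep H V W) (unit_rep H) q"
  define X where "X = J V W * (1\<^sub>m v \<otimes>\<^sub>K K)"
  have P: "P \<in> carrier_mat x v" and Q: "Q \<in> carrier_mat v x"
    unfolding P_def Q_def v_def x_def by (rule hom_carrier[OF V VWV p1] hom_carrier[OF VWV V q1])+
  have a: "a \<in> carrier_mat x (Fdim (tensor_rep H V W) * v)" and b: "b \<in> carrier_mat x (v * Fdim (tensor_rep H W V))"
    using J_carrier[OF VW V] J_carrier[OF V WV] unfolding a_def b_def v_def x_def assoc .
  have Fp: "Fp \<in> carrier_mat (Fdim (tensor_rep H W V)) (Fdim (unit_rep H))"
    and Fq: "Fq \<in> carrier_mat (Fdim (unit_rep H)) (Fdim (tensor_rep H V W))"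
    unfolding Fp_def Fq_def by (rule hom_carrier[OF U WV p] hom_carrier[OF VW U q])+
  note JVW = J_carrier[OF V W, folded v_def w_def] and JWV = J_carrier[OF W V, folded v_def w_def]
  note JUV = J_carrier[OF U V, folded v_def, unfolded UV, folded v_def]
    and JVU = J_carrier[OF V U, folded v_def, unfolded VU, folded v_def]
  note K = K[folded w_def] and p' = p'[folded v_def] and q' = q'[folded v_def]
  note K1 = kronecker_carrier[OF K one_carrier_mat[of v]] and K2 = kronecker_carrier[OF one_carrier_mat[of v] K]
  have X: "X \<in> carrier_mat (Fdim (tensor_rep H V W)) (v * N)"
    unfolding X_def by (rule mult_carrier_mat[OF JVW K2])
  have \<phi>1: "\<phi> \<otimes>\<^sub>K 1\<^sub>m v \<in> carrier_mat (Fdim (unit_rep H) * v) v" and \<phi>2: "1\<^sub>m v \<otimes>\<^sub>K \<phi> \<in> carrier_mat (v * Fdim (unit_rep H)) v"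
    using kronecker_carrier[OF \<phi>_carrier one_carrier_mat[of v]] kronecker_carrier[OF one_carrier_mat[of v] \<phi>_carrier]
    by simp_all
  have P_eq: "P = b * (1\<^sub>m v \<otimes>\<^sub>K (J W V * ((K \<otimes>\<^sub>K 1\<^sub>m v) * p')))"
  proof -
    have nat: "b * (1\<^sub>m v \<otimes>\<^sub>K Fp) = P * J V (unit_rep H)"
      using J_natural[OF V U V WV idV p] unfolding id[OF V] VU b_def Fp_def v_def P_def .
    have unit: "J V (unit_rep H) * (1\<^sub>m v \<otimes>\<^sub>K \<phi>) = 1\<^sub>m v"
      using J_unit_right[OF V] unfolding v_def .
    have "P = P * (J V (unit_rep H) * (1\<^sub>m v \<otimes>\<^sub>K \<phi>))"
      unfolding unit by (rule right_mult_one_mat[OF P, symmetric])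
    also have "\<dots> = b * (1\<^sub>m v \<otimes>\<^sub>K Fp) * (1\<^sub>m v \<otimes>\<^sub>K \<phi>)"
      unfolding nat by (rule assoc_mult_mat[OF P JVU \<phi>2, symmetric])
    also have "\<dots> = b * (1\<^sub>m v \<otimes>\<^sub>K (Fp * \<phi>))"
      unfolding one_kronecker_mult[OF Fp \<phi>_carrier]
      by (rule assoc_mult_mat[OF b kronecker_carrier[OF one_carrier_mat Fp] \<phi>2])
    also have "Fp * \<phi> = J W V * ((K \<otimes>\<^sub>K 1\<^sub>m v) * p')"
      unfolding Fp_def v_def by (rule Jp[symmetric])
    finally show ?thesis .
  qed
  have Q_eq: "Q * a * (X \<otimes>\<^sub>K 1\<^sub>m v) = q' \<otimes>\<^sub>K 1\<^sub>m v"
  proof -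
    have nat: "J (unit_rep H) V * (Fq \<otimes>\<^sub>K 1\<^sub>m v) = Q * a"
      using J_natural[OF VW V U V q idV] unfolding id[OF V] UV assoc a_def Fq_def v_def Q_def .
    have unit: "J (unit_rep H) V * (\<phi> \<otimes>\<^sub>K 1\<^sub>m v) = 1\<^sub>m v"
      using J_unit_left[OF V] unfolding v_def .
    have q1': "q' \<otimes>\<^sub>K 1\<^sub>m v \<in> carrier_mat v (v * N * v)"
      using kronecker_carrier[OF q' one_carrier_mat[of v]] by simp
    have "Q * a * (X \<otimes>\<^sub>K 1\<^sub>m v) = J (unit_rep H) V * ((Fq * X) \<otimes>\<^sub>K 1\<^sub>m v)"
      unfolding nat[symmetric] kronecker_one_mult[OF Fq X]
      by (rule assoc_mult_mat[OF JUV kronecker_carrier[OF Fq one_carrier_mat] kronecker_carrier[OF X one_carrier_mat]])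
    also have "Fq * X = \<phi> * q'"
      unfolding Fq_def X_def v_def by (rule Jq[symmetric])
    also have "J (unit_rep H) V * ((\<phi> * q') \<otimes>\<^sub>K 1\<^sub>m v) = J (unit_rep H) V * (\<phi> \<otimes>\<^sub>K 1\<^sub>m v) * (q' \<otimes>\<^sub>K 1\<^sub>m v)"
      unfolding kronecker_one_mult[OF \<phi>_carrier q'] by (rule assoc_mult_mat[OF JUV \<phi>1 q1', symmetric])
    also have "\<dots> = q' \<otimes>\<^sub>K 1\<^sub>m v" unfolding unit by (rule left_mult_one_mat[OF q1'])
    finally show ?thesis .
  qed
  have p1': "1\<^sub>m v \<otimes>\<^sub>K p' \<in> carrier_mat (v * N * v) v"
    using kronecker_carrier[OF one_carrier_mat[of v] p'] by (simp add: mult.assoc)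
  have Xv: "X \<otimes>\<^sub>K 1\<^sub>m v \<in> carrier_mat (Fdim (tensor_rep H V W) * v) (v * N * v)"
    by (rule kronecker_carrier[OF X one_carrier_mat])
  have vJ: "1\<^sub>m v \<otimes>\<^sub>K J W V \<in> carrier_mat (v * Fdim (tensor_rep H W V)) (v * w * v)"
    using kronecker_carrier[OF one_carrier_mat[of v] JWV] by (simp add: mult.assoc)
  have Jv: "J V W \<otimes>\<^sub>K 1\<^sub>m v \<in> carrier_mat (Fdim (tensor_rep H V W) * v) (v * w * v)"
    by (rule kronecker_carrier[OF JVW one_carrier_mat])
  have Kv: "(1\<^sub>m v \<otimes>\<^sub>K K) \<otimes>\<^sub>K 1\<^sub>m v \<in> carrier_mat (v * w * v) (v * N * v)"
    by (rule kronecker_carrier[OF K2 one_carrier_mat])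
  have P_eq': "P = a * ((X \<otimes>\<^sub>K 1\<^sub>m v) * (1\<^sub>m v \<otimes>\<^sub>K p'))"
  proof -
    have coh: "b * (1\<^sub>m v \<otimes>\<^sub>K J W V) = a * (J V W \<otimes>\<^sub>K 1\<^sub>m v)"
      using J_assoc[OF V W V, symmetric] unfolding a_def b_def v_def .
    have "P = b * ((1\<^sub>m v \<otimes>\<^sub>K J W V) * (((1\<^sub>m v \<otimes>\<^sub>K K) \<otimes>\<^sub>K 1\<^sub>m v) * (1\<^sub>m v \<otimes>\<^sub>K p')))"
      unfolding P_eq one_kronecker_mult[OF JWV mult_carrier_mat[OF K1 p']] one_kronecker_mult[OF K1 p'] kronecker_assoc ..
    also have "\<dots> = b * (1\<^sub>m v \<otimes>\<^sub>K J W V) * (((1\<^sub>m v \<otimes>\<^sub>K K) \<otimes>\<^sub>K 1\<^sub>m v) * (1\<^sub>m v \<otimes>\<^sub>K p'))"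
      by (rule assoc_mult_mat[OF b vJ mult_carrier_mat[OF Kv p1'], symmetric])
    also have "\<dots> = a * ((J V W \<otimes>\<^sub>K 1\<^sub>m v) * (((1\<^sub>m v \<otimes>\<^sub>K K) \<otimes>\<^sub>K 1\<^sub>m v) * (1\<^sub>m v \<otimes>\<^sub>K p')))"
      unfolding coh by (rule assoc_mult_mat[OF a Jv mult_carrier_mat[OF Kv p1']])
    also have "(J V W \<otimes>\<^sub>K 1\<^sub>m v) * (((1\<^sub>m v \<otimes>\<^sub>K K) \<otimes>\<^sub>K 1\<^sub>m v) * (1\<^sub>m v \<otimes>\<^sub>K p')) = (X \<otimes>\<^sub>K 1\<^sub>m v) * (1\<^sub>m v \<otimes>\<^sub>K p')"
      unfolding X_def kronecker_one_mult[OF JVW K2] by (rule assoc_mult_mat[OF Jv Kv p1', symmetric])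
    finally show ?thesis .
  qed
  have "on_hom F V V ((q \<otimes>\<^sub>K 1\<^sub>m (fst V)) * (1\<^sub>m (fst V) \<otimes>\<^sub>K p)) = Q * P"
    unfolding P_def Q_def by (rule comp[OF V VWV V p1 q1])
  also have "\<dots> = Q * a * ((X \<otimes>\<^sub>K 1\<^sub>m v) * (1\<^sub>m v \<otimes>\<^sub>K p'))"
    unfolding P_eq' by (rule assoc_mult_mat[OF Q a mult_carrier_mat[OF Xv p1'], symmetric])
  also have "\<dots> = Q * a * (X \<otimes>\<^sub>K 1\<^sub>m v) * (1\<^sub>m v \<otimes>\<^sub>K p')"
    by (rule assoc_mult_mat[OF mult_carrier_mat[OF Q a] Xv p1', symmetric])
  also have "\<dots> = (q' \<otimes>\<^sub>K 1\<^sub>m v) * (1\<^sub>m v \<otimes>\<^sub>K p')"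
    by (simp only: Q_eq)
  finally show "on_hom F V V ((q \<otimes>\<^sub>K 1\<^sub>m (fst V)) * (1\<^sub>m (fst V) \<otimes>\<^sub>K p)) = (q' \<otimes>\<^sub>K 1\<^sub>m (Fdim V)) * (1\<^sub>m (Fdim V) \<otimes>\<^sub>K p')"
    unfolding v_def .
qed

end

section \<open>Iterated structure isomorphisms\<close>

lemma lmod_iso_mult:
  assumes lmod: "U \<in> lmod H" "V \<in> lmod H" "W \<in> lmod H" and S: "S \<in> lmod_iso U V" and T: "T \<in> lmod_iso V W"
  shows "T * S \<in> lmod_iso U W"
proof -
  obtain S' where S': "S \<in> lmod_hom U V" "S' \<in> lmod_hom V U" "S' * S = 1\<^sub>m (fst U)" "S * S' = 1\<^sub>m (fst V)"
    using lmod_isoE[OF S] .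
  obtain T' where T': "T \<in> lmod_hom V W" "T' \<in> lmod_hom W V" "T' * T = 1\<^sub>m (fst V)" "T * T' = 1\<^sub>m (fst W)"
    using lmod_isoE[OF T] .
  note c = S'(1,2)[THEN lmod_hom_carrier] T'(1,2)[THEN lmod_hom_carrier]
  have "S' * T' * (T * S) = S' * (T' * T * S)"
    unfolding assoc_mult_mat[OF c(2,4) mult_carrier_mat[OF c(3,1)]] assoc_mult_mat[OF c(4,3,1)] ..
  moreover have "T * S * (S' * T') = T * (S * S' * T')"
    unfolding assoc_mult_mat[OF c(3,1) mult_carrier_mat[OF c(2,4)]] assoc_mult_mat[OF c(1,2,4)] ..
  ultimately have "S' * T' * (T * S) = 1\<^sub>m (fst U)" "T * S * (S' * T') = 1\<^sub>m (fst W)"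
    unfolding S'(4) T'(3) left_mult_one_mat[OF c(1)] left_mult_one_mat[OF c(4)] S'(3) T'(4) .
  then show ?thesis
    unfolding lmod_iso_def using lmod_hom_mult[OF lmod S'(1) T'(1)] lmod_hom_mult[OF lmod(3,2,1) T'(2) S'(2)] by blast
qed

lemma lmod_iso_kronecker:
  assumes lmod: "V \<in> lmod H" "W \<in> lmod H" "V' \<in> lmod H" "W' \<in> lmod H"
    and S: "S \<in> lmod_iso V V'" and T: "T \<in> lmod_iso W W'"
  shows "S \<otimes>\<^sub>K T \<in> lmod_iso (tensor_rep H V W) (tensor_rep H V' W')"
proof -
  obtain S' where S': "S \<in> lmod_hom V V'" "S' \<in> lmod_hom V' V" "S' * S = 1\<^sub>m (fst V)" "S * S' = 1\<^sub>m (fst V')"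
    using lmod_isoE[OF S] .
  obtain T' where T': "T \<in> lmod_hom W W'" "T' \<in> lmod_hom W' W" "T' * T = 1\<^sub>m (fst W)" "T * T' = 1\<^sub>m (fst W')"
    using lmod_isoE[OF T] .
  note c = S'(1,2)[THEN lmod_hom_carrier] T'(1,2)[THEN lmod_hom_carrier]
  have "(S' \<otimes>\<^sub>K T') * (S \<otimes>\<^sub>K T) = 1\<^sub>m (fst (tensor_rep H V W))" "(S \<otimes>\<^sub>K T) * (S' \<otimes>\<^sub>K T') = 1\<^sub>m (fst (tensor_rep H V' W'))"
    unfolding kronecker_mult[OF c(2,1,4,3)] kronecker_mult[OF c(1,2,3,4)] S'(3,4) T'(3,4) kronecker_one fst_tensor_rep by (rule refl)+
  then show ?thesis
    unfolding lmod_iso_def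
    using lmod_hom_kronecker[OF lmod S'(1) T'(1)] lmod_hom_kronecker[OF lmod(3,4,1,2) S'(2) T'(2)] by blast
qed

lemma lmod_iso_one: "V \<in> lmod H \<Longrightarrow> 1\<^sub>m (fst V) \<in> lmod_iso V V"
  unfolding lmod_iso_def using lmod_hom_one left_mult_one_mat[OF one_carrier_mat] by blast

context hopf_tensor_functor
begin

primrec J_power :: "('k, 'a) rep \<Rightarrow> nat \<Rightarrow> 'k mat" where
  "J_power V 0 = \<phi>"
| "J_power V (Suc n) = J V (tensor_power H V n) * (1\<^sub>m (Fdim V) \<otimes>\<^sub>K J_power V n)"

lemma J_power_iso:
  assumes V: "V \<in> lmod H"
  shows "J_power V n \<in> lmod_iso (tensor_power H' (on_ob F V) n) (on_ob F (tensor_power H V n))"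
proof (induction n)
  case 0
  show ?case using \<phi>_iso by simp
next
  case (Suc n)
  note P = A.tensor_power_lmod[OF V, of n] and P' = A'.tensor_power_lmod[OF ob[OF V], of n]
  have "1\<^sub>m (Fdim V) \<otimes>\<^sub>K J_power V n \<in> lmod_iso (tensor_rep H' (on_ob F V) (tensor_power H' (on_ob F V) n))
      (tensor_rep H' (on_ob F V) (on_ob F (tensor_power H V n)))"
    by (rule lmod_iso_kronecker[OF ob[OF V] P' ob[OF V] ob[OF P] lmod_iso_one[OF ob[OF V]] Suc])
  from lmod_iso_mult[OF A'.tensor_rep_lmod[OF ob[OF V] P'] A'.tensor_rep_lmod[OF ob[OF V] ob[OF P]]
      ob[OF A.tensor_rep_lmod[OF V P]] this J_iso[OF V P]]
  show ?case by simp
qed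

lemma J_power_carrier:
  "V \<in> lmod H \<Longrightarrow> J_power V n \<in> carrier_mat (Fdim (tensor_power H V n)) (Fdim V ^ n)"
  using J_power_iso[of V n] lmod_hom_carrier unfolding lmod_iso_def by fastforce

text \<open>Coherence: peeling off \<open>V\<close> on the right gives the same map as on the left,
  by induction with \<open>J_assoc\<close>. For \<open>n = 0\<close> both sides are identities by
  the unit axioms. Both forms are needed since \<open>p\<close> and \<open>q\<close> split
  \<open>V\<close> off on opposite sides.\<close>

lemma J_power_Suc_right:
  assumes V: "V \<in> lmod H"
  shows "J_power V (Suc n) = J (tensor_power H V n) V * (J_power V n \<otimes>\<^sub>K 1\<^sub>m (Fdim V))"
proof (induction n)
  case 0
  show ?case using J_unit_left[OF V] J_unit_right[OF V] by simp
next
  case (Suc n)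
  let ?v = "Fdim V" and ?P = "tensor_power H V n"
  note P = A.tensor_power_lmod[OF V, of n]
  note VP = A.tensor_rep_lmod[OF V P] and PV = A.tensor_rep_lmod[OF P V]
  note Jn = J_power_carrier[OF V, of n]
  have PV_VP: "tensor_rep H ?P V = tensor_rep H V ?P" using A.tensor_power_Suc_right[OF V, of n] by simp
  have assoc: "tensor_rep H (tensor_rep H V ?P) V = tensor_rep H V (tensor_rep H ?P V)"
    by (rule tensor_rep_assoc[OF A.hopf_algebra_axioms V P V])
  note c1 = J_carrier[OF V PV]
  note c2 = kronecker_carrier[OF one_carrier_mat[of ?v] J_carrier[OF P V]]
  have c3: "1\<^sub>m ?v \<otimes>\<^sub>K (J_power V n \<otimes>\<^sub>K 1\<^sub>m ?v) \<in> carrier_mat (?v * (Fdim ?P * ?v)) (?v * (?v ^ n * ?v))"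
    by (rule kronecker_carrier[OF one_carrier_mat kronecker_carrier[OF Jn one_carrier_mat]])
  have c4: "J V ?P \<otimes>\<^sub>K 1\<^sub>m ?v \<in> carrier_mat (Fdim (tensor_rep H V ?P) * ?v) (?v * (Fdim ?P * ?v))"
    using kronecker_carrier[OF J_carrier[OF V P] one_carrier_mat[of ?v]] by (simp add: mult.assoc)
  have "J_power V (Suc (Suc n)) = J V (tensor_rep H ?P V) * (1\<^sub>m ?v \<otimes>\<^sub>K (J ?P V * (J_power V n \<otimes>\<^sub>K 1\<^sub>m ?v)))"
    unfolding J_power.simps(2)[of V "Suc n"] Suc unfolding tensor_power.simps PV_VP ..
  also have "\<dots> = J V (tensor_rep H ?P V) * (1\<^sub>m ?v \<otimes>\<^sub>K J ?P V) * (1\<^sub>m ?v \<otimes>\<^sub>K (J_power V n \<otimes>\<^sub>K 1\<^sub>m ?v))"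
    unfolding one_kronecker_mult[OF J_carrier[OF P V] kronecker_carrier[OF Jn one_carrier_mat]]
    by (rule assoc_mult_mat[OF c1 c2 c3, symmetric])
  also have "\<dots> = J (tensor_rep H V ?P) V * (J V ?P \<otimes>\<^sub>K 1\<^sub>m ?v) * (1\<^sub>m ?v \<otimes>\<^sub>K (J_power V n \<otimes>\<^sub>K 1\<^sub>m ?v))"
    unfolding J_assoc[OF V P V] ..
  also have "\<dots> = J (tensor_rep H V ?P) V * ((J V ?P \<otimes>\<^sub>K 1\<^sub>m ?v) * ((1\<^sub>m ?v \<otimes>\<^sub>K J_power V n) \<otimes>\<^sub>K 1\<^sub>m ?v))"
    unfolding kronecker_assoc by (rule assoc_mult_mat[OF J_carrier[OF VP V] c4 c3])
  also have "\<dots> = J (tensor_rep H V ?P) V * (J_power V (Suc n) \<otimes>\<^sub>K 1\<^sub>m ?v)"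
    unfolding J_power.simps kronecker_one_mult[OF J_carrier[OF V P] kronecker_carrier[OF one_carrier_mat Jn]] ..
  finally show ?case by simp
qed

lemma \<phi>_inverse:
  obtains \<phi>' where "\<phi>' \<in> lmod_hom (on_ob F (unit_rep H)) (unit_rep H')" "\<phi>' * \<phi> = 1\<^sub>m 1" "\<phi> * \<phi>' = 1\<^sub>m (Fdim (unit_rep H))"
  using lmod_isoE[OF \<phi>_iso] by (metis fst_unit_rep)

text \<open>\<open>K\<close> is a right inverse of \<open>J_power\<close>, so sandwiching moves
  \<open>F(X)\<close> to the tensor power of \<open>F(V)\<close>. Slides are additive, and each
  summand through the trivial module is a planar diagram, to which \<open>planar\<close> and
  \<open>planar'\<close> apply.\<close>

lemma slide_transport:
  assumes V: "V \<in> lmod H" and X: "factors_trivially H (tensor_power H V (Suc n)) X"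
    and K: "K \<in> carrier_mat (Fdim V * Fdim V ^ n) (Fdim (tensor_power H V (Suc n)))"
      "J_power V (Suc n) * K = 1\<^sub>m (Fdim (tensor_power H V (Suc n)))"
  shows "slide (fst V) (fst V ^ n) X \<in> lmod_hom V V \<and> slide' (fst V) (fst V ^ n) X \<in> lmod_hom V V \<and>
    on_hom F V V (slide (fst V) (fst V ^ n) X) = slide (Fdim V) (Fdim V ^ n)
      (K * on_hom F (tensor_power H V (Suc n)) (tensor_power H V (Suc n)) X * J_power V (Suc n)) \<and>
    on_hom F V V (slide' (fst V) (fst V ^ n) X) = slide' (Fdim V) (Fdim V ^ n)
      (K * on_hom F (tensor_power H V (Suc n)) (tensor_power H V (Suc n)) X * J_power V (Suc n))"
  using X
proof induction
  define T d v m where "T = tensor_power H V (Suc n)" and "d = fst V" and "v = Fdim V"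
    and "m = Fdim (tensor_power H V (Suc n))"
  define N where "N = v ^ n"
  have N: "Fdim V ^ n = N" by (simp add: N_def v_def)
  note defs = T_def[symmetric] d_def[symmetric] v_def[symmetric] N_def[symmetric] m_def[symmetric]
  note P = A.tensor_power_lmod[OF V, of n]
  have T: "T \<in> lmod H" unfolding T_def by (rule A.tensor_power_lmod[OF V])
  note U = A.unit_rep_lmod
  have T_left: "tensor_rep H V (tensor_power H V n) = T" and T_right: "tensor_rep H (tensor_power H V n) V = T"
    using A.tensor_power_Suc_right[OF V, of n] by (simp_all add: T_def)
  have fst_T: "fst T = d * d ^ n" by (simp add: T_def d_def)
  have FT: "Fdim T = m" by (simp add: T_def m_def)
  define Jn where "Jn = J_power V (Suc n)"
  have Jn: "Jn \<in> carrier_mat m (v * N)"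
    using J_power_carrier[OF V, of "Suc n"] by (simp add: Jn_def v_def N_def m_def)
  have K: "K \<in> carrier_mat (v * N) m" and JK: "Jn * K = 1\<^sub>m m"
    using K by (simp_all only: Jn_def v_def N_def m_def)
  have FX: "on_hom F T T X \<in> carrier_mat m m" if "X \<in> lmod_hom T T" for X
    using hom_carrier[OF T T that] by (simp only: FT)
  {
    case zero
    have F0: "K * on_hom F T T (0\<^sub>m (fst T) (fst T)) * Jn = 0\<^sub>m (v * v ^ n) (v * v ^ n)"
      unfolding hom_zero[OF T T] FT using K Jn by (simp add: N_def)
    have V0: "0\<^sub>m d d \<in> lmod_hom V V" "on_hom F V V (0\<^sub>m d d) = 0\<^sub>m v v"
      unfolding d_def v_def by (rule lmod_hom_zero[OF V V] hom_zero[OF V V])+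
    have s0: "slide d (d ^ n) (0\<^sub>m (fst T) (fst T)) = 0\<^sub>m d d" "slide' d (d ^ n) (0\<^sub>m (fst T) (fst T)) = 0\<^sub>m d d"
      unfolding fst_T by (rule slide_zero)+
    show ?case
      unfolding T_def[symmetric] d_def[symmetric] v_def[symmetric] Jn_def[symmetric] F0 s0 slide_zero V0(2)
      using V0(1) by simp
  next
    case step: (add p q X)
    note p = step(1)[folded T_def] and q = step(2)[folded T_def] and X = step(3)[folded T_def]
    note IH = step(4)[unfolded defs, folded Jn_def]
    note XT = A.factors_trivially_hom[OF T X]
    obtain \<phi>' where \<phi>': "\<phi>' \<in> lmod_hom (on_ob F (unit_rep H)) (unit_rep H')" "\<phi>' * \<phi> = 1\<^sub>m 1" "\<phi> * \<phi>' = 1\<^sub>m (Fdim (unit_rep H))"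
      using \<phi>_inverse .
    define u where "u = Fdim (unit_rep H)"
    have \<phi>: "\<phi> \<in> carrier_mat u 1" and \<phi>'_c: "\<phi>' \<in> carrier_mat 1 u"
      using \<phi>_carrier lmod_hom_carrier[OF \<phi>'(1)] by (simp_all add: u_def)
    define Fp Fq where "Fp = on_hom F (unit_rep H) T p" and "Fq = on_hom F T (unit_rep H) q"
    have Fp: "Fp \<in> carrier_mat m u" and Fq: "Fq \<in> carrier_mat u m"
      using hom_carrier[OF U T p] hom_carrier[OF T U q] by (simp_all only: Fp_def Fq_def u_def FT)
    \<comment> \<open>The images of \<open>p\<close> and \<open>q\<close> as maps between the
      trivial module and the tensor power of \<open>F(V)\<close>. In the product
      \<open>p' * q'\<close> the factors \<open>\<phi>\<close> and \<open>\<phi>'\<close>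
      cancel.\<close>
    define p' q' where "p' = K * (Fp * \<phi>)" and "q' = \<phi>' * (Fq * Jn)"
    note Fp\<phi> = mult_carrier_mat[OF Fp \<phi>] and FqJ = mult_carrier_mat[OF Fq Jn]
    have p': "p' \<in> carrier_mat (v * N) 1" and q': "q' \<in> carrier_mat 1 (v * N)"
      unfolding p'_def q'_def by (rule mult_carrier_mat[OF K Fp\<phi>] mult_carrier_mat[OF \<phi>'_c FqJ])+
    have Jp: "Jn * p' = Fp * \<phi>"
      unfolding p'_def assoc_mult_mat[OF Jn K Fp\<phi>, symmetric] JK by (rule left_mult_one_mat[OF Fp\<phi>])
    have Jq: "\<phi> * q' = Fq * Jn"
      unfolding q'_def assoc_mult_mat[OF \<phi> \<phi>'_c FqJ, symmetric] \<phi>'(3) u_def[symmetric] by (rule left_mult_one_mat[OF FqJ])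
    have pq': "p' * q' = K * (Fp * Fq) * Jn"
    proof -
      have "p' * q' = K * ((Fp * \<phi>) * (\<phi>' * (Fq * Jn)))"
        unfolding p'_def q'_def by (rule assoc_mult_mat[OF K Fp\<phi> mult_carrier_mat[OF \<phi>'_c FqJ]])
      also have "(Fp * \<phi>) * (\<phi>' * (Fq * Jn)) = Fp * (\<phi> * (\<phi>' * (Fq * Jn)))"
        by (rule assoc_mult_mat[OF Fp \<phi> mult_carrier_mat[OF \<phi>'_c FqJ]])
      also have "\<phi> * (\<phi>' * (Fq * Jn)) = Fq * Jn"
        using Jq unfolding q'_def .
      also have "Fp * (Fq * Jn) = Fp * Fq * Jn"
        by (rule assoc_mult_mat[OF Fp Fq Jn, symmetric])
      also have "K * (Fp * Fq * Jn) = K * (Fp * Fq) * Jn"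
        by (rule assoc_mult_mat[OF K mult_carrier_mat[OF Fp Fq] Jn, symmetric])
      finally show ?thesis .
    qed
    have Jn_left: "J V (tensor_power H V n) * (1\<^sub>m (Fdim V) \<otimes>\<^sub>K J_power V n) = Jn"
      by (simp add: Jn_def)
    have Jn_right: "J (tensor_power H V n) V * (J_power V n \<otimes>\<^sub>K 1\<^sub>m (Fdim V)) = Jn"
      by (simp only: Jn_def J_power_Suc_right[OF V])
    note JP = J_carrier[OF V P, unfolded T_left FT, folded v_def] J_carrier[OF P V, unfolded T_right FT, folded v_def]
    note Kr = kronecker_carrier[OF one_carrier_mat[of v] J_power_carrier[OF V, of n]]
      kronecker_carrier[OF J_power_carrier[OF V, of n] one_carrier_mat[of v]]
    note Kr = Kr[unfolded N]
    have p2: "p' \<in> carrier_mat (Fdim V * N) 1" "p' \<in> carrier_mat (N * Fdim V) 1"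
      and q2: "q' \<in> carrier_mat 1 (N * Fdim V)" "q' \<in> carrier_mat 1 (Fdim V * N)"
      using p' q' by (simp_all add: v_def mult.commute)
    have Jp1: "J V (tensor_power H V n) * ((1\<^sub>m (Fdim V) \<otimes>\<^sub>K J_power V n) * p') =
      on_hom F (unit_rep H) (tensor_rep H V (tensor_power H V n)) p * \<phi>"
      using assoc_mult_mat[OF JP(1) Kr(1) p'] unfolding v_def Jn_left T_left Jp Fp_def by (rule sym)
    have Jp2: "J (tensor_power H V n) V * ((J_power V n \<otimes>\<^sub>K 1\<^sub>m (Fdim V)) * p') =
      on_hom F (unit_rep H) (tensor_rep H (tensor_power H V n) V) p * \<phi>"
      using assoc_mult_mat[OF JP(2) Kr(2), of p' 1] p2(2) unfolding v_def Jn_right T_right Jp Fp_def by simp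
    \<comment> \<open>\<open>W\<close> is the \<open>n\<close>-th tensor power, and its change of
      coordinates is \<open>J_power V n\<close>; both forms of \<open>J_power V (Suc n)\<close> then
      match the hypotheses.\<close>
    note pl = planar[OF V P p[folded T_left] q[folded T_right] J_power_carrier[OF V, of n, unfolded N] p2(1) q2(1) Jp1,
        unfolded Jn_right T_right, OF Jq[unfolded Fq_def]]
    note pl' = planar'[OF V P p[folded T_right] q[folded T_left] J_power_carrier[OF V, of n, unfolded N] p2(2) q2(2) Jp2,
        unfolded Jn_left T_left, OF Jq[unfolded Fq_def]]
    have pc: "p \<in> carrier_mat (d * d ^ n) 1" and qc: "q \<in> carrier_mat 1 (d * d ^ n)"
      using lmod_hom_carrier[OF p] lmod_hom_carrier[OF q] by (simp_all add: fst_T)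
    define Y where "Y = K * on_hom F T T X * Jn"
    have pqT: "p * q \<in> lmod_hom T T" by (rule lmod_hom_mult[OF T U T q p])
    have pqc: "p * q \<in> carrier_mat (d * d ^ n) (d * d ^ n)" and Xc: "X \<in> carrier_mat (d * d ^ n) (d * d ^ n)"
      using lmod_hom_carrier[OF pqT] lmod_hom_carrier[OF XT] unfolding fst_T .
    have pqc': "p' * q' \<in> carrier_mat (v * N) (v * N)" by (rule mult_carrier_mat[OF p' q'])
    have Yc: "Y \<in> carrier_mat (v * N) (v * N)"
      unfolding Y_def by (rule mult_carrier_mat[OF mult_carrier_mat[OF K FX[OF XT]] Jn])
    have "K * on_hom F T T (p * q + X) * Jn = K * (Fp * Fq + on_hom F T T X) * Jn"
      by (simp only: add[OF T T pqT XT] comp[OF T U T q p] Fp_def Fq_def)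
    also have "\<dots> = p' * q' + Y"
      unfolding Y_def pq' mult_add_distrib_mat[OF K mult_carrier_mat[OF Fp Fq] FX[OF XT]]
      by (rule add_mult_distrib_mat[OF mult_carrier_mat[OF K mult_carrier_mat[OF Fp Fq]] mult_carrier_mat[OF K FX[OF XT]] Jn])
    finally have sum: "K * on_hom F T T (p * q + X) * Jn = p' * q' + Y" .
    have sl: "slide d (d ^ n) (p * q) \<in> lmod_hom V V" "slide' d (d ^ n) (p * q) \<in> lmod_hom V V"
      "on_hom F V V (slide d (d ^ n) (p * q)) = slide v N (p' * q')"
      "on_hom F V V (slide' d (d ^ n) (p * q)) = slide' v N (p' * q')"
      unfolding slide_mult[OF pc qc] slide_mult[OF p' q'] unfolding d_def v_def by (rule pl pl')+
    show ?case
      unfolding defs Jn_def[symmetric] sum slide_add[OF pqc Xc] slide_add[OF pqc' Yc]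
      using sl IH[folded Y_def] lmod_hom_add[OF V V] add[OF V V] by simp
  }
qed

section \<open>Elements corresponding under the functor\<close>

text \<open>On the source side \<open>x\<close> is a natural endomorphism of the identity functor;
  \<open>x'\<close> realises its image. As a relation it has its closure properties for every tensor
  functor; existence of \<open>x'\<close> is obtained later from an equivalence.\<close>

definition transported :: "'a \<Rightarrow> 'b \<Rightarrow> bool" where
  "transported x x' \<longleftrightarrow> (\<forall>V\<in>lmod H. snd V x \<in> lmod_hom V V \<and> on_hom F V V (snd V x) = snd (on_ob F V) x')"

lemma transportedD:
  "transported x x' \<Longrightarrow> V \<in> lmod H \<Longrightarrow> snd V x \<in> lmod_hom V V"
  "transported x x' \<Longrightarrow> V \<in> lmod H \<Longrightarrow> on_hom F V V (snd V x) = snd (on_ob F V) x'"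
  by (simp_all add: transported_def)

lemma transported_one: "transported 1 1"
  unfolding transported_def
proof (intro ballI conjI)
  fix V assume V: "V \<in> lmod H"
  show "snd V 1 \<in> lmod_hom V V" "on_hom F V V (snd V 1) = snd (on_ob F V) 1"
    unfolding lmodD(4)[OF V] lmodD(4)[OF ob[OF V]] id[OF V] by (rule lmod_hom_one[OF V] refl)+
qed

lemma transported_add: "transported x x' \<Longrightarrow> transported y y' \<Longrightarrow> transported (x + y) (x' + y')"
  unfolding transported_def by (simp add: lmodD(1)[where H = H] lmodD(1)[where H = H'] ob lmod_hom_add add)

lemma transported_mult: "transported x x' \<Longrightarrow> transported y y' \<Longrightarrow> transported (x * y) (x' * y')"
  unfolding transported_def by (simp add: lmodD(3)[where H = H] lmodD(3)[where H = H'] ob lmod_hom_mult comp)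

lemma transported_scale:
  assumes "transported x x'"
  shows "transported (Defs.scale H c x) (Defs.scale H' c x')"
  unfolding transported_def
proof (intro ballI conjI)
  fix V assume V: "V \<in> lmod H"
  note x = transportedD[OF assms V]
  show "on_hom F V V (snd V (Defs.scale H c x)) = snd (on_ob F V) (Defs.scale H' c x')"
    by (simp only: lmodD(2)[OF V] lmodD(2)[OF ob[OF V]] scale[OF V V x(1)] x(2))
  have c: "snd V y \<in> carrier_mat (fst V) (fst V)" for y by (rule lmod_carrier[OF V])
  show "snd V (Defs.scale H c x) \<in> lmod_hom V V"
  proof (rule lmod_homI[OF c])
    show "snd V (Defs.scale H c x) * snd V y = snd V y * snd V (Defs.scale H c x)" for y
      unfolding lmodD(2)[OF V] mult_smult_assoc_mat[OF c c] mult_smult_distrib[OF c c] lmod_hom_commute[OF x(1)] ..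
  qed
qed

lemma transported_zero: "transported 0 0"
  using transported_scale[OF transported_one, of 0] by simp

lemma transported_sum: "(\<And>i. i \<in> I \<Longrightarrow> transported (f i) (g i)) \<Longrightarrow> transported (\<Sum>i\<in>I. f i) (\<Sum>i\<in>I. g i)"
  by (induction I rule: infinite_finite_induct) (simp_all add: transported_zero transported_add)

lemma transported_power: "transported x x' \<Longrightarrow> transported (x ^ n) (x' ^ n)"
  by (induction n) (simp_all add: transported_one transported_mult)

lemma transported_prod_list:
  "(\<And>i. i \<in> set is \<Longrightarrow> transported (f i) (g i)) \<Longrightarrow> transported (prod_list (map f is)) (prod_list (map g is))"
  by (induction "is") (simp_all add: transported_one transported_mult)

lemma transported_eval_poly:
  assumes "\<And>i. i < s \<Longrightarrow> transported (x i) (y i)"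
  shows "transported (eval_poly H s \<psi> x) (eval_poly H' s \<psi> y)"
  unfolding eval_poly_def
  by (intro transported_sum transported_scale transported_prod_list transported_power assms) simp

text \<open>The products of legs are slides of the action of \<open>x\<close> on a tensor power of
  \<open>V\<close>, and slides are carried along by \<open>slide_transport\<close>. This is why
  \<open>fac\<close> is needed for all modules.\<close>

lemma transported_iter_comult:
  assumes x: "transported x x'" and fac: "\<And>V. V \<in> lmod H \<Longrightarrow> factors_trivially H V (snd V x)"
  shows "transported (\<Sum>xs\<leftarrow>iter_comult H n x. prod_list xs) (\<Sum>xs\<leftarrow>iter_comult H' n x'. prod_list xs)"
    and "transported (\<Sum>xs\<leftarrow>iter_comult H n x. prod_list (rev xs)) (\<Sum>xs\<leftarrow>iter_comult H' n x'. prod_list (rev xs))"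
proof -
  have *: "snd V (\<Sum>xs\<leftarrow>iter_comult H n x. prod_list xs) \<in> lmod_hom V V \<and>
    snd V (\<Sum>xs\<leftarrow>iter_comult H n x. prod_list (rev xs)) \<in> lmod_hom V V \<and>
    on_hom F V V (snd V (\<Sum>xs\<leftarrow>iter_comult H n x. prod_list xs)) = snd (on_ob F V) (\<Sum>xs\<leftarrow>iter_comult H' n x'. prod_list xs) \<and>
    on_hom F V V (snd V (\<Sum>xs\<leftarrow>iter_comult H n x. prod_list (rev xs))) =
      snd (on_ob F V) (\<Sum>xs\<leftarrow>iter_comult H' n x'. prod_list (rev xs))"
    if V: "V \<in> lmod H" for V
  proof -
    define T T' where "T = tensor_power H V (Suc n)" and "T' = tensor_power H' (on_ob F V) (Suc n)"
    have T: "T \<in> lmod H" and T': "T' \<in> lmod H'"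
      unfolding T_def T'_def by (rule A.tensor_power_lmod[OF V] A'.tensor_power_lmod[OF ob[OF V]])+
    obtain K where K: "J_power V (Suc n) \<in> lmod_hom T' (on_ob F T)" "K \<in> lmod_hom (on_ob F T) T'"
      "K * J_power V (Suc n) = 1\<^sub>m (fst T')" "J_power V (Suc n) * K = 1\<^sub>m (Fdim T)"
      using lmod_isoE[OF J_power_iso[OF V, of "Suc n", folded T_def T'_def]] .
    note Kc = lmod_hom_carrier[OF K(2)] and Jc = lmod_hom_carrier[OF K(1)]
    have Kc': "K \<in> carrier_mat (Fdim V * Fdim V ^ n) (Fdim T)"
      using Kc by (simp add: T'_def)
    \<comment> \<open>Linearity of \<open>J_power\<close> identifies the conjugate of
      \<open>F(x)\<close> with the action of \<open>x'\<close> on the tensor power of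
      \<open>F(V)\<close>.\<close>
    have "K * on_hom F T T (snd T x) * J_power V (Suc n) = K * (snd (on_ob F T) x' * J_power V (Suc n))"
      unfolding transportedD(2)[OF x T] by (rule assoc_mult_mat[OF Kc lmod_carrier[OF ob[OF T]] Jc])
    also have "\<dots> = K * (J_power V (Suc n) * snd T' x')"
      unfolding lmod_hom_commute[OF K(1)] ..
    also have "\<dots> = snd T' x'"
      unfolding assoc_mult_mat[OF Kc Jc lmod_carrier[OF T'], symmetric] K(3) by (rule left_mult_one_mat[OF lmod_carrier[OF T']])
    finally have eq: "K * on_hom F T T (snd T x) * J_power V (Suc n) = snd T' x'" .
    from slide_transport[where n = n, OF V fac[OF A.tensor_power_lmod[OF V]], folded T_def, OF Kc' K(4), unfolded eq]
    show ?thesis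
      unfolding T_def T'_def A.slide_tensor_power[OF V] A.slide'_tensor_power[OF V]
        A'.slide_tensor_power[OF ob[OF V]] A'.slide'_tensor_power[OF ob[OF V]] by blast
  qed
  then show "transported (\<Sum>xs\<leftarrow>iter_comult H n x. prod_list xs) (\<Sum>xs\<leftarrow>iter_comult H' n x'. prod_list xs)"
    "transported (\<Sum>xs\<leftarrow>iter_comult H n x. prod_list (rev xs)) (\<Sum>xs\<leftarrow>iter_comult H' n x'. prod_list (rev xs))"
    unfolding transported_def by blast+
qed

text \<open>The snake of \<open>antipode_planar\<close> is carried over by \<open>planar\<close>. In
  its image \<open>z'\<close> acts on \<open>F\<close> of the dual; \<open>pairing_antipode\<close>
  moves it across the transported evaluation, where it becomes the antipode of \<open>z'\<close>.
  The remaining snake is the image of the identity.\<close>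

lemma transported_antipode:
  assumes z: "transported z z'"
  shows "transported (antipode H z) (antipode H' z')"
  unfolding transported_def
proof (intro ballI)
  fix V assume V: "V \<in> lmod H"
  define W d v w where "W = dual_rep H V" and "d = fst V" and "v = Fdim V" and "w = Fdim W"
  have W: "W \<in> lmod H" unfolding W_def by (rule A.dual_rep_lmod[OF V])
  have fst_W: "fst W = d" by (simp add: W_def d_def)
  note U = A.unit_rep_lmod
  note VW = A.tensor_rep_lmod[OF V W] and WV = A.tensor_rep_lmod[OF W V]
  note FV = ob[OF V] and FW = ob[OF W]
  define c e :: "'k mat" where "c = coev_mat d" and "e = ev_mat d"
  have c: "c \<in> lmod_hom (unit_rep H) (tensor_rep H V W)" and e: "e \<in> lmod_hom (tensor_rep H W V) (unit_rep H)"
    using A.coev_mat_hom[OF V] A.ev_mat_hom[OF V] by (simp_all only: c_def e_def d_def W_def)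
  define Z where "Z = snd W z \<otimes>\<^sub>K 1\<^sub>m d"
  have zW: "snd W z \<in> lmod_hom W W" and FzW: "on_hom F W W (snd W z) = snd (on_ob F W) z'"
    using transportedD[OF z W] .
  have Z: "Z \<in> lmod_hom (tensor_rep H W V) (tensor_rep H W V)"
    unfolding Z_def d_def by (rule lmod_hom_kronecker[OF W V W V zW lmod_hom_one[OF V]])
  have eZ: "e * Z \<in> lmod_hom (tensor_rep H W V) (unit_rep H)"
    by (rule lmod_hom_mult[OF WV WV U Z e])
  have S_planar: "(1\<^sub>m d \<otimes>\<^sub>K (e * Z)) * (c \<otimes>\<^sub>K 1\<^sub>m d) = snd V (antipode H z)"
    using A.antipode_planar[OF V, of z] by (simp only: c_def e_def d_def Z_def W_def)
  have zigzag: "(1\<^sub>m d \<otimes>\<^sub>K e) * (c \<otimes>\<^sub>K 1\<^sub>m d) = 1\<^sub>m d"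
  proof -
    have "snd W 1 \<otimes>\<^sub>K 1\<^sub>m d = 1\<^sub>m (d * d)"
      using lmodD(4)[OF W] by (simp add: fst_W kronecker_one)
    moreover have "e * 1\<^sub>m (d * d) = e"
      unfolding e_def by (rule right_mult_one_mat[OF ev_mat_carrier])
    ultimately show ?thesis
      using A.antipode_planar[OF V, of 1] lmodD(4)[OF V]
      by (simp only: c_def e_def d_def W_def A.antipode_one)
  qed
  obtain \<phi>' where \<phi>': "\<phi>' \<in> lmod_hom (on_ob F (unit_rep H)) (unit_rep H')" "\<phi>' * \<phi> = 1\<^sub>m 1" "\<phi> * \<phi>' = 1\<^sub>m (Fdim (unit_rep H))"
    using \<phi>_inverse .
  have \<phi>'_c: "\<phi>' \<in> carrier_mat 1 (Fdim (unit_rep H))" using lmod_hom_carrier[OF \<phi>'(1)] by simp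
  obtain K where K: "K \<in> lmod_hom (on_ob F (tensor_rep H V W)) (tensor_rep H' (on_ob F V) (on_ob F W))"
    "J V W * K = 1\<^sub>m (Fdim (tensor_rep H V W))"
    using lmod_isoE[OF J_iso[OF V W]] by metis
  have Kc: "K \<in> carrier_mat (v * w) (Fdim (tensor_rep H V W))"
    using lmod_hom_carrier[OF K(1)] by (simp add: v_def w_def)
  note JVW = J_carrier[OF V W, folded v_def w_def] and JWV = J_carrier[OF W V, folded v_def w_def]
  have J_hom: "J W V \<in> lmod_hom (tensor_rep H' (on_ob F W) (on_ob F V)) (on_ob F (tensor_rep H W V))"
    using J_iso[OF W V] unfolding lmod_iso_def by blast
  define Fc Fe where "Fc = on_hom F (unit_rep H) (tensor_rep H V W) c" and "Fe = on_hom F (tensor_rep H W V) (unit_rep H) e"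
  have Fc: "Fc \<in> carrier_mat (Fdim (tensor_rep H V W)) (Fdim (unit_rep H))"
    unfolding Fc_def by (rule hom_carrier[OF U VW c])
  have Fe: "Fe \<in> carrier_mat (Fdim (unit_rep H)) (Fdim (tensor_rep H W V))"
    and Fe_hom: "Fe \<in> lmod_hom (on_ob F (tensor_rep H W V)) (on_ob F (unit_rep H))"
    unfolding Fe_def by (rule hom_carrier[OF WV U e] hom[OF WV U e])+
  define c' e' where "c' = K * (Fc * \<phi>)" and "e' = \<phi>' * (Fe * J W V)"
  note Fc\<phi> = mult_carrier_mat[OF Fc \<phi>_carrier] and FeJ = mult_carrier_mat[OF Fe JWV]
  have c'_c: "c' \<in> carrier_mat (v * w) 1" and e'_c: "e' \<in> carrier_mat 1 (w * v)"
    unfolding c'_def e'_def by (rule mult_carrier_mat[OF Kc Fc\<phi>] mult_carrier_mat[OF \<phi>'_c FeJ])+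
  have FWFV: "tensor_rep H' (on_ob F W) (on_ob F V) \<in> lmod H'" by (rule A'.tensor_rep_lmod[OF FW FV])
  have e'_hom: "e' \<in> lmod_hom (tensor_rep H' (on_ob F W) (on_ob F V)) (unit_rep H')"
    unfolding e'_def
    by (rule lmod_hom_mult[OF FWFV ob[OF U] A'.unit_rep_lmod lmod_hom_mult[OF FWFV ob[OF WV] ob[OF U] J_hom Fe_hom] \<phi>'(1)])
  have Jc: "J V W * ((1\<^sub>m (Fdim V) \<otimes>\<^sub>K 1\<^sub>m (Fdim W)) * c') = on_hom F (unit_rep H) (tensor_rep H V W) c * \<phi>"
    unfolding kronecker_one v_def[symmetric] w_def[symmetric] left_mult_one_mat[OF c'_c] Fc_def[symmetric]
    unfolding c'_def assoc_mult_mat[OF JVW Kc Fc\<phi>, symmetric] K(2) by (rule left_mult_one_mat[OF Fc\<phi>])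
  have J1: "J W V * (1\<^sub>m (Fdim W) \<otimes>\<^sub>K 1\<^sub>m (Fdim V)) = J W V"
    unfolding kronecker_one by (rule right_mult_one_mat[OF J_carrier[OF W V]])
  have Je: "\<phi> * e' = on_hom F (tensor_rep H W V) (unit_rep H) e * (J W V * (1\<^sub>m (Fdim W) \<otimes>\<^sub>K 1\<^sub>m (Fdim V)))"
    unfolding J1 Fe_def[symmetric] e'_def assoc_mult_mat[OF \<phi>_carrier \<phi>'_c FeJ, symmetric] \<phi>'(3) by (rule left_mult_one_mat[OF FeJ])
  define R where "R = snd (on_ob F V) (antipode H' z')"
  have R: "R \<in> carrier_mat v v" unfolding R_def v_def by (rule lmod_carrier[OF FV])
  define Z' where "Z' = snd (on_ob F W) z' \<otimes>\<^sub>K 1\<^sub>m v"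
  have Z': "Z' \<in> carrier_mat (w * v) (w * v)"
    unfolding Z'_def w_def by (rule kronecker_carrier[OF lmod_carrier[OF FW] one_carrier_mat])
  have wR: "1\<^sub>m w \<otimes>\<^sub>K R \<in> carrier_mat (w * v) (w * v)" by (rule kronecker_carrier[OF one_carrier_mat R])
  have eZ': "e' * Z' = e' * (1\<^sub>m w \<otimes>\<^sub>K R)"
    unfolding Z'_def R_def v_def w_def by (rule A'.pairing_antipode[OF FW FV e'_hom])
  have FZ: "on_hom F (tensor_rep H W V) (tensor_rep H W V) Z * J W V = J W V * Z'"
    using J_natural[OF W V W V zW lmod_hom_one[OF V]]
    unfolding Z_def d_def Z'_def v_def FzW id[OF V] by (rule sym)
  have FZ_c: "on_hom F (tensor_rep H W V) (tensor_rep H W V) Z \<in> carrier_mat (Fdim (tensor_rep H W V)) (Fdim (tensor_rep H W V))"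
    by (rule hom_carrier[OF WV WV Z])
  have JeZ: "\<phi> * (e' * Z') = on_hom F (tensor_rep H W V) (unit_rep H) (e * Z) * (J W V * (1\<^sub>m (Fdim W) \<otimes>\<^sub>K 1\<^sub>m (Fdim V)))"
  proof -
    have "on_hom F (tensor_rep H W V) (unit_rep H) (e * Z) * J W V = Fe * (J W V * Z')"
      unfolding comp[OF WV WV U Z e] Fe_def[symmetric] assoc_mult_mat[OF Fe FZ_c JWV] FZ ..
    also have "\<dots> = \<phi> * e' * Z'"
      unfolding Je[unfolded J1, folded Fe_def] by (rule assoc_mult_mat[OF Fe JWV Z', symmetric])
    also have "\<dots> = \<phi> * (e' * Z')"
      by (rule assoc_mult_mat[OF \<phi>_carrier e'_c Z'])
    finally show ?thesis unfolding J1 by (rule sym)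
  qed
  note P = planar[OF V W c eZ one_carrier_mat c'_c[unfolded v_def w_def] mult_carrier_mat[OF e'_c Z', unfolded v_def w_def] Jc JeZ]
  note Q = planar[OF V W c e one_carrier_mat c'_c[unfolded v_def w_def] e'_c[unfolded v_def w_def] Jc Je]
  have e1: "1\<^sub>m v \<otimes>\<^sub>K e' \<in> carrier_mat v (v * (w * v))"
    using kronecker_carrier[OF one_carrier_mat[of v] e'_c] by simp
  have c1: "c' \<otimes>\<^sub>K 1\<^sub>m v \<in> carrier_mat (v * (w * v)) v"
    using kronecker_carrier[OF c'_c one_carrier_mat[of v]] by (simp add: mult.assoc)
  have wR1: "1\<^sub>m v \<otimes>\<^sub>K (1\<^sub>m w \<otimes>\<^sub>K R) \<in> carrier_mat (v * (w * v)) (v * (w * v))"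
    by (rule kronecker_carrier[OF one_carrier_mat wR])
  \<comment> \<open>\<open>R\<close> and \<open>c'\<close> act on disjoint strands, so
    \<open>R\<close> can be pulled out of the snake.\<close>
  have swap: "(1\<^sub>m v \<otimes>\<^sub>K (1\<^sub>m w \<otimes>\<^sub>K R)) * (c' \<otimes>\<^sub>K 1\<^sub>m v) = (c' \<otimes>\<^sub>K 1\<^sub>m v) * R"
  proof -
    have "(1\<^sub>m v \<otimes>\<^sub>K (1\<^sub>m w \<otimes>\<^sub>K R)) * (c' \<otimes>\<^sub>K 1\<^sub>m v) = c' \<otimes>\<^sub>K R"
      unfolding kronecker_assoc[symmetric] kronecker_one kronecker_mult[OF one_carrier_mat c'_c R one_carrier_mat]
        left_mult_one_mat[OF c'_c] right_mult_one_mat[OF R] ..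
    also have "\<dots> = (c' \<otimes>\<^sub>K 1\<^sub>m v) * (1\<^sub>m 1 \<otimes>\<^sub>K R)"
      unfolding kronecker_mult[OF c'_c one_carrier_mat one_carrier_mat R] right_mult_one_mat[OF c'_c] left_mult_one_mat[OF R] ..
    finally show ?thesis unfolding kronecker_one_left .
  qed
  have "on_hom F V V (snd V (antipode H z)) = (1\<^sub>m v \<otimes>\<^sub>K (e' * Z')) * (c' \<otimes>\<^sub>K 1\<^sub>m v)"
    using P(2) unfolding d_def[symmetric] S_planar v_def .
  also have "\<dots> = (1\<^sub>m v \<otimes>\<^sub>K e') * ((1\<^sub>m v \<otimes>\<^sub>K (1\<^sub>m w \<otimes>\<^sub>K R)) * (c' \<otimes>\<^sub>K 1\<^sub>m v))"
    unfolding eZ' one_kronecker_mult[OF e'_c wR] by (rule assoc_mult_mat[OF e1 wR1 c1])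
  also have "\<dots> = (1\<^sub>m v \<otimes>\<^sub>K e') * (c' \<otimes>\<^sub>K 1\<^sub>m v) * R"
    unfolding swap by (rule assoc_mult_mat[OF e1 c1 R, symmetric])
  also have "(1\<^sub>m v \<otimes>\<^sub>K e') * (c' \<otimes>\<^sub>K 1\<^sub>m v) = 1\<^sub>m v"
    using Q(2) unfolding d_def[symmetric] zigzag v_def unfolding d_def id[OF V] by (rule sym)
  also have "1\<^sub>m v * R = R" by (rule left_mult_one_mat[OF R])
  finally show "snd V (antipode H z) \<in> lmod_hom V V \<and> on_hom F V V (snd V (antipode H z)) = snd (on_ob F V) (antipode H' z')"
    using P(1) unfolding d_def[symmetric] S_planar R_def by blast
qed

text \<open>The isomorphism \<open>\<phi>\<close> carries the trivial action over.\<close>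

lemma rep_F_unit: "snd (on_ob F (unit_rep H)) a = counit H' a \<cdot>\<^sub>m 1\<^sub>m (Fdim (unit_rep H))"
proof -
  let ?U = "on_ob F (unit_rep H)"
  note FU = ob[OF A.unit_rep_lmod]
  obtain \<phi>' where \<phi>': "\<phi>' \<in> lmod_hom ?U (unit_rep H')" "\<phi>' * \<phi> = 1\<^sub>m 1" "\<phi> * \<phi>' = 1\<^sub>m (fst ?U)"
    using \<phi>_inverse .
  have \<phi>'_c: "\<phi>' \<in> carrier_mat 1 (fst ?U)" using lmod_hom_carrier[OF \<phi>'(1)] by simp
  have \<phi>_hom: "\<phi> \<in> lmod_hom (unit_rep H') ?U" using \<phi>_iso unfolding lmod_iso_def by blast
  have "snd ?U a = snd ?U a * (\<phi> * \<phi>')"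
    unfolding \<phi>'(3) by (rule right_mult_one_mat[OF lmod_carrier[OF FU], symmetric])
  also have "\<dots> = \<phi> * snd (unit_rep H') a * \<phi>'"
    unfolding lmod_hom_commute[OF \<phi>_hom] by (rule assoc_mult_mat[OF lmod_carrier[OF FU] \<phi>_carrier \<phi>'_c, symmetric])
  also have "\<dots> = counit H' a \<cdot>\<^sub>m (\<phi> * \<phi>')"
    unfolding unit_rep_def snd_conv mult_smult_distrib[OF \<phi>_carrier one_carrier_mat] right_mult_one_mat[OF \<phi>_carrier]
    by (rule mult_smult_assoc_mat[OF \<phi>_carrier \<phi>'_c])
  finally show ?thesis unfolding \<phi>'(3) .
qed

text \<open>On the trivial module \<open>x\<close> is the scalar given by its counit, and
  \<open>F\<close> preserves scalars. This settles the Sweedler power of index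
  \<open>0\<close>.\<close>

lemma transported_counit:
  assumes "transported x x'"
  shows "counit H x = counit H' x'"
proof -
  let ?u = "Fdim (unit_rep H)"
  note U = A.unit_rep_lmod
  obtain \<phi>' where \<phi>': "\<phi>' \<in> lmod_hom (on_ob F (unit_rep H)) (unit_rep H')" "\<phi>' * \<phi> = 1\<^sub>m 1" "\<phi> * \<phi>' = 1\<^sub>m ?u"
    using \<phi>_inverse .
  have \<phi>'_c: "\<phi>' \<in> carrier_mat 1 ?u" using lmod_hom_carrier[OF \<phi>'(1)] by simp
  have "(\<phi>' * \<phi>) $$ (0, 0) = 1" unfolding \<phi>'(2) by simp
  then have "(\<Sum>k<?u. \<phi>' $$ (0, k) * \<phi> $$ (k, 0)) = 1"
    by (simp add: index_mult_mat_sum[OF \<phi>'_c \<phi>_carrier] del: index_mult_mat)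
  \<comment> \<open>A nonempty matrix is needed to read off the scalar; invertibility of
    \<open>\<phi>\<close> guarantees it.\<close>
  then have u: "0 < ?u" by (cases "?u = 0") auto
  have "counit H x \<cdot>\<^sub>m 1\<^sub>m ?u = counit H' x' \<cdot>\<^sub>m 1\<^sub>m ?u"
    using scale[OF U U lmod_hom_one[OF U], of "counit H x"] transportedD(2)[OF assms U]
    unfolding id[OF U] rep_F_unit unfolding unit_rep_def snd_conv fst_conv by simp
  from arg_cong[OF this, of "\<lambda>M. M $$ (0, 0)"] u show ?thesis by simp
qed

lemma transported_sweedler_power:
  assumes x: "transported x x'" and fac: "\<And>V. V \<in> lmod H \<Longrightarrow> factors_trivially H V (snd V x)"
  shows "transported (sweedler_power H n x) (sweedler_power H' n x')"
  unfolding sweedler_power_def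
  using transported_scale[OF transported_one, of "counit H x"] transported_counit[OF x]
    transported_iter_comult[OF x fac] transported_antipode by simp

text \<open>\<open>F(p)\<close> starts at the image of the unit object, on which
  \<open>rep_F_unit\<close> makes every \<open>a\<close> act by its counit; hence the image of
  \<open>F(p)\<close> consists of invariants.\<close>

lemma integral_image:
  assumes V: "V \<in> lmod H" and X: "factors_trivially H V X"
  shows "snd (on_ob F V) a * on_hom F V V X = counit H' a \<cdot>\<^sub>m on_hom F V V X"
  using X
proof induction
  let ?c = "counit H' a"
  note FV = ob[OF V] and U = A.unit_rep_lmod
  note c = lmod_carrier[OF FV, of a]
  {
    case zero
    show ?case unfolding hom_zero[OF V V] right_mult_zero_mat[OF c] by (intro eq_matI) simp_all
  next
    case step: (add p q X)
    note XV = A.factors_trivially_hom[OF V step(3)]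
    have pq: "p * q \<in> lmod_hom V V" by (rule lmod_hom_mult[OF V U V step(2,1)])
    note p = hom_carrier[OF U V step(1)] and q = hom_carrier[OF V U step(2)]
    let ?p = "on_hom F (unit_rep H) V p" and ?q = "on_hom F V (unit_rep H) q" and ?X = "on_hom F V V X"
    have "snd (on_ob F V) a * ?p = ?c \<cdot>\<^sub>m ?p"
      using lmod_hom_commute[OF hom[OF U V step(1)], of a]
      unfolding rep_F_unit mult_smult_distrib[OF p one_carrier_mat] right_mult_one_mat[OF p] by (rule sym)
    then have "snd (on_ob F V) a * (?p * ?q) = ?c \<cdot>\<^sub>m (?p * ?q)"
      unfolding assoc_mult_mat[OF c p q, symmetric] by (simp only: mult_smult_assoc_mat[OF p q])
    then show ?case
      unfolding add[OF V V pq XV] comp[OF V U V step(2,1)]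
        mult_add_distrib_mat[OF c mult_carrier_mat[OF p q] hom_carrier[OF V V XV]]
      by (simp only: step(4) add_smult_distrib_left_mat[OF mult_carrier_mat[OF p q] hom_carrier[OF V V XV]])
  }
qed

end

section \<open>Gauge equivalence\<close>

locale gauge_equivalence = hopf_tensor_functor H H' F J \<phi> + G: linear_functor H' H G
    + A: fin_dim_hopf_algebra H + A': fin_dim_hopf_algebra H'
  for H :: "('k::field, 'a::ring_1) hopf" and H' :: "('k, 'b::ring_1) hopf" and F J \<phi> G +
  fixes \<eta> \<theta>
  assumes natural_iso_GF: "natural_iso H id_functor (comp_functor G F) \<eta>"
    and natural_iso_FG: "natural_iso H' (comp_functor F G) id_functor \<theta>"
begin

lemma \<eta>_iso: "V \<in> lmod H \<Longrightarrow> \<eta> V \<in> lmod_iso V (on_ob G (on_ob F V))"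
  and \<eta>_natural: "V \<in> lmod H \<Longrightarrow> W \<in> lmod H \<Longrightarrow> T \<in> lmod_hom V W \<Longrightarrow>
    \<eta> W * T = on_hom G (on_ob F V) (on_ob F W) (on_hom F V W T) * \<eta> V"
  using natural_iso_GF by (simp_all add: natural_iso_def id_functor_def comp_functor_def)

lemma \<theta>_iso: "W \<in> lmod H' \<Longrightarrow> \<theta> W \<in> lmod_iso (on_ob F (on_ob G W)) W"
  and \<theta>_natural: "V \<in> lmod H' \<Longrightarrow> W \<in> lmod H' \<Longrightarrow> T \<in> lmod_hom V W \<Longrightarrow>
    \<theta> W * on_hom F (on_ob G V) (on_ob G W) (on_hom G V W T) = T * \<theta> V"
  using natural_iso_FG by (simp_all add: natural_iso_def id_functor_def comp_functor_def)

section \<open>Full faithfulness and its consequences\<close>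

lemma faithful:
  assumes V: "V \<in> lmod H" and W: "W \<in> lmod H" and S: "S \<in> lmod_hom V W" and T: "T \<in> lmod_hom V W"
    and eq: "on_hom F V W S = on_hom F V W T"
  shows "S = T"
proof -
  show ?thesis
    by (rule lmod_iso_cancel_left[OF \<eta>_iso[OF W] lmod_hom_carrier[OF S] lmod_hom_carrier[OF T]])
      (simp only: \<eta>_natural[OF V W S] \<eta>_natural[OF V W T] eq)
qed

text \<open>The preimage is the conjugate of \<open>G(T)\<close> by the isomorphisms
  \<open>\<eta>\<close>. Its image and \<open>T\<close> agree after applying
  \<open>G\<close>.\<close>

lemma full:
  assumes V: "V \<in> lmod H" and W: "W \<in> lmod H" and T: "T \<in> lmod_hom (on_ob F V) (on_ob F W)"
  obtains S where "S \<in> lmod_hom V W" "on_hom F V W S = T"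
proof -
  note FV = ob[OF V] and FW = ob[OF W]
  note GFV = G.ob[OF FV] and GFW = G.ob[OF FW]
  define GT where "GT = on_hom G (on_ob F V) (on_ob F W) T"
  have GT: "GT \<in> lmod_hom (on_ob G (on_ob F V)) (on_ob G (on_ob F W))"
    unfolding GT_def by (rule G.hom[OF FV FW T])
  have \<eta>V: "\<eta> V \<in> lmod_hom V (on_ob G (on_ob F V))" using \<eta>_iso[OF V] unfolding lmod_iso_def by blast
  obtain \<eta>' where \<eta>': "\<eta> W \<in> lmod_hom W (on_ob G (on_ob F W))" "\<eta>' \<in> lmod_hom (on_ob G (on_ob F W)) W"
    "\<eta> W * \<eta>' = 1\<^sub>m (fst (on_ob G (on_ob F W)))"
    using lmod_isoE[OF \<eta>_iso[OF W]] by metis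
  define S where "S = \<eta>' * (GT * \<eta> V)"
  have GT\<eta>: "GT * \<eta> V \<in> lmod_hom V (on_ob G (on_ob F W))" by (rule lmod_hom_mult[OF V GFV GFW \<eta>V GT])
  have S: "S \<in> lmod_hom V W" unfolding S_def by (rule lmod_hom_mult[OF V GFW W GT\<eta> \<eta>'(2)])
  note FS = hom[OF V W S]
  have "\<eta> W * S = GT * \<eta> V"
    unfolding S_def assoc_mult_mat[OF lmod_hom_carrier[OF \<eta>'(1)] lmod_hom_carrier[OF \<eta>'(2)] lmod_hom_carrier[OF GT\<eta>], symmetric] \<eta>'(3)
    by (rule left_mult_one_mat[OF lmod_hom_carrier[OF GT\<eta>]])
  then have "on_hom G (on_ob F V) (on_ob F W) (on_hom F V W S) * \<eta> V = GT * \<eta> V"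
    by (simp only: \<eta>_natural[OF V W S])
  from lmod_iso_cancel_right[OF \<eta>_iso[OF V] lmod_hom_carrier[OF G.hom[OF FV FW FS]] lmod_hom_carrier[OF GT] this]
  have G_eq: "on_hom G (on_ob F V) (on_ob F W) (on_hom F V W S) = on_hom G (on_ob F V) (on_ob F W) T"
    unfolding GT_def .
  \<comment> \<open>Naturality of \<open>\<theta>\<close> makes \<open>G\<close> faithful.\<close>
  have "on_hom F V W S * \<theta> (on_ob F V) = T * \<theta> (on_ob F V)"
    using \<theta>_natural[OF FV FW FS] \<theta>_natural[OF FV FW T] by (simp only: G_eq)
  from lmod_iso_cancel_right[OF \<theta>_iso[OF FV] lmod_hom_carrier[OF FS] lmod_hom_carrier[OF T] this]
  show thesis by (rule that[OF S])
qed

text \<open>Take \<open>V\<close> to be \<open>G\<close> of the regular module: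
  \<open>\<theta>\<close> identifies \<open>F(V)\<close> with the regular module, which is faithful.
  Since \<open>transported\<close> only sees modules in the image of \<open>F\<close>, this is what
  determines an element of the target algebra.\<close>

lemma faithful_image:
  obtains V where "V \<in> lmod H" "inj (snd (on_ob F V))"
proof -
  obtain R coord where "regular_coordinates H' R coord"
    using A'.regular_module .
  note R = regular_coordinatesD[OF this]
  define V \<tau> where "V = on_ob G R" and "\<tau> = \<theta> R"
  have V: "V \<in> lmod H" unfolding V_def by (rule G.ob[OF R(1)])
  have \<tau>: "\<tau> \<in> lmod_iso (on_ob F V) R" unfolding V_def \<tau>_def by (rule \<theta>_iso[OF R(1)])
  have \<tau>_hom: "\<tau> \<in> lmod_hom (on_ob F V) R" using \<tau> unfolding lmod_iso_def by blast
  have "x = y" if eq: "snd (on_ob F V) x = snd (on_ob F V) y" for x y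
  proof -
    have "snd R x * \<tau> = snd R y * \<tau>"
      unfolding lmod_hom_commute[OF \<tau>_hom, symmetric] eq ..
    then have "snd R x = snd R y"
      by (rule lmod_iso_cancel_right[OF \<tau> lmod_carrier[OF R(1)] lmod_carrier[OF R(1)]])
    then have "coord (x * 1) = coord (y * 1)"
      unfolding R(5)[symmetric] by (rule arg_cong)
    then show "x = y" using R(3) by (simp add: inj_eq)
  qed
  then show thesis using V that by (meson injI)
qed

text \<open>An endomorphism commuting with all module maps is determined by its value at
  \<open>1\<close> in the regular module. The action of \<open>z\<close> is transported to that
  module, and fullness brings the needed maps into the image of \<open>F\<close>.\<close>

lemma transported_exists:
  assumes z: "\<And>V. V \<in> lmod H \<Longrightarrow> snd V z \<in> lmod_hom V V"
  obtains z' where "transported z z'"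
proof -
  obtain R coord where "regular_coordinates H' R coord"
    using A'.regular_module .
  note R = regular_coordinatesD[OF this]
  define V0 \<tau> where "V0 = on_ob G R" and "\<tau> = \<theta> R"
  have V0: "V0 \<in> lmod H" unfolding V0_def by (rule G.ob[OF R(1)])
  have \<tau>: "\<tau> \<in> lmod_iso (on_ob F V0) R" unfolding V0_def \<tau>_def by (rule \<theta>_iso[OF R(1)])
  obtain \<tau>' where \<tau>': "\<tau> \<in> lmod_hom (on_ob F V0) R" "\<tau>' \<in> lmod_hom R (on_ob F V0)" "\<tau> * \<tau>' = 1\<^sub>m (fst R)"
    using lmod_isoE[OF \<tau>] by metis
  note \<tau>c = lmod_hom_carrier[OF \<tau>'(1)] and \<tau>'c = lmod_hom_carrier[OF \<tau>'(2)]
  define B where "B = on_hom F V0 V0 (snd V0 z)"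
  have B: "B \<in> carrier_mat (Fdim V0) (Fdim V0)" unfolding B_def by (rule hom_carrier[OF V0 V0 z[OF V0]])
  have "\<tau> * (B * (\<tau>' * coord 1)) \<in> carrier_mat (fst R) 1"
    using \<tau>c B \<tau>'c R(2)[of 1] by (intro mult_carrier_mat)
  \<comment> \<open>The witness is the image of \<open>1\<close> under the transported action of
    \<open>z\<close> on the regular module.\<close>
  then obtain z' where z': "coord z' = \<tau> * (B * (\<tau>' * coord 1))" using R(4) by (metis imageE)
  have "on_hom F V V (snd V z) = snd (on_ob F V) z'" if V: "V \<in> lmod H" for V
  proof (rule eq_mat_columnI)
    note FV = ob[OF V]
    define C where "C = on_hom F V V (snd V z)"
    show Cc: "on_hom F V V (snd V z) \<in> carrier_mat (Fdim V) (Fdim V)" by (rule hom_carrier[OF V V z[OF V]])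
    then have C: "C \<in> carrier_mat (Fdim V) (Fdim V)" unfolding C_def .
    show "snd (on_ob F V) z' \<in> carrier_mat (Fdim V) (Fdim V)" by (rule lmod_carrier[OF FV])
    fix y :: "'k mat" assume y: "y \<in> carrier_mat (Fdim V) 1"
    obtain T where T: "T \<in> lmod_hom R (on_ob F V)" and T_col: "\<And>x. T * coord x = snd (on_ob F V) x * y"
      using R(6)[OF FV y] by blast
    have T\<tau>: "T * \<tau> \<in> lmod_hom (on_ob F V0) (on_ob F V)" by (rule lmod_hom_mult[OF ob[OF V0] R(1) FV \<tau>'(1) T])
    \<comment> \<open>Lifting to \<open>S\<close> is the point of fullness: \<open>S\<close>
      commutes with the action of \<open>z\<close>, so \<open>T * \<tau>\<close> commutes with its
      image. As \<open>T\<close> sends \<open>1\<close> to \<open>y\<close>, the value at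
      \<open>y\<close> is forced.\<close>
    obtain S where S: "S \<in> lmod_hom V0 V" and FS: "on_hom F V0 V S = T * \<tau>" using full[OF V0 V T\<tau>] .
    note Tc = lmod_hom_carrier[OF T] and T\<tau>c = lmod_hom_carrier[OF T\<tau>]
    have "C * (T * \<tau>) = T * \<tau> * B"
      using arg_cong[OF lmod_hom_commute[OF S, of z], of "on_hom F V0 V"]
      unfolding comp[OF V0 V0 V z[OF V0] S] comp[OF V0 V V S z[OF V]] FS C_def B_def by (rule sym)
    then have commute: "C * (T * \<tau>) * (\<tau>' * coord 1) = T * \<tau> * B * (\<tau>' * coord 1)" by (rule arg_cong)
    have \<tau>'1: "\<tau>' * coord 1 \<in> carrier_mat (Fdim V0) 1" by (rule mult_carrier_mat[OF \<tau>'c R(2)])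
    have "T * \<tau> * (\<tau>' * coord 1) = T * (\<tau> * \<tau>' * coord 1)"
      unfolding assoc_mult_mat[OF \<tau>c \<tau>'c R(2)] by (rule assoc_mult_mat[OF Tc \<tau>c \<tau>'1])
    also have "\<dots> = y"
      unfolding \<tau>'(3) left_mult_one_mat[OF R(2)] T_col lmodD(4)[OF FV] by (rule left_mult_one_mat[OF y])
    finally have T1: "T * \<tau> * (\<tau>' * coord 1) = y" .
    have "C * y = T * \<tau> * B * (\<tau>' * coord 1)"
      using commute unfolding assoc_mult_mat[OF C T\<tau>c \<tau>'1] T1 .
    also have "\<dots> = T * coord z'"
      unfolding z' assoc_mult_mat[OF T\<tau>c B \<tau>'1] by (rule assoc_mult_mat[OF Tc \<tau>c mult_carrier_mat[OF B \<tau>'1]])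
    finally show "on_hom F V V (snd V z) * y = snd (on_ob F V) z' * y"
      unfolding T_col C_def .
  qed
  with z show thesis by (intro that[of z']) (simp add: transported_def)
qed

lemma transported_eq_zero:
  assumes "transported 0 x"
  shows "x = 0"
proof -
  obtain V where V: "V \<in> lmod H" and inj: "inj (snd (on_ob F V))"
    using faithful_image .
  show ?thesis
    by (rule injD[OF inj]) (simp only: transportedD(2)[OF assms V, symmetric] transportedD(2)[OF transported_zero V])
qed

text \<open>Faithfulness of \<open>F\<close>, applied to the regular module of the source. It
  guarantees that a nonzero integral has a nonzero counterpart.\<close>

lemma transported_eq_zero_left:
  assumes x: "transported x 0"
  shows "x = 0"
proof -
  obtain R coord where "regular_coordinates H R coord"
    using A.regular_module .
  note R = regular_coordinatesD[OF this]
  note zero = transportedD[OF transported_zero R(1)] and x = transportedD[OF x R(1)]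
  have "snd R x = snd R 0"
    by (rule faithful[OF R(1) R(1) x(1) zero(1)]) (simp only: x(2) zero(2))
  then have "coord (x * 1) = coord (0 * 1)" unfolding R(5)[symmetric] by (rule arg_cong)
  then show ?thesis using R(3) by (simp only: inj_eq mult_1_right)
qed

text \<open>It suffices to compare both sides on one faithful module \<open>F(V)\<close>, where
  \<open>integral_image\<close> gives the invariance.\<close>

lemma left_integral_transport:
  assumes x: "transported x x'" and fac: "\<And>V. V \<in> lmod H \<Longrightarrow> factors_trivially H V (snd V x)"
  shows "left_integral H' x'"
  unfolding left_integral_def
proof
  fix a
  obtain V where V: "V \<in> lmod H" and inj: "inj (snd (on_ob F V))"
    using faithful_image .
  show "a * x' = Defs.scale H' (counit H' a) x'"
    by (rule injD[OF inj]) (simp only: lmodD(2,3)[OF ob[OF V]] transportedD(2)[OF x V, symmetric] integral_image[OF V fac[OF V]])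
qed

end

theorem proposition4p2:
  fixes A :: "('k::field, 'a::ring_1) hopf" and A' :: "('k, 'b::ring_1) hopf"
    and \<Lambda> :: 'a and s :: nat and \<psi> :: "'k polynomial" and n :: "nat \<Rightarrow> int"
  assumes "fin_dim_hopf_algebra A" and "fin_dim_hopf_algebra A'"
    and "unimodular A" and "unimodular A'"
    and "gauge_equivalent A A'"
    and "left_integral A \<Lambda>" and "\<Lambda> \<noteq> 0"
    and "in_variables s \<psi>"
    and "eval_poly A s \<psi> (\<lambda>i. sweedler_power A (n i) \<Lambda>) = 0"
  shows "\<exists>\<Lambda>'. left_integral A' \<Lambda>' \<and> \<Lambda>' \<noteq> 0 \<and>
           eval_poly A' s \<psi> (\<lambda>i. sweedler_power A' (n i) \<Lambda>') = 0"
proof -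
  obtain F J \<phi> where F: "linear_equivalence A A' F" "tensor_functor A A' F J \<phi>"
    using assms(5) unfolding gauge_equivalent_def by blast
  obtain G \<eta> \<theta> where "linear_functor A' A G" "natural_iso A id_functor (comp_functor G F) \<eta>"
    "natural_iso A' (comp_functor F G) id_functor \<theta>"
    using linear_equivalence.quasi_inverse[OF F(1)] by blast
  with F(2) interpret gauge_equivalence A A' F J \<phi> G \<eta> \<theta>
    using assms(1,2)
    by (simp add: gauge_equivalence_def gauge_equivalence_axioms_def hopf_tensor_functor_def fin_dim_hopf_algebra_def)
  \<comment> \<open>Unimodularity of \<open>A\<close> makes \<open>\<Lambda>\<close> invariant on
    both sides, hence its action factors through the trivial module.\<close>
  have "right_integral A \<Lambda>"
    using assms(3,6) by (simp add: unimodular_def)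
  then have fac: "factors_trivially A V (snd V \<Lambda>)" if "V \<in> lmod A" for V
    using A.factors_trivially_integral[OF that assms(6)] by blast
  obtain \<Lambda>' where \<Lambda>': "transported \<Lambda> \<Lambda>'"
    using transported_exists[OF A.factors_trivially_hom[OF _ fac]] by blast
  \<comment> \<open>The polynomial value on the \<open>A\<close> side is zero by assumption, so its
    counterpart is related to zero and must vanish.\<close>
  have "transported 0 (eval_poly A' s \<psi> (\<lambda>i. sweedler_power A' (n i) \<Lambda>'))"
    using transported_eval_poly[OF transported_sweedler_power[OF \<Lambda>' fac], of s \<psi> n] assms(9) by simp
  then have "eval_poly A' s \<psi> (\<lambda>i. sweedler_power A' (n i) \<Lambda>') = 0"
    by (rule transported_eq_zero)
  moreover have "\<Lambda>' \<noteq> 0"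
    using transported_eq_zero_left \<Lambda>' assms(7) by blast
  ultimately show ?thesis
    using left_integral_transport[OF \<Lambda>' fac] by blast
qed

end
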